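(* Let $N\ge 1$ and let $a\in\Phi_r(K_1^1)\cap\Phi_l(K_1^1)$ be an $N\times N$ matrix function, with right canonical Wiener-Hopf factorization $a=u_-u_+$ in $K_1^1$ and left canonical Wiener-Hopf factorization $a=v_+v_-$ in $K_1^1$. Put $b=v_-u_+^{-1}$ and $c=u_-^{-1}v_+$. Then for all integers $n\ge 1$, $$\det T_n(a)=G(a)^n\,E(a)\,2^{-nN}\det\bigl(I+P-L(c)Q_nL(b)\bigr),$$ where $G(a)=(\det v_+)_0(\det v_-)_0$, $E(a)=1/\det\bigl(I-H(b)H(\tilde c)\bigr)$, and the operator $I+P-L(c)Q_nL(b)$ acts on $\ell^2(\mathbf Z,\mathbf C^N)$.
   Context: $\mathbf T$ is the complex unit circle, $\mathbf Z_+=\{0,1,2,\dots\}$, and $L^\infty=L^\infty_{N\times N}$ is the algebra of all $N\times N$ matrix functions with entries in $L^\infty(\mathbf T)$. For a (matrix or scalar) function $a$ on $\mathbf T$, $a_k=(a)_k=\frac1{2\pi}\int_0^{2\pi}a(e^{i\theta})e^{-ik\theta}\,d\theta$ ($k\in\mathbf Z$) denotes its $k$th Fourier coefficient. Fix any matrix norm $\|\cdot\|$ on $\mathbf C^{N\times N}$. Put $K_1^1=\{a\in L^\infty:\sum_{n\in\mathbf Z}(|n|+1)\|a_n\|<\infty\}$ and $H^\infty_\pm=\{a\in L^\infty: a_{\mp n}=0\text{ for } n>0\}$. For a subset $E\subset L^\infty$, $a\in\Phi_r(E)$ means that $a$ has a right canonical Wiener-Hopf factorization in $E$, i.e. $a=u_-u_+$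 with $u_-,u_-^{-1}\in E\cap H^\infty_-$ and $u_+,u_+^{-1}\in E\cap H^\infty_+$; $a\in\Phi_l(E)$ means that $a$ has a left canonical Wiener-Hopf factorization in $E$, i.e. $a=v_+v_-$ with $v_-,v_-^{-1}\in E\cap H^\infty_-$ and $v_+,v_+^{-1}\in E\cap H^\infty_+$. Block matrices: $T_n(a)=(a_{j-k})_{j,k=0}^{n-1}$ (finite block Toeplitz); $H(a)=(a_{j+k+1})_{j,k=0}^\infty$ and $H(\tilde a)=(a_{-j-k-1})_{j,k=0}^\infty$ (block Hankel), acting on $\ell^2(\mathbf Z_+,\mathbf C^N)$; $L(a)=(a_{j-k})_{j,k=-\infty}^\infty$ (block Laurent), acting on $\ell^2(\mathbf Z,\mathbf C^N)$. Projections on $\ell^2(\mathbf Z,\mathbf C^N)$: $(Px)_k=x_k$ for $k\ge0$ and $0$ for $k<0$; $(Q_nx)_k=x_k$ for $k\ge n$ and $0$ for $k<n$. For the $b,c$ in the claim, $b,c\in K_1^1$ and $bc=I$, the operators $H(b)H(\tilde c)$ and $P-L(c)Q_nL(b)$ are trace class, and $I-H(b)H(\tilde c)$ is invertible, so $E(a)$ is well defined. Determinants of identity plus trace class operators are Fredholm determinants. *)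

theory Defs
  imports "HOL-Analysis.Analysis" "HOL-Library.Function_Algebras"
begin

section \<open>Matrix functions on the unit circle\<close>

text \<open>
  An element of \<open>L\<^sup>\<infinity>\<close> is represented by a function on the complex plane of which only the values
  on the unit circle matter; identities between such functions are required almost everywhere
  with respect to arc length.
\<close>

abbreviation angles :: "real measure" where
  "angles \<equiv> lebesgue_on {0..2 * pi}"

definition fourier :: "(complex \<Rightarrow> complex) \<Rightarrow> int \<Rightarrow> complex" where
  "fourier f k = (LINT \<theta>|angles. f (cis \<theta>) * cis (- (of_int k * \<theta>))) / (2 * pi)"

definition mfourier :: "(complex \<Rightarrow> complex^'n^'n) \<Rightarrow> int \<Rightarrow> complex^'n^'n" where
  "mfourier a k = (\<chi> p q. fourier (\<lambda>z. a z $ p $ q) k)"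

definition Linf :: "(complex \<Rightarrow> complex^'n^'n) set" where
  "Linf = {a. (\<lambda>\<theta>. a (cis \<theta>)) \<in> borel_measurable angles \<and>
              (\<exists>C. AE \<theta> in angles. norm (a (cis \<theta>)) \<le> C)}"

text \<open>
  The norm below is the Frobenius norm. Any other norm on the space of matrices gives the same
  set, see \<open>K11_norm_independent\<close>.
\<close>

definition K11 :: "(complex \<Rightarrow> complex^'n^'n) set" where
  "K11 = {a \<in> Linf. (\<lambda>n::int. (of_int \<bar>n\<bar> + 1) * norm (mfourier a n)) summable_on UNIV}"

definition Hinf_plus :: "(complex \<Rightarrow> complex^'n^'n) set" where
  "Hinf_plus = {a \<in> Linf. \<forall>n>0. mfourier a (- n) = 0}"

definition Hinf_minus :: "(complex \<Rightarrow> complex^'n^'n) set" where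
  "Hinf_minus = {a \<in> Linf. \<forall>n>0. mfourier a n = 0}"

definition mmult ::
  "(complex \<Rightarrow> complex^'n^'n) \<Rightarrow> (complex \<Rightarrow> complex^'n^'n) \<Rightarrow> complex \<Rightarrow> complex^'n^'n"
  (infixl "\<odot>" 70) where
  "u \<odot> v = (\<lambda>z. u z ** v z)"

text \<open>
  \<^const>\<open>matrix_inv\<close> is only meaningful at invertible matrices, so \<open>minv u\<close> is the
  inverse of \<open>u\<close> in the algebra \<open>L\<^sup>\<infinity>\<close> exactly if it lies in \<open>L\<^sup>\<infinity>\<close> and
  \<open>u\<close> is invertible almost everywhere.
\<close>

definition minv :: "(complex \<Rightarrow> complex^'n^'n) \<Rightarrow> complex \<Rightarrow> complex^'n^'n" where
  "minv u = (\<lambda>z. matrix_inv (u z))"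

definition unit_in :: "(complex \<Rightarrow> complex^'n^'n) set \<Rightarrow> (complex \<Rightarrow> complex^'n^'n) \<Rightarrow> bool" where
  "unit_in A u \<longleftrightarrow> u \<in> A \<and> (AE \<theta> in angles. invertible (u (cis \<theta>))) \<and> minv u \<in> A"

definition right_factorization ::
  "(complex \<Rightarrow> complex^'n^'n) set \<Rightarrow> (complex \<Rightarrow> complex^'n^'n) \<Rightarrow>
   (complex \<Rightarrow> complex^'n^'n) \<Rightarrow> (complex \<Rightarrow> complex^'n^'n) \<Rightarrow> bool" where
  "right_factorization E a um up \<longleftrightarrow>
     (AE \<theta> in angles. a (cis \<theta>) = (um \<odot> up) (cis \<theta>)) \<and>
     unit_in (E \<inter> Hinf_minus) um \<and> unit_in (E \<inter> Hinf_plus) up"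

definition left_factorization ::
  "(complex \<Rightarrow> complex^'n^'n) set \<Rightarrow> (complex \<Rightarrow> complex^'n^'n) \<Rightarrow>
   (complex \<Rightarrow> complex^'n^'n) \<Rightarrow> (complex \<Rightarrow> complex^'n^'n) \<Rightarrow> bool" where
  "left_factorization E a vp vm \<longleftrightarrow>
     (AE \<theta> in angles. a (cis \<theta>) = (vp \<odot> vm) (cis \<theta>)) \<and>
     unit_in (E \<inter> Hinf_minus) vm \<and> unit_in (E \<inter> Hinf_plus) vp"

definition Phi_r :: "(complex \<Rightarrow> complex^'n^'n) set \<Rightarrow> (complex \<Rightarrow> complex^'n^'n) set" where
  "Phi_r E = {a. \<exists>um up. right_factorization E a um up}"

definition Phi_l :: "(complex \<Rightarrow> complex^'n^'n) set \<Rightarrow> (complex \<Rightarrow> complex^'n^'n) set" where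
  "Phi_l E = {a. \<exists>vp vm. left_factorization E a vp vm}"

lemma K11_norm_independent:
  fixes nrm :: "complex^'n^'n \<Rightarrow> real" and a :: "complex \<Rightarrow> complex^'n^'n"
  assumes pos: "\<And>A. nrm A = 0 \<longleftrightarrow> A = 0"
    and tri: "\<And>A B. nrm (A + B) \<le> nrm A + nrm B"
    and hom: "\<And>t A. nrm (t *\<^sub>R A) = \<bar>t\<bar> * nrm A"
  shows "a \<in> K11 \<longleftrightarrow>
    a \<in> Linf \<and> (\<lambda>n::int. (of_int \<bar>n\<bar> + 1) * nrm (mfourier a n)) summable_on UNIV"
proof -
  have nn: "0 \<le> nrm A" for A
    using tri[of A "- A"] hom[of "-1" A] pos[of 0] by simp
  have nsum: "nrm (\<Sum>i\<in>I. f i) \<le> (\<Sum>i\<in>I. nrm (f i))" if "finite I"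
    for I and f :: "complex^'n^'n \<Rightarrow> complex^'n^'n"
    using that
  proof (induction I)
    case empty
    then show ?case using pos[of 0] by simp
  next
    case (insert i I)
    then show ?case using tri[of "f i" "sum f I"] by simp
  qed
  define M where "M = (\<Sum>e\<in>(Basis :: (complex^'n^'n) set). nrm e)"
  have up: "nrm A \<le> M * norm A" for A
  proof -
    have "nrm A = nrm (\<Sum>e\<in>Basis. (A \<bullet> e) *\<^sub>R e)"
      by (simp add: euclidean_representation)
    also have "\<dots> \<le> (\<Sum>e\<in>Basis. \<bar>A \<bullet> e\<bar> * nrm e)"
      using nsum[of Basis "\<lambda>e. (A \<bullet> e) *\<^sub>R e"] by (simp add: hom)
    also have "\<dots> \<le> (\<Sum>e\<in>Basis. norm A * nrm e)"
      by (intro sum_mono mult_right_mono Basis_le_norm nn)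
    finally show ?thesis by (simp add: M_def sum_distrib_left mult.commute)
  qed
  have M0: "0 \<le> M" unfolding M_def by (intro sum_nonneg nn)
  have "\<bar>nrm A - nrm B\<bar> \<le> M * norm (A - B)" for A B
  proof -
    have "nrm A \<le> nrm B + nrm (A - B)" using tri[of B "A - B"] by simp
    moreover have "nrm B \<le> nrm A + nrm (A - B)"
      using tri[of A "B - A"] hom[of "-1" "A - B"] by simp
    ultimately show ?thesis using up[of "A - B"] by linarith
  qed
  then have "M-lipschitz_on UNIV nrm"
    using M0 by (intro lipschitz_onI) (simp_all add: dist_norm)
  then have cont: "continuous_on S nrm" for S
    by (meson lipschitz_on_continuous_on continuous_on_subset subset_UNIV)
  obtain e :: "complex^'n^'n" where e: "e \<in> Basis" using nonempty_Basis by blast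
  then have "e \<in> sphere 0 1" by simp
  then obtain A0 where A0: "A0 \<in> sphere 0 1" "\<And>A. A \<in> sphere 0 1 \<Longrightarrow> nrm A0 \<le> nrm A"
    using continuous_attains_inf[OF compact_sphere _ cont, of 0 1] by blast
  define m where "m = nrm A0"
  have "A0 \<noteq> 0" using A0(1) by auto
  then have m: "0 < m" using nn[of A0] pos[of A0] by (simp add: m_def)
  have lo: "m * norm A \<le> nrm A" for A
  proof (cases "A = 0")
    case False
    then have "m \<le> nrm ((1 / norm A) *\<^sub>R A)" unfolding m_def by (intro A0) simp
    then show ?thesis using False by (simp add: hom field_simps)
  qed (simp add: nn)
  let ?w = "\<lambda>n::int. of_int \<bar>n\<bar> + 1 :: real"
  have "(\<lambda>n. ?w n * norm (mfourier a n)) summable_on UNIV \<longleftrightarrow>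
        (\<lambda>n. ?w n * nrm (mfourier a n)) summable_on UNIV" (is "?L \<longleftrightarrow> ?R")
  proof
    assume ?L
    then have "(\<lambda>n. M * (?w n * norm (mfourier a n))) summable_on UNIV"
      by (rule summable_on_cmult_right)
    then show ?R
    proof (rule summable_on_comparison_test)
      fix n :: int
      show "?w n * nrm (mfourier a n) \<le> M * (?w n * norm (mfourier a n))"
        using mult_left_mono[OF up[of "mfourier a n"], of "?w n"] by (simp add: mult_ac)
      show "0 \<le> ?w n * nrm (mfourier a n)" by (simp add: nn)
    qed
  next
    assume ?R
    then have "(\<lambda>n. (1 / m) * (?w n * nrm (mfourier a n))) summable_on UNIV"
      by (rule summable_on_cmult_right)
    then show ?L
    proof (rule summable_on_comparison_test)
      fix n :: int
      have "norm (mfourier a n) \<le> nrm (mfourier a n) / m"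
        using lo[of "mfourier a n"] m by (simp add: field_simps)
      from mult_left_mono[OF this, of "?w n"]
      show "?w n * norm (mfourier a n) \<le> (1 / m) * (?w n * nrm (mfourier a n))" by simp
      show "0 \<le> ?w n * norm (mfourier a n)" by simp
    qed
  qed
  then show ?thesis by (simp add: K11_def)
qed

section \<open>Operators on square summable sequences\<close>

text \<open>
  \<open>'i\<close> is \<^typ>\<open>nat\<close> or \<^typ>\<open>int\<close>. Operators are written as maps on all sequences, but only their
  action on \<open>ell2\<close> is relevant; sums and differences of operators are pointwise.
\<close>

definition ell2 :: "('i \<Rightarrow> complex^'n) set" where
  "ell2 = {x. (\<lambda>k. (norm (x k))\<^sup>2) summable_on UNIV}"

definition ell2_norm :: "('i \<Rightarrow> complex^'n) \<Rightarrow> real" where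
  "ell2_norm x = sqrt (\<Sum>\<^sub>\<infinity>k. (norm (x k))\<^sup>2)"

definition ell2_inner :: "('i \<Rightarrow> complex^'n) \<Rightarrow> ('i \<Rightarrow> complex^'n) \<Rightarrow> complex" where
  "ell2_inner x y = (\<Sum>\<^sub>\<infinity>k. \<Sum>p\<in>UNIV. x k $ p * cnj (y k $ p))"

definition hankel ::
  "(complex \<Rightarrow> complex^'n^'n) \<Rightarrow> (nat \<Rightarrow> complex^'n) \<Rightarrow> nat \<Rightarrow> complex^'n" where
  "hankel a x = (\<lambda>j. \<Sum>\<^sub>\<infinity>k. mfourier a (int j + int k + 1) *v x k)"

definition hankel_tilde ::
  "(complex \<Rightarrow> complex^'n^'n) \<Rightarrow> (nat \<Rightarrow> complex^'n) \<Rightarrow> nat \<Rightarrow> complex^'n" where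
  "hankel_tilde a x = (\<lambda>j. \<Sum>\<^sub>\<infinity>k. mfourier a (- int j - int k - 1) *v x k)"

definition laurent ::
  "(complex \<Rightarrow> complex^'n^'n) \<Rightarrow> (int \<Rightarrow> complex^'n) \<Rightarrow> int \<Rightarrow> complex^'n" where
  "laurent a x = (\<lambda>j. \<Sum>\<^sub>\<infinity>k. mfourier a (j - k) *v x k)"

definition proj_P :: "(int \<Rightarrow> complex^'n) \<Rightarrow> int \<Rightarrow> complex^'n" where
  "proj_P x = (\<lambda>k. if k \<ge> 0 then x k else 0)"

definition proj_Q :: "nat \<Rightarrow> (int \<Rightarrow> complex^'n) \<Rightarrow> int \<Rightarrow> complex^'n" where
  "proj_Q n x = (\<lambda>k. if k \<ge> int n then x k else 0)"

section \<open>Determinants\<close>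

text \<open>
  The determinant of a square matrix whose rows and columns are indexed by the finite set \<open>S\<close>;
  it extends \<^const>\<open>det\<close>, where the index set is a whole type.
\<close>

definition det_on :: "'k set \<Rightarrow> ('k \<Rightarrow> 'k \<Rightarrow> complex) \<Rightarrow> complex" where
  "det_on S M = (\<Sum>\<pi> | \<pi> permutes S. of_int (sign \<pi>) * (\<Prod>i\<in>S. M i (\<pi> i)))"

lemma det_on_UNIV: "det_on UNIV (\<lambda>i j. A $ i $ j) = det A"
  by (simp add: det_on_def det_def)

definition det_toeplitz :: "nat \<Rightarrow> (complex \<Rightarrow> complex^'n^'n) \<Rightarrow> complex" where
  "det_toeplitz n a =
     det_on ({..<n} \<times> (UNIV :: 'n set)) (\<lambda>(j, p) (k, q). mfourier a (int j - int k) $ p $ q)"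

text \<open>
  Trace class operators on \<open>\<ell>\<^sup>2\<close>: absolutely convergent sums of rank one operators
  \<open>x \<mapsto> \<langle>x, g\<^sub>m\<rangle> f\<^sub>m\<close>. As the series converges absolutely in norm, coordinatewise convergence
  determines its sum.
\<close>

definition trace_class :: "(('i \<Rightarrow> complex^'n) \<Rightarrow> 'i \<Rightarrow> complex^'n) \<Rightarrow> bool" where
  "trace_class K \<longleftrightarrow>
     (\<exists>f g :: nat \<Rightarrow> 'i \<Rightarrow> complex^'n.
        (\<forall>m. f m \<in> ell2 \<and> g m \<in> ell2) \<and>
        summable (\<lambda>m. ell2_norm (f m) * ell2_norm (g m)) \<and>
        (\<forall>x\<in>ell2. \<forall>k. (\<lambda>m. ell2_inner x (g m) *s f m k) sums K x k))"

definition unit_vec :: "'i \<times> 'n \<Rightarrow> 'i \<Rightarrow> complex^'n" where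
  "unit_vec = (\<lambda>(j, q) k. if k = j then axis q 1 else 0)"

definition entry ::
  "(('i \<Rightarrow> complex^'n) \<Rightarrow> 'i \<Rightarrow> complex^'n) \<Rightarrow> 'i \<times> 'n \<Rightarrow> 'i \<times> 'n \<Rightarrow> complex" where
  "entry K = (\<lambda>(i, p) s. K (unit_vec s) i $ p)"

text \<open>
  The Fredholm determinant of \<open>A = I + K\<close>, \<open>K\<close> trace class, is \<open>\<Sum>\<^sub>m tr (\<Lambda>\<^sup>m K)\<close>. The trace of
  \<open>\<Lambda>\<^sup>m K\<close>, taken in the orthonormal basis of the \<open>m\<close>-fold wedge products of the vectors
  \<open>unit_vec s\<close>, is the sum of the \<open>m \<times> m\<close> principal minors of the matrix of \<open>K\<close>, so the
  determinant is the (absolutely convergent) sum of all finite principal minors: Fredholm's series.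
\<close>

definition fredholm_det :: "(('i \<Rightarrow> complex^'n) \<Rightarrow> 'i \<Rightarrow> complex^'n) \<Rightarrow> complex" where
  "fredholm_det A =
     (if trace_class (A - id) then \<Sum>\<^sub>\<infinity>S | finite S. det_on S (entry (A - id)) else 0)"

definition G_const :: "(complex \<Rightarrow> complex^'n^'n) \<Rightarrow> (complex \<Rightarrow> complex^'n^'n) \<Rightarrow> complex" where
  "G_const vp vm = fourier (\<lambda>z. det (vp z)) 0 * fourier (\<lambda>z. det (vm z)) 0"

definition E_const :: "(complex \<Rightarrow> complex^'n^'n) \<Rightarrow> (complex \<Rightarrow> complex^'n^'n) \<Rightarrow> complex" where
  "E_const b c = 1 / fredholm_det (id - (hankel b \<circ> hankel_tilde c))"

end

theory Submission
  imports Defs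
begin

text \<open>
  Operators are handled as infinite matrices whose index consists of an integer and one of the \<open>N\<close> coordinates.
  Let \<open>U\<^sub>+, U\<^sub>-, V\<^sub>+, V\<^sub>-\<close> be the Laurent matrices of the factors \<open>u\<^sub>+, u\<^sub>-, v\<^sub>+, v\<^sub>-\<close>. Those with index \<open>+\<close> and their
  inverses are lower triangular, those with index \<open>-\<close> upper triangular, and \<open>U\<^sub>- U\<^sub>+ = V\<^sub>+ V\<^sub>-\<close> is the Laurent
  matrix of \<open>a\<close>. The Laurent matrices \<open>B = V\<^sub>- U\<^sub>+\<^sup>-\<^sup>1\<close> of \<open>b\<close> and \<open>C = U\<^sub>-\<^sup>-\<^sup>1 V\<^sub>+ = U\<^sub>+ V\<^sub>-\<^sup>-\<^sup>1\<close> of \<open>c\<close> are inverse to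
  each other. Let \<open>P\<close> and \<open>Q\<close> be the projections to the integers \<open>\<ge> 0\<close> and \<open>\<ge> n\<close>. Both sides of the formula are
  multiples of \<open>d = det (1 - Q + Q B P C Q)\<close>.

  For the left hand side, let \<open>J = 1 - P B (1 - P) C P\<close>; on the integers \<open>\<ge> 0\<close> this is \<open>I - H(b) H(c\<^sup>~)\<close>. As \<open>B C = 1\<close>,
  it is the compression of \<open>B P C\<close> there, a product of four compressed triangular matrices, and its inverse \<open>M\<close>
  satisfies \<open>P V\<^sub>+ P M P V\<^sub>- P = P U\<^sub>- U\<^sub>+ P\<close>. The \<open>n\<close>th section of this equation reads \<open>det T\<^sub>n(a) = G(a)\<^sup>n \<mu>\<close>, where \<open>\<mu>\<close> is
  the minor of \<open>M\<close> in the blocks \<open>0, \<dots>, n - 1\<close>, and by Jacobi's theorem on complementary minors \<open>\<mu> det J = d\<close>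
  (\<open>toeplitz_minor_identity\<close>, a form of the Borodin-Okounkov identity).

  For the right hand side, conjugation by \<open>U\<^sub>+\<close> turns \<open>1 + P - C Q B\<close> into \<open>1 + X - Y\<close> with two oblique projections,
  \<open>X\<close> with the range of \<open>P\<close> and \<open>Y\<close> with the kernel of \<open>Q\<close>. In block form with respect to \<open>1 - P\<close>, \<open>P - Q\<close>, \<open>Q\<close>, its
  middle column is \<open>(0, 2, 0)\<close>, which accounts for the factor \<open>2\<^sup>n\<^sup>N\<close>, and elimination in the remaining blocks
  leaves \<open>d\<close> (\<open>fdet_projection_difference\<close>).

  The determinants involved are Fredholm series, sums of all finite principal minors. In \<open>K11\<close> the coefficient
  \<open>a\<^sub>k\<close> occurs \<open>\<bar>k\<bar>\<close> times in a corner \<open>P L(a) (1 - P)\<close> or \<open>(1 - P) L(a) P\<close>, so the weight makes the entries of these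
  corners, and with them those of all perturbations of the identity above, absolutely summable. The minors are then
  dominated by permanents whose sum converges (\<open>sum_permanent_on_le\<close>), and the product rule and
  \<open>det (1 + A B) = det (1 + B A)\<close> pass from finite matrices to the limit (\<open>tendsto_fredholm_series\<close>).

  That Laurent matrices multiply like their symbols is the convolution theorem \<open>fourier_mult\<close>. It rests on the
  uniqueness of Fourier coefficients (\<open>no_fourier_AE_0\<close>): a function with an absolutely convergent Fourier series is
  almost everywhere equal to the sum of this series.
\<close>

section \<open>Finite determinants and permanents\<close>

lemma det_on_cong:
  assumes "\<And>i j. i \<in> S \<Longrightarrow> j \<in> S \<Longrightarrow> M i j = N i j"
  shows "det_on S M = det_on S N"
  unfolding det_on_def
  by (intro sum.cong refl arg_cong2[where f="(*)"] prod.cong) (auto simp: assms permutes_in_image)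

lemma det_on_zero_row:
  assumes "finite S" "i \<in> S" "\<And>j. j \<in> S \<Longrightarrow> M i j = 0"
  shows "det_on S M = 0"
  unfolding det_on_def
proof (intro sum.neutral ballI)
  fix \<pi> assume "\<pi> \<in> {\<pi>. \<pi> permutes S}"
  then have "M i (\<pi> i) = 0" using assms by (auto simp: permutes_in_image)
  then show "of_int (sign \<pi>) * (\<Prod>i\<in>S. M i (\<pi> i)) = 0"
    using assms(1,2) by (auto intro: prod_zero)
qed

lemma det_on_zero_col:
  assumes "finite S" "j \<in> S" "\<And>i. i \<in> S \<Longrightarrow> M i j = 0"
  shows "det_on S M = 0"
  unfolding det_on_def
proof (intro sum.neutral ballI)
  fix \<pi> assume "\<pi> \<in> {\<pi>. \<pi> permutes S}"
  then obtain i where "i \<in> S" "\<pi> i = j"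
    using assms(2) by (metis mem_Collect_eq permutes_image imageE)
  then have "M i (\<pi> i) = 0" using assms by auto
  then show "of_int (sign \<pi>) * (\<Prod>i\<in>S. M i (\<pi> i)) = 0"
    using assms(1) \<open>i \<in> S\<close> by (auto intro: prod_zero)
qed

text \<open>
  Relabelling the indices conjugates each permutation and keeps its sign.
\<close>

lemma det_on_reindex:
  assumes "finite S" "inj_on f S"
  shows "det_on (f ` S) M = det_on S (\<lambda>i j. M (f i) (f j))"
proof -
  have bij: "bij_betw (map_permutation S f) {\<pi>. \<pi> permutes S} {\<pi>. \<pi> permutes f ` S}"
    using assms(2) bij_betw_permutations[of f S "f ` S"]
    by (simp add: map_permutation_def[abs_def] restrict_id_def[abs_def] inj_on_imp_bij_betw o_def)
  show ?thesis
    unfolding det_on_def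
  proof (subst sum.reindex_bij_betw[OF bij, symmetric], intro sum.cong refl)
    fix \<pi> assume "\<pi> \<in> {\<pi>. \<pi> permutes S}"
    then have \<pi>: "\<pi> permutes S" by simp
    have "(\<Prod>i\<in>f ` S. M i (map_permutation S f \<pi> i)) = (\<Prod>i\<in>S. M (f i) (f (\<pi> i)))"
      using assms \<pi> by (simp add: prod.reindex map_permutation_apply cong: prod.cong)
    then show "of_int (sign (map_permutation S f \<pi>)) * (\<Prod>i\<in>f ` S. M i (map_permutation S f \<pi> i))
        = of_int (sign \<pi>) * (\<Prod>i\<in>S. M (f i) (f (\<pi> i)))"
      using sign_map_permutation[OF assms(2) \<pi> assms(1)] by simp
  qed
qed

text \<open>
  Composing with the transposition of the two equal rows preserves the products and flips the signs.
\<close>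

lemma det_on_eq_rows:
  assumes "finite S" "a \<in> S" "b \<in> S" "a \<noteq> b" "\<And>j. j \<in> S \<Longrightarrow> M a j = M b j"
  shows "det_on S M = 0"
proof -
  let ?t = "Transposition.transpose a b"
  have t: "?t permutes S" using assms by (simp add: permutes_swap_id)
  have "det_on S M = (\<Sum>\<pi> | \<pi> permutes S. of_int (sign (\<pi> \<circ> ?t)) * (\<Prod>i\<in>S. M i ((\<pi> \<circ> ?t) i)))"
    unfolding det_on_def
    by (rule sum_permutations_compose_right[OF t])
  also have "\<dots> = (\<Sum>\<pi> | \<pi> permutes S. - (of_int (sign \<pi>) * (\<Prod>i\<in>S. M i (\<pi> i))))"
  proof (intro sum.cong refl)
    fix \<pi> assume "\<pi> \<in> {\<pi>. \<pi> permutes S}"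
    then have \<pi>: "\<pi> permutes S" by simp
    have s: "sign (\<pi> \<circ> ?t) = - sign \<pi>"
      using \<pi> assms by (subst sign_compose) (auto simp: sign_swap_id permutation_swap_id permutation_permutes intro: permutation_swap_id[unfolded permutation_permutes])
    have "(\<Prod>i\<in>S. M i ((\<pi> \<circ> ?t) i)) = (\<Prod>i\<in>S. M (?t i) (\<pi> (?t i)))"
      using assms \<pi> by (intro prod.cong) (auto simp: Transposition.transpose_def permutes_in_image)
    also have "\<dots> = (\<Prod>i\<in>S. M i (\<pi> i))"
      by (rule prod.permute[OF t, symmetric, unfolded o_def])
    finally show "of_int (sign (\<pi> \<circ> ?t)) * (\<Prod>i\<in>S. M i ((\<pi> \<circ> ?t) i)) =
        - (of_int (sign \<pi>) * (\<Prod>i\<in>S. M i (\<pi> i)))"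
      by (simp add: s)
  qed
  finally have "det_on S M = - det_on S M" by (simp add: det_on_def sum_negf)
  then show ?thesis by simp
qed

lemma det_on_permute_rows:
  assumes "finite S" and p: "p permutes S"
  shows "det_on S (\<lambda>i j. M (p i) j) = of_int (sign p) * det_on S M"
proof -
  have "det_on S (\<lambda>i j. M (p i) j) =
     (\<Sum>\<pi> | \<pi> permutes S. of_int (sign (\<pi> \<circ> p)) * (\<Prod>i\<in>S. M (p i) ((\<pi> \<circ> p) i)))"
    unfolding det_on_def
    by (rule sum_permutations_compose_right[OF p])
  also have "\<dots> = (\<Sum>\<pi> | \<pi> permutes S. of_int (sign p) * (of_int (sign \<pi>) * (\<Prod>i\<in>S. M i (\<pi> i))))"
  proof (intro sum.cong refl)
    fix \<pi> assume "\<pi> \<in> {\<pi>. \<pi> permutes S}"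
    then have \<pi>: "\<pi> permutes S" by simp
    have s: "sign (\<pi> \<circ> p) = sign \<pi> * sign p"
      using \<pi> assms by (intro sign_compose) (auto simp: permutation_permutes)
    have "(\<Prod>i\<in>S. M (p i) ((\<pi> \<circ> p) i)) = (\<Prod>i\<in>S. M i (\<pi> i))"
      using prod.permute[OF p, of "\<lambda>i. M i (\<pi> i)"] by (simp add: o_def)
    then show "of_int (sign (\<pi> \<circ> p)) * (\<Prod>i\<in>S. M (p i) ((\<pi> \<circ> p) i)) =
        of_int (sign p) * (of_int (sign \<pi>) * (\<Prod>i\<in>S. M i (\<pi> i)))"
      by (simp add: s)
  qed
  finally show ?thesis by (simp add: det_on_def sum_distrib_left)
qed

lemma inj_on_restrict_permutes: "inj_on (\<lambda>\<pi>. restrict \<pi> S) {\<pi>. \<pi> permutes S}"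
proof (rule inj_onI, rule ext)
  fix \<pi> \<rho> i
  assume \<pi>: "\<pi> \<in> {\<pi>. \<pi> permutes S}" "\<rho> \<in> {\<pi>. \<pi> permutes S}"
    and e: "restrict \<pi> S = restrict \<rho> S"
  show "\<pi> i = \<rho> i"
  proof (cases "i \<in> S")
    case True
    then show ?thesis using e by (metis restrict_apply')
  qed (use \<pi> in \<open>simp add: permutes_not_in\<close>)
qed

text \<open>
  Multiplying out, the product of row sums becomes a sum over maps \<open>f\<close> from \<open>S\<close> to \<open>S\<close>. A map that is not
  injective contributes a determinant with two equal rows; the others are permutations.
\<close>

lemma det_on_mult:
  assumes S: "finite S"
  shows "det_on S (\<lambda>i j. \<Sum>k\<in>S. A i k * B k j) = det_on S A * det_on S B"
proof -
  let ?F = "S \<rightarrow>\<^sub>E S"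
  let ?P = "{\<pi>. \<pi> permutes S}"
  have fin: "finite ?F" "finite ?P" using S by (auto intro: finite_PiE finite_permutations)
  have "det_on S (\<lambda>i j. \<Sum>k\<in>S. A i k * B k j) =
     (\<Sum>\<pi>\<in>?P. of_int (sign \<pi>) * (\<Sum>f\<in>?F. \<Prod>i\<in>S. A i (f i) * B (f i) (\<pi> i)))"
    unfolding det_on_def by (simp add: prod_sum_PiE S)
  also have "\<dots> = (\<Sum>f\<in>?F. (\<Prod>i\<in>S. A i (f i)) * det_on S (\<lambda>i. B (f i)))"
    unfolding det_on_def prod.distrib sum_distrib_left
    by (subst sum.swap) (simp add: mult_ac)
  also have "\<dots> = (\<Sum>f\<in>(\<lambda>\<pi>. restrict \<pi> S) ` ?P. (\<Prod>i\<in>S. A i (f i)) * det_on S (\<lambda>i. B (f i)))"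
  proof (rule sum.mono_neutral_right[OF fin(1)])
    show "(\<lambda>\<pi>. restrict \<pi> S) ` ?P \<subseteq> ?F" by (auto simp: permutes_in_image)
    show "\<forall>f\<in>?F - (\<lambda>\<pi>. restrict \<pi> S) ` ?P. (\<Prod>i\<in>S. A i (f i)) * det_on S (\<lambda>i. B (f i)) = 0"
    proof
      fix f assume f: "f \<in> ?F - (\<lambda>\<pi>. restrict \<pi> S) ` ?P"
      have "\<not> inj_on f S"
      proof
        assume inj: "inj_on f S"
        have "f ` S = S" using f inj S by (intro endo_inj_surj) auto
        then have "(\<lambda>i. if i \<in> S then f i else i) permutes S"
          using inj by (intro bij_imp_permutes) (auto simp: bij_betw_def inj_on_def)
        moreover have "f = restrict (\<lambda>i. if i \<in> S then f i else i) S"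
          using f by (auto simp: fun_eq_iff restrict_def PiE_def extensional_def)
        ultimately show False using f by blast
      qed
      then obtain a b where "a \<in> S" "b \<in> S" "a \<noteq> b" "f a = f b" by (auto simp: inj_on_def)
      then have "det_on S (\<lambda>i. B (f i)) = 0" by (intro det_on_eq_rows[OF S, of a b]) auto
      then show "(\<Prod>i\<in>S. A i (f i)) * det_on S (\<lambda>i. B (f i)) = 0" by simp
    qed
  qed
  also have "\<dots> = (\<Sum>\<pi>\<in>?P. (\<Prod>i\<in>S. A i (\<pi> i)) * det_on S (\<lambda>i. B (\<pi> i)))"
  by (subst sum.reindex[OF inj_on_restrict_permutes]) (auto intro!: sum.cong arg_cong2[where f="(*)"] prod.cong det_on_cong)
  also have "\<dots> = (\<Sum>\<pi>\<in>?P. of_int (sign \<pi>) * (\<Prod>i\<in>S. A i (\<pi> i)) * det_on S B)"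
    by (intro sum.cong refl) (simp add: det_on_permute_rows[OF S])
  also have "\<dots> = det_on S A * det_on S B"
    by (simp add: det_on_def sum_distrib_right)
  finally show ?thesis .
qed

text \<open>
  Let \<open>S\<close> be the set of rows in which the factor \<open>M\<close> is chosen: on \<open>F - S\<close> the permutation must then be the
  identity. The weight \<open>c\<close> is the sign for determinants and 1 for permanents.
\<close>

lemma permutation_sum_one_plus:
  fixes M :: "'k \<Rightarrow> 'k \<Rightarrow> 'a::comm_ring_1"
  assumes F: "finite F"
  shows "(\<Sum>\<pi> | \<pi> permutes F. c \<pi> * (\<Prod>i\<in>F. (if i = \<pi> i then 1 else 0) + M i (\<pi> i))) =
         (\<Sum>S\<in>Pow F. \<Sum>\<pi> | \<pi> permutes S. c \<pi> * (\<Prod>i\<in>S. M i (\<pi> i)))"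
proof -
  have "(\<Sum>\<pi> | \<pi> permutes F. c \<pi> * (\<Prod>i\<in>F. (if i = \<pi> i then 1 else 0) + M i (\<pi> i))) =
     (\<Sum>\<pi> | \<pi> permutes F. \<Sum>S\<in>Pow F. c \<pi> * ((\<Prod>i\<in>S. M i (\<pi> i)) * (\<Prod>i\<in>F-S. if i = \<pi> i then 1 else 0)))"
    by (subst add.commute) (simp add: prod_add[OF F] sum_distrib_left)
  also have "\<dots> = (\<Sum>S\<in>Pow F. \<Sum>\<pi> | \<pi> permutes F.  c \<pi> * ((\<Prod>i\<in>S. M i (\<pi> i)) * (\<Prod>i\<in>F-S. if i = \<pi> i then 1 else 0)))"
    by (rule sum.swap)
  also have "\<dots> = (\<Sum>S\<in>Pow F. \<Sum>\<pi> | \<pi> permutes S. c \<pi> * (\<Prod>i\<in>S. M i (\<pi> i)))"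
  proof (rule sum.cong[OF refl])
    fix S assume "S \<in> Pow F"
    then have S: "S \<subseteq> F" by simp
    show "(\<Sum>\<pi> | \<pi> permutes F. c \<pi> * ((\<Prod>i\<in>S. M i (\<pi> i)) * (\<Prod>i\<in>F-S. if i = \<pi> i then 1 else 0))) =
       (\<Sum>\<pi> | \<pi> permutes S. c \<pi> * (\<Prod>i\<in>S. M i (\<pi> i)))"
    proof (rule sum.mono_neutral_cong_right)
      show "finite {\<pi>. \<pi> permutes F}" using F by (rule finite_permutations)
      show "{\<pi>. \<pi> permutes S} \<subseteq> {\<pi>. \<pi> permutes F}" using S by (auto intro: permutes_subset)
      show "\<forall>\<pi>\<in>{\<pi>. \<pi> permutes F} - {\<pi>. \<pi> permutes S}.
          c \<pi> * ((\<Prod>i\<in>S. M i (\<pi> i)) * (\<Prod>i\<in>F-S. if i = \<pi> i then 1 else 0)) = 0"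
      proof
        fix \<pi> assume \<pi>: "\<pi> \<in> {\<pi>. \<pi> permutes F} - {\<pi>. \<pi> permutes S}"
        then obtain i where "i \<in> F - S" "\<pi> i \<noteq> i"
          by (auto intro: permutes_superset)
        then have "(\<Prod>i\<in>F-S. if i = \<pi> i then 1 else 0) = (0::'a)"
          using F by (intro prod_zero) (auto intro!: bexI[of _ i])
        then show "c \<pi> * ((\<Prod>i\<in>S. M i (\<pi> i)) * (\<Prod>i\<in>F-S. if i = \<pi> i then 1 else 0)) = 0" by simp
      qed
      fix \<pi> assume "\<pi> \<in> {\<pi>. \<pi> permutes S}"
      then have "(\<Prod>i\<in>F-S. if i = \<pi> i then 1 else 0) = (1::'a)"
        by (intro prod.neutral) (auto simp: permutes_not_in)
      then show "c \<pi> * ((\<Prod>i\<in>S. M i (\<pi> i)) * (\<Prod>i\<in>F-S. if i = \<pi> i then 1 else 0)) = c \<pi> * (\<Prod>i\<in>S. M i (\<pi> i))"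
        by simp
    qed
  qed
  finally show ?thesis .
qed

text \<open>
  Fredholm's series extends this identity to infinite index sets.
\<close>

lemma det_on_one_plus:
  assumes "finite F"
  shows "det_on F (\<lambda>i j. (if i = j then 1 else 0) + M i j) = (\<Sum>S\<in>Pow F. det_on S M)"
  unfolding det_on_def by (rule permutation_sum_one_plus[OF assms])

definition permanent_on :: "'k set \<Rightarrow> ('k \<Rightarrow> 'k \<Rightarrow> real) \<Rightarrow> real" where
  "permanent_on S d = (\<Sum>\<pi> | \<pi> permutes S. \<Prod>i\<in>S. d i (\<pi> i))"

lemma norm_det_on_le:
  assumes "\<And>i j. norm (M i j) \<le> d i j"
  shows "norm (det_on S M) \<le> permanent_on S d"
  unfolding det_on_def permanent_on_def
proof (rule order_trans[OF norm_sum], rule sum_mono)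
  fix \<pi> :: "'a \<Rightarrow> 'a"
  have "\<bar>real_of_int (sign \<pi>)\<bar> = 1" by (simp flip: of_int_abs)
  then show "norm (of_int (sign \<pi>) * (\<Prod>i\<in>S. M i (\<pi> i))) \<le> (\<Prod>i\<in>S. d i (\<pi> i))"
    by (simp add: norm_mult prod_norm[symmetric] prod_mono assms del: of_int_abs)
qed

lemma permanent_on_nonneg: "(\<And>i j. 0 \<le> d i j) \<Longrightarrow> 0 \<le> permanent_on S d"
  unfolding permanent_on_def by (intro sum_nonneg prod_nonneg) auto

text \<open>
  The permanents add up to the permanent of \<open>1 + d\<close>, which is at most the product of its row sums. The bound
  does not depend on \<open>F\<close>, so it makes Fredholm's series converge absolutely.
\<close>

lemma sum_permanent_on_le:
  assumes d: "\<And>i j. 0 \<le> d i j" and F: "finite F" and C: "(\<Sum>i\<in>F. \<Sum>j\<in>F. d i j) \<le> C"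
  shows "(\<Sum>S\<in>Pow F. permanent_on S d) \<le> exp C"
proof -
  let ?g = "\<lambda>i j. (if i = j then 1 else 0) + d i j"
  have "(\<Sum>S\<in>Pow F. permanent_on S d) = (\<Sum>\<pi> | \<pi> permutes F. \<Prod>i\<in>F. ?g i (\<pi> i))"
    using permutation_sum_one_plus[OF F, of "\<lambda>_. 1" d] by (simp add: permanent_on_def)
  also have "\<dots> = (\<Sum>f\<in>(\<lambda>\<pi>. restrict \<pi> F) ` {\<pi>. \<pi> permutes F}. \<Prod>i\<in>F. ?g i (f i))"
  by (subst sum.reindex[OF inj_on_restrict_permutes]) (auto intro!: sum.cong prod.cong)
  also have "\<dots> \<le> (\<Sum>f\<in>F \<rightarrow>\<^sub>E F. \<Prod>i\<in>F. ?g i (f i))"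
    using F d by (intro sum_mono2 finite_PiE prod_nonneg) (auto simp: permutes_in_image)
  also have "\<dots> = (\<Prod>i\<in>F. \<Sum>j\<in>F. ?g i j)"
    by (rule prod_sum_PiE[symmetric]) (use F in auto)
  also have "\<dots> = (\<Prod>i\<in>F. 1 + (\<Sum>j\<in>F. d i j))"
    using F by (intro prod.cong refl) (simp add: sum.distrib)
  also have "\<dots> \<le> (\<Prod>i\<in>F. exp (\<Sum>j\<in>F. d i j))"
    using d by (intro prod_mono) (auto intro!: add_nonneg_nonneg sum_nonneg exp_ge_add_one_self)
  also have "\<dots> = exp (\<Sum>i\<in>F. \<Sum>j\<in>F. d i j)" using F by (simp add: exp_sum)
  also have "\<dots> \<le> exp C" using C by simp
  finally show ?thesis .
qed

section \<open>Fredholm's series\<close>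

definition fredholm_series :: "('k \<Rightarrow> 'k \<Rightarrow> complex) \<Rightarrow> complex" where
  "fredholm_series M = (\<Sum>\<^sub>\<infinity>S | finite S. det_on S M)"

lemma has_sum_finite_sum:
  fixes f :: "'a \<Rightarrow> 'b \<Rightarrow> 'c::topological_comm_monoid_add"
  assumes "\<And>i. i \<in> I \<Longrightarrow> (f i has_sum s i) X"
  shows "((\<lambda>x. \<Sum>i\<in>I. f i x) has_sum (\<Sum>i\<in>I. s i)) X"
  using assms by (induction I rule: infinite_finite_induct) (auto intro: has_sum_add)

lemma permanent_on_summable:
  assumes d: "\<And>i j. 0 \<le> d i j" and s: "(\<lambda>(i, j). d i j) summable_on UNIV"
  shows "(\<lambda>S. permanent_on S d) summable_on {S. finite S}"
proof (rule nonneg_bdd_above_summable_on)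
  show "bdd_above (sum (\<lambda>S. permanent_on S d) ` {\<F>. \<F> \<subseteq> {S. finite S} \<and> finite \<F>})"
  proof (rule bdd_aboveI2)
    fix \<F> :: "'a set set" assume \<F>: "\<F> \<in> {\<F>. \<F> \<subseteq> {S. finite S} \<and> finite \<F>}"
    define F where "F = \<Union>\<F>"
    have F: "finite F" "\<F> \<subseteq> Pow F" using \<F> by (auto simp: F_def)
    have "(\<Sum>S\<in>\<F>. permanent_on S d) \<le> (\<Sum>S\<in>Pow F. permanent_on S d)"
      using F d by (intro sum_mono2) (auto intro: permanent_on_nonneg)
    also have "\<dots> \<le> exp (\<Sum>\<^sub>\<infinity>(i, j). d i j)"
    proof (rule sum_permanent_on_le[OF d F(1)])
      have "(\<Sum>i\<in>F. \<Sum>j\<in>F. d i j) = (\<Sum>(i, j)\<in>F \<times> F. d i j)"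
        by (rule sum.cartesian_product)
      also have "\<dots> \<le> (\<Sum>\<^sub>\<infinity>(i, j). d i j)"
        using F d by (intro finite_sum_le_infsum[OF s]) auto
      finally show "(\<Sum>i\<in>F. \<Sum>j\<in>F. d i j) \<le> (\<Sum>\<^sub>\<infinity>(i, j). d i j)" .
    qed
    finally show "(\<Sum>S\<in>\<F>. permanent_on S d) \<le> exp (\<Sum>\<^sub>\<infinity>(i, j). d i j)" .
  qed
qed (auto intro: permanent_on_nonneg d)

lemma tendsto_det_on:
  assumes "\<And>i j. ((\<lambda>x. M x i j) \<longlongrightarrow> L i j) G"
  shows "((\<lambda>x. det_on S (M x)) \<longlongrightarrow> det_on S L) G"
  unfolding det_on_def by (intro tendsto_intros assms)

text \<open>
  Tannery's theorem for unordered sums: the majorant makes the finite partial sums converge uniformly, so the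
  two limits may be exchanged.
\<close>

lemma tendsto_infsum_dominated:
  fixes f :: "'a \<Rightarrow> 'b \<Rightarrow> 'c::banach"
  assumes lim: "\<And>k. k \<in> X \<Longrightarrow> ((\<lambda>x. f k x) \<longlongrightarrow> g k) G"
    and dom: "\<And>k x. k \<in> X \<Longrightarrow> norm (f k x) \<le> M k" and M: "M summable_on X"
  shows "((\<lambda>x. \<Sum>\<^sub>\<infinity>k\<in>X. f k x) \<longlongrightarrow> (\<Sum>\<^sub>\<infinity>k\<in>X. g k)) G"
proof (cases "G = bot")
  case False
  have nb: "norm (g k) \<le> M k" if "k \<in> X" for k
    using lim[OF that] dom[OF that] False by (intro tendsto_upperbound[OF tendsto_norm]) auto
  have "(\<lambda>k. norm (g k)) summable_on X"
    by (rule summable_on_comparison_test[OF M nb]) auto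
  then have g: "(g has_sum (\<Sum>\<^sub>\<infinity>k\<in>X. g k)) X"
    using abs_summable_summable by (intro has_sum_infsum) blast
  show ?thesis
  proof (rule swap_uniform_limit')
    show "\<forall>\<^sub>F F in finite_subsets_at_top X. ((\<lambda>x. \<Sum>k\<in>F. f k x) \<longlongrightarrow> (\<Sum>k\<in>F. g k)) G"
      by (rule eventually_finite_subsets_at_top_weakI) (auto intro!: tendsto_sum lim)
    show "((\<lambda>F. \<Sum>k\<in>F. g k) \<longlongrightarrow> (\<Sum>\<^sub>\<infinity>k\<in>X. g k)) (finite_subsets_at_top X)"
      using g by (simp add: has_sum_def)
    show "uniform_limit UNIV (\<lambda>F x. \<Sum>k\<in>F. f k x) (\<lambda>x. \<Sum>\<^sub>\<infinity>k\<in>X. f k x) (finite_subsets_at_top X)"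
      by (rule Weierstrass_m_test_general[OF _ M]) (use dom in auto)
  qed auto
qed auto

text \<open>
  The permanents of \<open>d\<close> are a summable majorant of the minors. The product rule and the
  commutation rule for Fredholm determinants are limits of finite identities along this lemma.
\<close>

lemma tendsto_fredholm_series:
  assumes lim: "\<And>i j. ((\<lambda>x. M x i j) \<longlongrightarrow> L i j) G"
    and dom: "\<And>x i j. norm (M x i j) \<le> d i j" and d: "(\<lambda>(i, j). d i j) summable_on UNIV"
  shows "((\<lambda>x. fredholm_series (M x)) \<longlongrightarrow> fredholm_series L) G"
  unfolding fredholm_series_def
proof (rule tendsto_infsum_dominated)
  show "(\<lambda>S. permanent_on S d) summable_on {S. finite S}"
    using d by (intro permanent_on_summable) (auto intro: order_trans[OF norm_ge_zero dom])
  show "norm (det_on S (M x)) \<le> permanent_on S d" for S x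
    by (rule norm_det_on_le[OF dom])
qed (rule tendsto_det_on[OF lim])

lemma fredholm_series_finite_support:
  assumes F: "finite F" and z: "\<And>i j. i \<notin> F \<Longrightarrow> M i j = 0"
  shows "fredholm_series M = det_on F (\<lambda>i j. (if i = j then 1 else 0) + M i j)"
proof -
  have "fredholm_series M = (\<Sum>\<^sub>\<infinity>S\<in>Pow F. det_on S M)"
    unfolding fredholm_series_def
  proof (rule infsum_cong_neutral)
    fix S assume "S \<in> {S. finite S} - Pow F"
    then obtain i where "finite S" "i \<in> S" "i \<notin> F" by auto
    then show "det_on S M = 0" by (intro det_on_zero_row[of S i]) (auto simp: z)
  qed (use F finite_subset in auto)
  also have "\<dots> = (\<Sum>S\<in>Pow F. det_on S M)" using F by (intro infsum_finite) auto
  finally show ?thesis by (simp add: det_on_one_plus[OF F])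
qed

text \<open>
  A finite index set that leaves the range of \<open>f\<close> has a zero row and contributes nothing.
\<close>

lemma fredholm_series_reindex:
  assumes f: "inj f" and M: "\<And>i j. M' (f i) (f j) = M i j"
    and z: "\<And>x y. x \<notin> range f \<Longrightarrow> M' x y = 0"
  shows "fredholm_series M' = fredholm_series M"
proof -
  have "fredholm_series M' = (\<Sum>\<^sub>\<infinity>S\<in>image f ` {S. finite S}. det_on S M')"
    unfolding fredholm_series_def
  proof (rule infsum_cong_neutral)
    fix S assume S: "S \<in> {S. finite S} - image f ` {S. finite S}"
    have "\<not> S \<subseteq> range f"
      using S by (auto dest: finite_subset_image)
    then obtain x where "x \<in> S" "x \<notin> range f" by blast
    then show "det_on S M' = 0" using S by (intro det_on_zero_row[of S x]) (auto simp: z)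
  qed auto
  also have "\<dots> = (\<Sum>\<^sub>\<infinity>S | finite S. det_on (f ` S) M')"
    using f by (subst infsum_reindex) (simp_all add: o_def inj_on_def inj_image_eq_iff)
  also have "\<dots> = fredholm_series M"
    unfolding fredholm_series_def
    using f by (intro infsum_cong) (simp add: det_on_reindex inj_on_subset M)
  finally show ?thesis .
qed

lemma fredholm_series_cong_minors:
  assumes "\<And>S. finite S \<Longrightarrow> det_on S M = det_on S N"
  shows "fredholm_series M = fredholm_series N"
  unfolding fredholm_series_def by (intro infsum_cong) (simp add: assms)

section \<open>The ring of matrices with bounded row and column sums\<close>

text \<open>
  Bounded absolute row and column sums make matrix products converge absolutely and are inherited by them. The
  resulting ring contains the coordinate projections and all Laurent matrices of functions in \<open>K11\<close>, so the
  operator identities of the proof become calculations in a ring.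
\<close>

typedef 'k bmat = "{M :: 'k \<Rightarrow> 'k \<Rightarrow> complex. \<exists>C. \<forall>i F. finite F \<longrightarrow>
    (\<Sum>j\<in>F. norm (M i j)) \<le> C \<and> (\<Sum>j\<in>F. norm (M j i)) \<le> C}"
  morphisms entries Bmat
  by (intro exI[of _ "\<lambda>_ _. 0"]) auto

setup_lifting type_definition_bmat

lemma bmat_eqI: "(\<And>i j. entries A i j = entries B i j) \<Longrightarrow> A = B"
  by (metis entries_inject ext)

definition abs_sum_bound :: "'k bmat \<Rightarrow> real" where
  "abs_sum_bound A = (SOME C. \<forall>i F. finite F \<longrightarrow>
    (\<Sum>j\<in>F. norm (entries A i j)) \<le> C \<and> (\<Sum>j\<in>F. norm (entries A j i)) \<le> C)"

lemma
  assumes "finite F"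
  shows row_sum_le_bound: "(\<Sum>j\<in>F. norm (entries A i j)) \<le> abs_sum_bound A"
    and col_sum_le_bound: "(\<Sum>j\<in>F. norm (entries A j i)) \<le> abs_sum_bound A"
proof -
  have "\<exists>C. \<forall>i F. finite F \<longrightarrow>
    (\<Sum>j\<in>F. norm (entries A i j)) \<le> C \<and> (\<Sum>j\<in>F. norm (entries A j i)) \<le> C"
    using entries[of A] by simp
  from someI_ex[OF this] show "(\<Sum>j\<in>F. norm (entries A i j)) \<le> abs_sum_bound A"
    "(\<Sum>j\<in>F. norm (entries A j i)) \<le> abs_sum_bound A"
    using assms unfolding abs_sum_bound_def by auto
qed

lemma norm_entries_le_bound: "norm (entries A i j) \<le> abs_sum_bound A"
  using row_sum_le_bound[of "{j}" A i] by simp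

lemma abs_sum_bound_nonneg: "0 \<le> abs_sum_bound A"
  using row_sum_le_bound[of "{}" A undefined] by simp

lemma bmat_row_summable: "(\<lambda>j. norm (entries A i j)) summable_on UNIV"
  by (intro nonneg_bdd_above_summable_on bdd_aboveI2[of _ _ "abs_sum_bound A"]) (auto intro: row_sum_le_bound)

lemma bmat_col_summable: "(\<lambda>j. norm (entries A j i)) summable_on UNIV"
  by (intro nonneg_bdd_above_summable_on bdd_aboveI2[of _ _ "abs_sum_bound A"]) (auto intro: col_sum_le_bound)

lemma abs_summable_mult_bounded:
  fixes f g :: "'a \<Rightarrow> complex"
  assumes f: "(\<lambda>k. norm (f k)) summable_on X" and g: "\<And>k. norm (g k) \<le> C"
  shows "(\<lambda>k. norm (f k * g k)) summable_on X"
proof (rule summable_on_comparison_test[where f = "\<lambda>k. norm (f k) * C"])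
  show "(\<lambda>k. norm (f k) * C) summable_on X" using f by (rule summable_on_cmult_left)
  show "norm (f k * g k) \<le> norm (f k) * C" for k
    by (simp add: norm_mult mult_left_mono g)
qed auto

lemma bmat_fubini_summable:
  fixes f x :: "'k \<Rightarrow> complex" and N :: "'k bmat"
  assumes f: "(\<lambda>k. norm (f k)) summable_on UNIV" and x: "\<And>l. norm (x l) \<le> X"
  shows "(\<lambda>(k, l). norm (f k * entries N k l * x l)) summable_on UNIV"
proof -
  have X: "0 \<le> X" using x[of undefined] norm_ge_zero order_trans by blast
  have rs: "(\<lambda>l. norm (f k * entries N k l * x l)) summable_on UNIV" for k
    unfolding mult.assoc norm_mult[of "f k"]
    by (intro summable_on_cmult_right abs_summable_mult_bounded[OF bmat_row_summable x])
  have le: "(\<Sum>\<^sub>\<infinity>l. norm (f k * entries N k l * x l)) \<le> norm (f k) * (abs_sum_bound N * X)" for k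
  proof (rule infsum_le_finite_sums[OF rs])
    fix F :: "'k set" assume "finite F"
    have "(\<Sum>l\<in>F. norm (f k * entries N k l * x l)) \<le> (\<Sum>l\<in>F. norm (f k) * norm (entries N k l) * X)"
      by (intro sum_mono) (simp add: norm_mult mult_left_mono x)
    also have "\<dots> = norm (f k) * ((\<Sum>l\<in>F. norm (entries N k l)) * X)"
      by (simp add: sum_distrib_left sum_distrib_right mult_ac)
    also have "\<dots> \<le> norm (f k) * (abs_sum_bound N * X)"
      by (intro mult_left_mono mult_right_mono row_sum_le_bound abs_sum_bound_nonneg X \<open>finite F\<close>) auto
    finally show "(\<Sum>l\<in>F. norm (f k * entries N k l * x l)) \<le> norm (f k) * (abs_sum_bound N * X)" .
  qed
  have "(\<lambda>p. norm (case p of (k, l) \<Rightarrow> f k * entries N k l * x l)) summable_on Sigma UNIV (\<lambda>_. UNIV)"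
  proof (rule Infinite_Sum.abs_summable_on_Sigma_iff[THEN iffD2], intro conjI ballI)
    show "(\<lambda>l. norm (case (k, l) of (k, l) \<Rightarrow> f k * entries N k l * x l)) summable_on UNIV" for k
      using rs by simp
    have "(\<lambda>k. norm (f k) * (abs_sum_bound N * X)) summable_on UNIV"
      by (intro summable_on_cmult_left f)
    then show "(\<lambda>k. norm (\<Sum>\<^sub>\<infinity>l. norm (case (k, l) of (k, l) \<Rightarrow> f k * entries N k l * x l))) summable_on UNIV"
      by (rule summable_on_comparison_test) (use le in \<open>auto simp: infsum_nonneg abs_of_nonneg\<close>)
  qed
  then show ?thesis by (simp add: case_prod_unfold)
qed

text \<open>
  Associativity for a summable row, a matrix and a bounded column. It gives both the associativity of the
  matrix product and its compatibility with the action on bounded vectors.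
\<close>

lemma bmat_fubini:
  fixes f x :: "'k \<Rightarrow> complex" and N :: "'k bmat"
  assumes f: "(\<lambda>k. norm (f k)) summable_on UNIV" and x: "\<And>l. norm (x l) \<le> X"
  shows "(\<Sum>\<^sub>\<infinity>k. f k * (\<Sum>\<^sub>\<infinity>l. entries N k l * x l)) = (\<Sum>\<^sub>\<infinity>l. (\<Sum>\<^sub>\<infinity>k. f k * entries N k l) * x l)"
proof -
  have "(\<lambda>(k, l). f k * entries N k l * x l) summable_on UNIV \<times> UNIV"
    using bmat_fubini_summable[where N = N and x = x, OF f x]
    by (intro abs_summable_summable[where f = "\<lambda>(k, l). f k * entries N k l * x l"])
       (simp add: case_prod_unfold)
  then have "(\<Sum>\<^sub>\<infinity>k. \<Sum>\<^sub>\<infinity>l. f k * entries N k l * x l) = (\<Sum>\<^sub>\<infinity>l. \<Sum>\<^sub>\<infinity>k. f k * entries N k l * x l)"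
    by (rule infsum_swap_banach)
  moreover have "(\<Sum>\<^sub>\<infinity>l. f k * entries N k l * x l) = f k * (\<Sum>\<^sub>\<infinity>l. entries N k l * x l)" for k
    by (simp add: mult.assoc infsum_cmult_right')
  moreover have "(\<Sum>\<^sub>\<infinity>k. f k * entries N k l * x l) = (\<Sum>\<^sub>\<infinity>k. f k * entries N k l) * x l" for l
    by (simp add: infsum_cmult_left')
  ultimately show ?thesis by simp
qed

lemma bmat_mult_summable: "(\<lambda>k. norm (entries A i k * entries B k j)) summable_on UNIV"
  by (rule abs_summable_mult_bounded[OF bmat_row_summable norm_entries_le_bound])

lemma bmat_mult_bound:
  assumes A: "\<And>F. finite F \<Longrightarrow> (\<Sum>j\<in>F. norm (a j)) \<le> CA" "0 \<le> CA"
    and B: "\<And>i F. finite F \<Longrightarrow> (\<Sum>j\<in>F. norm (B i j)) \<le> CB" "0 \<le> CB"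
    and F: "finite F"
  shows "(\<Sum>j\<in>F. norm (\<Sum>\<^sub>\<infinity>k. a k * B k j :: complex)) \<le> CA * CB"
proof -
  have a: "(\<lambda>k. norm (a k)) summable_on UNIV"
    by (intro nonneg_bdd_above_summable_on bdd_aboveI2[of _ _ CA]) (auto intro: A)
  have B1: "norm (B k j) \<le> CB" for k j using B(1)[of "{j}"] by simp
  have s: "(\<lambda>k. norm (a k * B k j)) summable_on UNIV" for j
    by (rule abs_summable_mult_bounded[OF a B1])
  have "(\<Sum>j\<in>F. norm (\<Sum>\<^sub>\<infinity>k. a k * B k j)) \<le> (\<Sum>j\<in>F. \<Sum>\<^sub>\<infinity>k. norm (a k * B k j))"
    by (intro sum_mono norm_infsum_bound s)
  also have "\<dots> = (\<Sum>\<^sub>\<infinity>k. \<Sum>j\<in>F. norm (a k * B k j))"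
    by (rule infsumI[symmetric], rule has_sum_finite_sum) (use s in auto)
  also have "\<dots> \<le> CA * CB"
  proof (rule infsum_le_finite_sums)
    show "(\<lambda>k. \<Sum>j\<in>F. norm (a k * B k j)) summable_on UNIV"
      using s by (intro has_sum_imp_summable[OF has_sum_finite_sum]) (auto intro: has_sum_infsum)
    fix E :: "'a set" assume E: "finite E"
    have "(\<Sum>k\<in>E. \<Sum>j\<in>F. norm (a k * B k j)) = (\<Sum>k\<in>E. norm (a k) * (\<Sum>j\<in>F. norm (B k j)))"
      by (simp add: norm_mult sum_distrib_left)
    also have "\<dots> \<le> (\<Sum>k\<in>E. norm (a k) * CB)"
      using F by (intro sum_mono mult_left_mono B) auto
    also have "\<dots> \<le> CA * CB"
      using A(1)[OF E] B(2) by (simp flip: sum_distrib_right add: mult_right_mono)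
    finally show "(\<Sum>k\<in>E. \<Sum>j\<in>F. norm (a k * B k j)) \<le> CA * CB" .
  qed
  finally show ?thesis .
qed

instantiation bmat :: (type) ring_1
begin

lift_definition zero_bmat :: "'a bmat" is "\<lambda>_ _. 0" by (auto intro: exI[of _ 0])
lift_definition one_bmat :: "'a bmat" is "\<lambda>i j. if i = j then 1 else 0"
  by (auto intro!: exI[of _ 1] simp: if_distrib[of norm] sum.delta sum.delta' cong: if_cong)
lift_definition plus_bmat :: "'a bmat \<Rightarrow> 'a bmat \<Rightarrow> 'a bmat" is "\<lambda>A B i j. A i j + B i j"
proof -
  fix A B :: "'a \<Rightarrow> 'a \<Rightarrow> complex"
  assume "\<exists>C. \<forall>i F. finite F \<longrightarrow> (\<Sum>j\<in>F. norm (A i j)) \<le> C \<and> (\<Sum>j\<in>F. norm (A j i)) \<le> C"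
    and "\<exists>C. \<forall>i F. finite F \<longrightarrow> (\<Sum>j\<in>F. norm (B i j)) \<le> C \<and> (\<Sum>j\<in>F. norm (B j i)) \<le> C"
  then obtain C D where C: "\<And>i F. finite F \<Longrightarrow> (\<Sum>j\<in>F. norm (A i j)) \<le> C"
      "\<And>i F. finite F \<Longrightarrow> (\<Sum>j\<in>F. norm (A j i)) \<le> C"
    and D: "\<And>i F. finite F \<Longrightarrow> (\<Sum>j\<in>F. norm (B i j)) \<le> D"
      "\<And>i F. finite F \<Longrightarrow> (\<Sum>j\<in>F. norm (B j i)) \<le> D" by metis
  have tri: "(\<Sum>j\<in>F. norm (f j + g j)) \<le> (\<Sum>j\<in>F. norm (f j)) + (\<Sum>j\<in>F. norm (g j))"
    for F :: "'a set" and f g :: "'a \<Rightarrow> complex"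
    unfolding sum.distrib[symmetric] by (intro sum_mono norm_triangle_ineq)
  show "\<exists>C. \<forall>i F. finite F \<longrightarrow> (\<Sum>j\<in>F. norm (A i j + B i j)) \<le> C \<and> (\<Sum>j\<in>F. norm (A j i + B j i)) \<le> C"
    by (intro exI[of _ "C + D"] allI impI conjI order_trans[OF tri] add_mono C D)
qed
lift_definition uminus_bmat :: "'a bmat \<Rightarrow> 'a bmat" is "\<lambda>A i j. - A i j" by simp
lift_definition times_bmat :: "'a bmat \<Rightarrow> 'a bmat \<Rightarrow> 'a bmat" is "\<lambda>A B i j. \<Sum>\<^sub>\<infinity>k. A i k * B k j"
proof -
  fix A B :: "'a \<Rightarrow> 'a \<Rightarrow> complex"
  assume "\<exists>C. \<forall>i F. finite F \<longrightarrow> (\<Sum>j\<in>F. norm (A i j)) \<le> C \<and> (\<Sum>j\<in>F. norm (A j i)) \<le> C"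
    and "\<exists>C. \<forall>i F. finite F \<longrightarrow> (\<Sum>j\<in>F. norm (B i j)) \<le> C \<and> (\<Sum>j\<in>F. norm (B j i)) \<le> C"
  then obtain C D where C: "\<And>i F. finite F \<Longrightarrow> (\<Sum>j\<in>F. norm (A i j)) \<le> C"
      "\<And>i F. finite F \<Longrightarrow> (\<Sum>j\<in>F. norm (A j i)) \<le> C"
    and D: "\<And>i F. finite F \<Longrightarrow> (\<Sum>j\<in>F. norm (B i j)) \<le> D"
      "\<And>i F. finite F \<Longrightarrow> (\<Sum>j\<in>F. norm (B j i)) \<le> D" by metis
  have 0: "0 \<le> C" "0 \<le> D" using C(1)[of "{}"] D(1)[of "{}"] by auto
  have "(\<Sum>j\<in>F. norm (\<Sum>\<^sub>\<infinity>k. A i k * B k j)) \<le> C * D" if "finite F" for i F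
    by (rule bmat_mult_bound[OF C(1) 0(1) D(1) 0(2) that])
  moreover have "(\<Sum>j\<in>F. norm (\<Sum>\<^sub>\<infinity>k. A j k * B k i)) \<le> C * D" if "finite F" for i F
    using bmat_mult_bound[of "\<lambda>k. B k i" D "\<lambda>k j. A j k" C F] C(2) D(2) 0 that
    by (simp add: mult.commute)
  ultimately show "\<exists>C. \<forall>i F. finite F \<longrightarrow> (\<Sum>j\<in>F. norm (\<Sum>\<^sub>\<infinity>k. A i k * B k j)) \<le> C \<and>
      (\<Sum>j\<in>F. norm (\<Sum>\<^sub>\<infinity>k. A j k * B k i)) \<le> C" by blast
qed
definition minus_bmat :: "'a bmat \<Rightarrow> 'a bmat \<Rightarrow> 'a bmat" where "minus_bmat A B = A + - B"

instance
proof
  fix A B C :: "'a bmat"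
  note d = plus_bmat.rep_eq zero_bmat.rep_eq one_bmat.rep_eq uminus_bmat.rep_eq times_bmat.rep_eq
  have s: "(\<lambda>k. entries A i k * entries B k j) summable_on UNIV" for A B :: "'a bmat" and i j
    by (rule abs_summable_summable[OF bmat_mult_summable])
  show "A + B + C = A + (B + C)" "A + B = B + A" "0 + A = A" "- A + A = 0"
    by (rule bmat_eqI, simp add: d)+
  show "A - B = A + - B" by (simp add: minus_bmat_def)
  show "A * B * C = A * (B * C)"
  proof (rule bmat_eqI)
    fix i j
    from bmat_fubini[OF bmat_row_summable norm_entries_le_bound, of A i B C "\<lambda>l. l" "\<lambda>_. j"]
    show "entries (A * B * C) i j = entries (A * (B * C)) i j" unfolding d by (rule sym)
  qed
  show "(A + B) * C = A * C + B * C" "A * (B + C) = A * B + A * C"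
    by (rule bmat_eqI, simp only: d distrib_left distrib_right, rule infsum_add[OF s s])+
  show "1 * A = A"
  proof (rule bmat_eqI)
    fix i j
    have "(\<Sum>\<^sub>\<infinity>k. (if i = k then 1 else 0) * entries A k j) = (\<Sum>\<^sub>\<infinity>k\<in>{i}. (if i = k then 1 else 0) * entries A k j)"
      by (rule infsum_cong_neutral) auto
    then show "entries (1 * A) i j = entries A i j" by (simp add: d)
  qed
  show "A * 1 = A"
  proof (rule bmat_eqI)
    fix i j
    have "(\<Sum>\<^sub>\<infinity>k. entries A i k * (if k = j then 1 else 0)) = (\<Sum>\<^sub>\<infinity>k\<in>{j}. entries A i k * (if k = j then 1 else 0))"
      by (rule infsum_cong_neutral) auto
    then show "entries (A * 1) i j = entries A i j" by (simp add: d)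
  qed
  have "entries (0::'a bmat) undefined undefined \<noteq> entries 1 undefined undefined" by (simp add: d)
  then show "(0::'a bmat) \<noteq> 1" by auto
qed

end

lemmas entries_simps [simp] = plus_bmat.rep_eq zero_bmat.rep_eq uminus_bmat.rep_eq

lemma entries_minus [simp]: "entries (A - B) i j = entries A i j - entries B i j"
  by (simp only: minus_bmat_def plus_bmat.rep_eq uminus_bmat.rep_eq) simp

section \<open>Fredholm determinants of matrices with absolutely summable entries\<close>

lemma infsum_single:
  fixes f :: "'a \<Rightarrow> 'b::{topological_comm_monoid_add, t2_space}"
  assumes "\<And>k. k \<noteq> i \<Longrightarrow> f k = 0"
  shows "(\<Sum>\<^sub>\<infinity>k. f k) = f i"
proof -
  have "(\<Sum>\<^sub>\<infinity>k. f k) = (\<Sum>\<^sub>\<infinity>k\<in>{i}. f k)"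
    by (rule infsum_cong_neutral) (use assms in auto)
  then show ?thesis by simp
qed

lift_definition coord_proj :: "'k set \<Rightarrow> 'k bmat" is "\<lambda>S i j. if i = j \<and> i \<in> S then 1 else 0"
proof (intro exI[of _ 1] allI impI conjI)
  fix S F :: "'k set" and i :: 'k assume "finite F"
  have "(\<Sum>j\<in>F. norm (if i = j \<and> i \<in> S then 1 else 0 :: complex)) \<le> (\<Sum>j\<in>F. if j = i then 1 else 0)"
    by (intro sum_mono) auto
  then show "(\<Sum>j\<in>F. norm (if i = j \<and> i \<in> S then 1 else 0 :: complex)) \<le> 1"
    using \<open>finite F\<close> by (simp split: if_splits)
  have "(\<Sum>j\<in>F. norm (if j = i \<and> j \<in> S then 1 else 0 :: complex)) \<le> (\<Sum>j\<in>F. if j = i then 1 else 0)"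
    by (intro sum_mono) auto
  then show "(\<Sum>j\<in>F. norm (if j = i \<and> j \<in> S then 1 else 0 :: complex)) \<le> 1"
    using \<open>finite F\<close> by (simp split: if_splits)
qed

lemma entries_coord_proj_mult [simp]: "entries (coord_proj S * A) i j = (if i \<in> S then entries A i j else 0)"
  unfolding times_bmat.rep_eq coord_proj.rep_eq by (subst infsum_single[of i]) auto

lemma entries_mult_coord_proj [simp]: "entries (A * coord_proj S) i j = (if j \<in> S then entries A i j else 0)"
  unfolding times_bmat.rep_eq coord_proj.rep_eq by (subst infsum_single[of j]) auto

lemma coord_proj_mult_coord_proj [simp]: "coord_proj S * coord_proj T = coord_proj (S \<inter> T)"
  by (rule bmat_eqI) (auto simp: coord_proj.rep_eq)

lemma coord_proj_UNIV [simp]: "coord_proj UNIV = 1"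
  by (rule bmat_eqI) (simp add: coord_proj.rep_eq one_bmat.rep_eq)

lemma coord_proj_empty [simp]: "coord_proj {} = 0"
  by (rule bmat_eqI) (simp add: coord_proj.rep_eq)

lemma coord_proj_Un: "S \<inter> T = {} \<Longrightarrow> coord_proj (S \<union> T) = coord_proj S + coord_proj T"
  by (rule bmat_eqI) (auto simp: coord_proj.rep_eq)

text \<open>
  Matrices with absolutely summable entries are trace class, and they form an ideal of the ring. Every
  perturbation of the identity whose determinant is taken below belongs to it.
\<close>

definition summable_bmat :: "'k bmat \<Rightarrow> bool" where
  "summable_bmat A \<longleftrightarrow> (\<lambda>(i, j). norm (entries A i j)) summable_on UNIV"

lemma summable_bmat_comparison:
  assumes "(\<lambda>(i, j). d i j) summable_on UNIV" "\<And>i j. norm (entries A i j) \<le> d i j"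
  shows "summable_bmat A"
  unfolding summable_bmat_def
  by (rule summable_on_comparison_test[OF assms(1)]) (auto simp: assms(2))

lemma summable_bmat_add:
  assumes "summable_bmat A" "summable_bmat B"
  shows "summable_bmat (A + B)"
proof (rule summable_bmat_comparison)
  show "(\<lambda>(i, j). norm (entries A i j) + norm (entries B i j)) summable_on UNIV"
    using summable_on_add[OF assms[unfolded summable_bmat_def]] by (simp add: case_prod_unfold)
qed (simp add: norm_triangle_ineq)

lemma summable_bmat_uminus: "summable_bmat A \<Longrightarrow> summable_bmat (- A)"
  by (simp add: summable_bmat_def)

lemma summable_bmat_diff: "summable_bmat A \<Longrightarrow> summable_bmat B \<Longrightarrow> summable_bmat (A - B)"
  using summable_bmat_add[of A "- B"] by (simp add: summable_bmat_uminus)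

text \<open>
  Dominates the entries of \<open>A * B\<close> and, at the same time, those of every truncation \<open>A * coord_proj F * B\<close>.
\<close>

definition mult_majorant :: "'k bmat \<Rightarrow> 'k bmat \<Rightarrow> 'k \<Rightarrow> 'k \<Rightarrow> real" where
  "mult_majorant A B i j = (\<Sum>\<^sub>\<infinity>k. norm (entries A i k * entries B k j))"

lemma norm_entries_mult_le: "norm (entries (A * B) i j) \<le> mult_majorant A B i j"
  unfolding times_bmat.rep_eq mult_majorant_def by (rule norm_infsum_bound[OF bmat_mult_summable])

text \<open>
  Summing over the column index \<open>j\<close> first costs only the bound of the row sums of \<open>B\<close>.
\<close>

lemma mult_majorant_summable_left:
  assumes A: "summable_bmat A"
  shows "(\<lambda>(i, j). mult_majorant A B i j) summable_on UNIV"
proof -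
  have "(\<lambda>p. norm (case p of ((i, k), j) \<Rightarrow> entries A i k * entries B k j)) summable_on Sigma UNIV (\<lambda>_. UNIV)"
  proof (rule Infinite_Sum.abs_summable_on_Sigma_iff[THEN iffD2], intro conjI ballI)
    fix p :: "'a \<times> 'a"
    show "(\<lambda>j. norm (case (p, j) of ((i, k), j) \<Rightarrow> entries A i k * entries B k j)) summable_on UNIV"
      by (auto simp: case_prod_unfold norm_mult intro!: summable_on_cmult_right bmat_row_summable)
  next
    have "(\<lambda>p. (case p of (i, k) \<Rightarrow> norm (entries A i k)) * abs_sum_bound B) summable_on UNIV"
      using A unfolding summable_bmat_def by (rule summable_on_cmult_left)
    then show "(\<lambda>p. norm (\<Sum>\<^sub>\<infinity>j. norm (case (p, j) of ((i, k), j) \<Rightarrow> entries A i k * entries B k j))) summable_on UNIV"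
    proof (rule summable_on_comparison_test)
      fix p :: "'a \<times> 'a"
      obtain i k where p: "p = (i, k)" by force
      have "(\<Sum>\<^sub>\<infinity>j. norm (entries B k j)) \<le> abs_sum_bound B"
        by (rule infsum_le_finite_sums[OF bmat_row_summable row_sum_le_bound])
      then show "norm (\<Sum>\<^sub>\<infinity>j. norm (case (p, j) of ((i, k), j) \<Rightarrow> entries A i k * entries B k j))
          \<le> (case p of (i, k) \<Rightarrow> norm (entries A i k)) * abs_sum_bound B"
        by (simp add: p norm_mult infsum_cmult_right' infsum_nonneg abs_mult mult_left_mono)
    qed auto
  qed
  then have "(\<lambda>((i, k), j). norm (entries A i k * entries B k j)) summable_on UNIV"
    by (simp add: case_prod_unfold)
  also have "?this \<longleftrightarrow> (\<lambda>((i, j), k). norm (entries A i k * entries B k j)) summable_on UNIV"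
    by (rule summable_on_reindex_bij_witness[of _ "\<lambda>((i, j), k). ((i, k), j)" "\<lambda>((i, k), j). ((i, j), k)"]) auto
  finally have "(\<lambda>(p, k). norm (entries A (fst p) k * entries B k (snd p))) summable_on Sigma UNIV (\<lambda>_. UNIV)"
    by (simp add: case_prod_unfold)
  from summable_on_Sigma_banach[OF this] show ?thesis
    by (simp add: mult_majorant_def case_prod_unfold)
qed

lemma mult_majorant_summable_right:
  assumes B: "summable_bmat B"
  shows "(\<lambda>(i, j). mult_majorant A B i j) summable_on UNIV"
proof -
  have "(\<lambda>p. norm (case p of ((k, j), i) \<Rightarrow> entries A i k * entries B k j)) summable_on Sigma UNIV (\<lambda>_. UNIV)"
  proof (rule Infinite_Sum.abs_summable_on_Sigma_iff[THEN iffD2], intro conjI ballI)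
    fix p :: "'a \<times> 'a"
    show "(\<lambda>i. norm (case (p, i) of ((k, j), i) \<Rightarrow> entries A i k * entries B k j)) summable_on UNIV"
      by (auto simp: case_prod_unfold norm_mult intro!: summable_on_cmult_left bmat_col_summable)
  next
    have "(\<lambda>p. abs_sum_bound A * (case p of (k, j) \<Rightarrow> norm (entries B k j))) summable_on UNIV"
      using B unfolding summable_bmat_def by (rule summable_on_cmult_right)
    then show "(\<lambda>p. norm (\<Sum>\<^sub>\<infinity>i. norm (case (p, i) of ((k, j), i) \<Rightarrow> entries A i k * entries B k j))) summable_on UNIV"
    proof (rule summable_on_comparison_test)
      fix p :: "'a \<times> 'a"
      obtain k j where p: "p = (k, j)" by force
      have "(\<Sum>\<^sub>\<infinity>i. norm (entries A i k)) \<le> abs_sum_bound A"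
        by (rule infsum_le_finite_sums[OF bmat_col_summable col_sum_le_bound])
      then show "norm (\<Sum>\<^sub>\<infinity>i. norm (case (p, i) of ((k, j), i) \<Rightarrow> entries A i k * entries B k j))
          \<le> abs_sum_bound A * (case p of (k, j) \<Rightarrow> norm (entries B k j))"
        by (simp add: p norm_mult infsum_cmult_left' infsum_nonneg abs_mult mult_right_mono)
    qed auto
  qed
  then have "(\<lambda>((k, j), i). norm (entries A i k * entries B k j)) summable_on UNIV"
    by (simp add: case_prod_unfold)
  also have "?this \<longleftrightarrow> (\<lambda>((i, j), k). norm (entries A i k * entries B k j)) summable_on UNIV"
    by (rule summable_on_reindex_bij_witness[of _ "\<lambda>((i, j), k). ((k, j), i)" "\<lambda>((k, j), i). ((i, j), k)"]) auto
  finally have "(\<lambda>(p, k). norm (entries A (fst p) k * entries B k (snd p))) summable_on Sigma UNIV (\<lambda>_. UNIV)"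
    by (simp add: case_prod_unfold)
  from summable_on_Sigma_banach[OF this] show ?thesis
    by (simp add: mult_majorant_def case_prod_unfold)
qed

lemma summable_bmat_mult_left: "summable_bmat A \<Longrightarrow> summable_bmat (A * B)"
  by (rule summable_bmat_comparison[OF mult_majorant_summable_left norm_entries_mult_le])

lemma summable_bmat_mult_right: "summable_bmat B \<Longrightarrow> summable_bmat (A * B)"
  by (rule summable_bmat_comparison[OF mult_majorant_summable_right norm_entries_mult_le])

text \<open>
  The argument is the matrix \<open>A\<close> itself, a perturbation of the identity, so that the determinant is
  multiplicative.
\<close>

definition fdet :: "'k bmat \<Rightarrow> complex" where
  "fdet A = fredholm_series (entries (A - 1))"

lemma fdet_one_plus: "fdet (1 + Z) = fredholm_series (entries Z)"
  by (simp add: fdet_def)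

text \<open>
  A finite index set that leaves \<open>S\<close> gives a zero row on both sides; inside \<open>S\<close> the two matrices agree.
\<close>

lemma fdet_coord_proj_left: "fdet (1 + coord_proj S * Z) = fdet (1 + coord_proj S * Z * coord_proj S)"
  unfolding fdet_one_plus
proof (rule fredholm_series_cong_minors)
  fix F :: "'a set" assume F: "finite F"
  show "det_on F (entries (coord_proj S * Z)) = det_on F (entries (coord_proj S * Z * coord_proj S))"
  proof (cases "F \<subseteq> S")
    case False
    then obtain i where "i \<in> F" "i \<notin> S" by blast
    then show ?thesis using F by (simp add: det_on_zero_row[of F i])
  qed (auto intro!: det_on_cong)
qed

lemma fdet_coord_proj_right: "fdet (1 + Z * coord_proj S) = fdet (1 + coord_proj S * Z * coord_proj S)"
  unfolding fdet_one_plus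
proof (rule fredholm_series_cong_minors)
  fix F :: "'a set" assume F: "finite F"
  show "det_on F (entries (Z * coord_proj S)) = det_on F (entries (coord_proj S * Z * coord_proj S))"
  proof (cases "F \<subseteq> S")
    case False
    then obtain i where "i \<in> F" "i \<notin> S" by blast
    then show ?thesis using F by (simp add: det_on_zero_col[of F i])
  qed (auto intro!: det_on_cong)
qed

lemma fdet_1 [simp]: "fdet 1 = 1"
  using fredholm_series_finite_support[of "{}" "entries (0 :: 'a bmat)"]
  by (simp add: fdet_def det_on_def)

lemma fdet_finite:
  assumes F: "finite F"
  shows "fdet (1 + coord_proj F * Z * coord_proj F) = det_on F (entries (1 + Z))"
proof -
  have "fdet (1 + coord_proj F * Z * coord_proj F) =
      det_on F (\<lambda>i j. (if i = j then 1 else 0) + entries (coord_proj F * Z * coord_proj F) i j)"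
    unfolding fdet_one_plus by (rule fredholm_series_finite_support[OF F]) (simp add: mult.assoc)
  also have "\<dots> = det_on F (entries (1 + Z))"
    by (rule det_on_cong) (auto simp: one_bmat.rep_eq)
  finally show ?thesis .
qed

lemma entries_mult_coord_proj_mult:
  assumes "finite F"
  shows "entries (A * coord_proj F * B) i j = (\<Sum>k\<in>F. entries A i k * entries B k j)"
proof -
  have "entries (A * coord_proj F * B) i j = (\<Sum>\<^sub>\<infinity>k\<in>F. entries A i k * entries B k j)"
    unfolding times_bmat.rep_eq[of "A * coord_proj F"] by (rule infsum_cong_neutral) auto
  then show ?thesis using assms by simp
qed

text \<open>
  With the projection in the middle, all three determinants are those of finite matrices, because
  \<open>(1 + A) * coord_proj F * (1 + B)\<close> agrees on \<open>F\<close> with the identity plus the perturbation on the left.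
\<close>

lemma fdet_mult_truncated:
  assumes F: "finite F"
  shows "fdet (1 + coord_proj F * (A + B + A * coord_proj F * B) * coord_proj F) = fdet (1 + coord_proj F * A * coord_proj F) * fdet (1 + coord_proj F * B * coord_proj F)"
proof -
  have "det_on F (entries (1 + (A + B + A * coord_proj F * B))) =
      det_on F (\<lambda>i j. \<Sum>k\<in>F. entries (1 + A) i k * entries (1 + B) k j)"
  proof (rule det_on_cong)
    fix i j assume ij: "i \<in> F" "j \<in> F"
    have "entries (1 + (A + B + A * coord_proj F * B)) i j = entries (coord_proj F + coord_proj F * B + A * coord_proj F + A * coord_proj F * B) i j"
      using ij by (simp add: one_bmat.rep_eq coord_proj.rep_eq)
    also have "coord_proj F + coord_proj F * B + A * coord_proj F + A * coord_proj F * B = (1 + A) * coord_proj F * (1 + B)"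
      by (simp add: algebra_simps)
    finally show "entries (1 + (A + B + A * coord_proj F * B)) i j = (\<Sum>k\<in>F. entries (1 + A) i k * entries (1 + B) k j)"
      by (simp only: entries_mult_coord_proj_mult[OF F])
  qed
  also have "\<dots> = det_on F (entries (1 + A)) * det_on F (entries (1 + B))"
    by (rule det_on_mult[OF F])
  finally show ?thesis by (simp only: fdet_finite[OF F])
qed

abbreviation "finite_sets \<equiv> finite_subsets_at_top UNIV"

lemma eventually_finite_sets_mem: "\<forall>\<^sub>F F in finite_sets. finite F \<and> i \<in> F \<and> j \<in> F"
  unfolding eventually_finite_subsets_at_top by (intro exI[of _ "{i, j}"]) auto

lemma eventually_finite_sets_finite: "\<forall>\<^sub>F F in finite_sets. finite F"
  by (rule eventually_mono[OF eventually_finite_sets_mem]) auto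

lemma tendsto_entries_mult_coord_proj_mult:
  "((\<lambda>F. entries (A * coord_proj F * B) i j) \<longlongrightarrow> entries (A * B) i j) finite_sets"
proof -
  have "((\<lambda>F. \<Sum>k\<in>F. entries A i k * entries B k j) \<longlongrightarrow> entries (A * B) i j) finite_sets"
    unfolding times_bmat.rep_eq
    by (rule infsum_tendsto[OF abs_summable_summable[OF bmat_mult_summable]])
  then show ?thesis
    by (rule Lim_transform_eventually)
       (auto intro!: eventually_mono[OF eventually_finite_sets_finite] simp: entries_mult_coord_proj_mult)
qed

lemma tendsto_entries_coord_proj_mult_coord_proj:
  assumes "((\<lambda>F. entries (Z F) i j) \<longlongrightarrow> z) finite_sets"
  shows "((\<lambda>F. entries (coord_proj F * Z F * coord_proj F) i j) \<longlongrightarrow> z) finite_sets"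
  by (rule Lim_transform_eventually[OF assms], rule eventually_mono[OF eventually_finite_sets_mem[of i j]]) auto

lemma norm_entries_mult_coord_proj_mult_le:
  "norm (entries (A * coord_proj F * B) i j) \<le> mult_majorant A B i j"
proof -
  have "norm (entries (A * coord_proj F * B) i j) \<le> mult_majorant (A * coord_proj F) B i j"
    by (rule norm_entries_mult_le)
  also have "\<dots> \<le> mult_majorant A B i j"
    unfolding mult_majorant_def by (intro infsum_mono bmat_mult_summable) auto
  finally show ?thesis .
qed

lemma tendsto_fdet:
  assumes "\<And>i j. ((\<lambda>F. entries (Z F) i j) \<longlongrightarrow> entries L i j) finite_sets"
    and "\<And>F i j. norm (entries (Z F) i j) \<le> d i j" "(\<lambda>(i, j). d i j) summable_on UNIV"
  shows "((\<lambda>F. fdet (1 + Z F)) \<longlongrightarrow> fdet (1 + L)) finite_sets"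
  unfolding fdet_one_plus by (rule tendsto_fredholm_series[OF assms])

lemma fdet_tendsto_truncation:
  assumes "summable_bmat A"
  shows "((\<lambda>F. fdet (1 + coord_proj F * A * coord_proj F)) \<longlongrightarrow> fdet (1 + A)) finite_sets"
  by (rule tendsto_fdet[OF tendsto_entries_coord_proj_mult_coord_proj[OF tendsto_const] _ assms[unfolded summable_bmat_def]]) auto

lemma fdet_mult_one_plus:
  assumes A: "summable_bmat A" and B: "summable_bmat B"
  shows "fdet ((1 + A) * (1 + B)) = fdet (1 + A) * fdet (1 + B)"
proof -
  let ?d = "\<lambda>i j. norm (entries A i j) + norm (entries B i j) + mult_majorant A B i j"
  have "((\<lambda>F. fdet (1 + coord_proj F * (A + B + A * coord_proj F * B) * coord_proj F)) \<longlongrightarrow> fdet (1 + (A + B + A * B))) finite_sets"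
  proof (rule tendsto_fdet)
    show "((\<lambda>F. entries (coord_proj F * (A + B + A * coord_proj F * B) * coord_proj F) i j) \<longlongrightarrow> entries (A + B + A * B) i j) finite_sets" for i j
    proof (rule tendsto_entries_coord_proj_mult_coord_proj)
      show "((\<lambda>F. entries (A + B + A * coord_proj F * B) i j) \<longlongrightarrow> entries (A + B + A * B) i j) finite_sets"
        using tendsto_entries_mult_coord_proj_mult[of A B i j] by (auto intro!: tendsto_intros)
    qed
    show "norm (entries (coord_proj F * (A + B + A * coord_proj F * B) * coord_proj F) i j) \<le> ?d i j" for F i j
    proof -
      have "norm (entries (A + B + A * coord_proj F * B) i j) \<le> ?d i j"
        by (simp only: plus_bmat.rep_eq)
           (intro norm_triangle_le add_mono order_refl norm_entries_mult_coord_proj_mult_le)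
      moreover from this have "0 \<le> ?d i j" by (rule order_trans[OF norm_ge_zero])
      ultimately show ?thesis by auto
    qed
    show "(\<lambda>(i, j). ?d i j) summable_on UNIV"
      using summable_on_add[OF summable_on_add[OF A[unfolded summable_bmat_def] B[unfolded summable_bmat_def]]
        mult_majorant_summable_left[OF A, of B]] by (simp add: case_prod_unfold)
  qed
  moreover have "((\<lambda>F. fdet (1 + coord_proj F * A * coord_proj F) * fdet (1 + coord_proj F * B * coord_proj F)) \<longlongrightarrow> fdet (1 + A) * fdet (1 + B)) finite_sets"
    by (intro tendsto_mult fdet_tendsto_truncation A B)
  then have "((\<lambda>F. fdet (1 + coord_proj F * (A + B + A * coord_proj F * B) * coord_proj F)) \<longlongrightarrow> fdet (1 + A) * fdet (1 + B)) finite_sets"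
    by (rule Lim_transform_eventually)
       (auto intro!: eventually_mono[OF eventually_finite_sets_finite] simp only: fdet_mult_truncated)
  ultimately have "fdet (1 + (A + B + A * B)) = fdet (1 + A) * fdet (1 + B)"
    by (rule tendsto_unique[rotated]) simp
  then show ?thesis by (simp add: algebra_simps)
qed

lemma fdet_mult:
  assumes "summable_bmat (A - 1)" "summable_bmat (B - 1)"
  shows "fdet (A * B) = fdet A * fdet B"
  using fdet_mult_one_plus[OF assms] by simp

text \<open>
  Doubling the index set makes room for the 2 by 2 block matrices behind \<open>det (1 + A B) = det (1 + B A)\<close>.
\<close>

lift_definition block_embed :: "bool \<Rightarrow> bool \<Rightarrow> 'k bmat \<Rightarrow> ('k \<times> bool) bmat" is
  "\<lambda>s t A (i, b) (j, c). if b = s \<and> c = t then A i j else 0"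
proof -
  fix s t and A :: "'k \<Rightarrow> 'k \<Rightarrow> complex"
  assume "\<exists>C. \<forall>i F. finite F \<longrightarrow> (\<Sum>j\<in>F. norm (A i j)) \<le> C \<and> (\<Sum>j\<in>F. norm (A j i)) \<le> C"
  then obtain C where C: "\<And>i F. finite F \<Longrightarrow> (\<Sum>j\<in>F. norm (A i j)) \<le> C"
    "\<And>i F. finite F \<Longrightarrow> (\<Sum>j\<in>F. norm (A j i)) \<le> C" by metis
  have 0: "0 \<le> C" using C(1)[of "{}"] by simp
  have le: "(\<Sum>(j, c)\<in>F. if c = t then norm (f j) else 0) \<le> C"
    if F: "finite F" and f: "\<And>F. finite F \<Longrightarrow> (\<Sum>j\<in>F. norm (f j)) \<le> C"
    for F :: "('k \<times> bool) set" and t and f :: "'k \<Rightarrow> complex"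
  proof -
    have "(\<Sum>(j, c)\<in>F. if c = t then norm (f j) else 0) = (\<Sum>p\<in>{p \<in> F. snd p = t}. norm (f (fst p)))"
      using F by (simp add: sum.inter_filter case_prod_unfold)
    also have "\<dots> = (\<Sum>j\<in>fst ` {p \<in> F. snd p = t}. norm (f j))"
      by (subst sum.reindex) (auto simp: inj_on_def)
    also have "\<dots> \<le> C" using F by (intro f) auto
    finally show ?thesis .
  qed
  show "\<exists>C. \<forall>i F. finite F \<longrightarrow>
      (\<Sum>j\<in>F. norm ((\<lambda>(i, b :: bool) (j, c :: bool). if b = s \<and> c = t then A i j else 0) i j)) \<le> C \<and>
      (\<Sum>j\<in>F. norm ((\<lambda>(i, b :: bool) (j, c :: bool). if b = s \<and> c = t then A i j else 0) j i)) \<le> C"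
  proof (intro exI[of _ C] allI impI conjI)
    fix p :: "'k \<times> bool" and F :: "('k \<times> bool) set" assume F: "finite F"
    obtain i b where p: "p = (i, b)" by force
    show "(\<Sum>j\<in>F. norm ((\<lambda>(i, b :: bool) (j, c :: bool). if b = s \<and> c = t then A i j else 0) p j)) \<le> C"
      using le[OF F C(1), of t i] 0
      by (cases "b = s") (simp_all add: p case_prod_unfold if_distrib[of norm] cong: if_cong)
    show "(\<Sum>j\<in>F. norm ((\<lambda>(i, b :: bool) (j, c :: bool). if b = s \<and> c = t then A i j else 0) j p)) \<le> C"
      using le[OF F C(2), of s i] 0
      by (cases "b = t") (simp_all add: p case_prod_unfold if_distrib[of norm] cong: if_cong)
  qed
qed

lemma block_embed_mult: "block_embed s t A * block_embed t u B = block_embed s u (A * B)"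
proof (rule bmat_eqI)
  fix p q :: "'a \<times> bool"
  obtain i b j c where pq: "p = (i, b)" "q = (j, c)" by (cases p, cases q) auto
  have "entries (block_embed s t A * block_embed t u B) p q =
      (\<Sum>\<^sub>\<infinity>k\<in>range (\<lambda>k. (k, t)). entries (block_embed s t A) p k * entries (block_embed t u B) k q)"
    unfolding times_bmat.rep_eq
    by (rule infsum_cong_neutral) (auto simp: block_embed.rep_eq pq image_iff)
  also have "\<dots> = entries (block_embed s u (A * B)) p q"
    by (subst infsum_reindex) (auto simp: inj_on_def pq block_embed.rep_eq times_bmat.rep_eq o_def)
  finally show "entries (block_embed s t A * block_embed t u B) p q = entries (block_embed s u (A * B)) p q" .
qed

lemma block_embed_mult_0: "t \<noteq> t' \<Longrightarrow> block_embed s t A * block_embed t' u B = 0"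
  by (rule bmat_eqI) (auto simp: times_bmat.rep_eq block_embed.rep_eq case_prod_unfold intro!: infsum_0
    split: if_splits)

definition block_index :: "bool \<Rightarrow> ('k \<times> bool) set" where
  "block_index b = {p. snd p = b}"

lemma coord_proj_mult_block_embed: "coord_proj (block_index b) * block_embed s t A = (if b = s then block_embed s t A else 0)"
  by (rule bmat_eqI) (auto simp: block_embed.rep_eq block_index_def)

lemma block_embed_mult_coord_proj: "block_embed s t A * coord_proj (block_index b) = (if b = t then block_embed s t A else 0)"
  by (rule bmat_eqI) (auto simp: block_embed.rep_eq block_index_def)

lemma summable_block_embed:
  assumes "summable_bmat A"
  shows "summable_bmat (block_embed s t A)"
proof -
  let ?f = "\<lambda>(i, j). ((i, s), (j, t))"
  have "(\<lambda>(p, q). norm (entries (block_embed s t A) p q)) summable_on range ?f"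
    using assms unfolding summable_bmat_def
    by (subst summable_on_reindex) (auto simp: inj_on_def o_def block_embed.rep_eq case_prod_unfold)
  also have "?this \<longleftrightarrow> (\<lambda>(p, q). norm (entries (block_embed s t A) p q)) summable_on UNIV"
    by (rule summable_on_cong_neutral) (auto simp: block_embed.rep_eq image_iff)
  finally show ?thesis by (simp add: summable_bmat_def)
qed

lemma fdet_block_embed: "fdet (1 + block_embed s s A) = fdet (1 + A)"
  unfolding fdet_one_plus
  by (rule fredholm_series_reindex[of "\<lambda>i. (i, s)"]) (auto simp: inj_on_def block_embed.rep_eq image_iff)

text \<open>
  Let \<open>W\<close> be the block matrix with rows \<open>(1, A)\<close> and \<open>(-B, 1)\<close>, and \<open>L\<close> the one with rows \<open>(1, 0)\<close> and
  \<open>(B, 1)\<close>. Both \<open>W * L\<close> and \<open>L * W\<close> are block triangular, with diagonal blocks \<open>1 + A * B\<close>, \<open>1\<close> and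
  \<open>1\<close>, \<open>1 + B * A\<close> respectively, and they have the same determinant.
\<close>

lemma fdet_swap_summable:
  assumes A: "summable_bmat A" and B: "summable_bmat B"
  shows "fdet (1 + A * B) = fdet (1 + B * A)"
proof -
  define W where "W = 1 + (block_embed False True A - block_embed True False B)"
  define L where "L = 1 + block_embed True False B"
  note s = summable_bmat_diff[OF summable_block_embed[OF A] summable_block_embed[OF B]]
  have WL: "W * L = 1 + coord_proj (block_index False) * (block_embed False False (A * B) + block_embed False True A)"
    by (simp add: W_def L_def algebra_simps block_embed_mult block_embed_mult_0 coord_proj_mult_block_embed)
  have LW: "L * W = 1 + (block_embed True True (B * A) + block_embed False True A) * coord_proj (block_index True)"
    by (simp add: W_def L_def algebra_simps block_embed_mult block_embed_mult_0 block_embed_mult_coord_proj)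
  have "fdet (W * L) = fdet (1 + A * B)"
    unfolding WL by (subst fdet_coord_proj_left) (simp add: algebra_simps coord_proj_mult_block_embed block_embed_mult_coord_proj fdet_block_embed)
  moreover have "fdet (L * W) = fdet (1 + B * A)"
    unfolding LW by (subst fdet_coord_proj_right) (simp add: algebra_simps coord_proj_mult_block_embed block_embed_mult_coord_proj fdet_block_embed)
  moreover have "fdet (W * L) = fdet W * fdet L" "fdet (L * W) = fdet L * fdet W"
    using s summable_block_embed[OF B] by (auto intro!: fdet_mult simp: W_def L_def)
  ultimately show ?thesis by (metis mult.commute)
qed

lemma summable_coord_proj_mult:
  assumes "finite F"
  shows "summable_bmat (coord_proj F * B)"
proof -
  have "(\<lambda>p. norm (case p of (i, j) \<Rightarrow> entries (coord_proj F * B) i j)) summable_on Sigma F (\<lambda>_. UNIV)"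
    by (rule Infinite_Sum.abs_summable_on_Sigma_iff[THEN iffD2])
       (use assms in \<open>simp add: bmat_row_summable del: entries_coord_proj_mult\<close>)
  also have "?this \<longleftrightarrow> (\<lambda>(i, j). norm (entries (coord_proj F * B) i j)) summable_on UNIV"
    by (rule summable_on_cong_neutral) (auto split: if_splits)
  finally show ?thesis by (simp add: summable_bmat_def)
qed

text \<open>
  A finite number of rows of \<open>B\<close> is summable, and the rows outside \<open>F\<close> are negligible in the limit. The
  factor \<open>B\<close> is merely bounded, as is necessary for conjugation by Laurent matrices.
\<close>

lemma fdet_swap:
  assumes A: "summable_bmat A"
  shows "fdet (1 + A * B) = fdet (1 + B * A)"
proof -
  have 1: "((\<lambda>F. fdet (1 + A * coord_proj F * B)) \<longlongrightarrow> fdet (1 + A * B)) finite_sets"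
    by (rule tendsto_fdet[OF tendsto_entries_mult_coord_proj_mult norm_entries_mult_coord_proj_mult_le
      mult_majorant_summable_left[OF A]])
  have "((\<lambda>F. fdet (1 + coord_proj F * (B * A) * coord_proj F)) \<longlongrightarrow> fdet (1 + B * A)) finite_sets"
    by (rule fdet_tendsto_truncation[OF summable_bmat_mult_right[OF A]])
  moreover have "\<forall>\<^sub>F F in finite_sets. fdet (1 + coord_proj F * (B * A) * coord_proj F) = fdet (1 + A * coord_proj F * B)"
  proof (rule eventually_mono[OF eventually_finite_sets_finite])
    fix F :: "'a set" assume "finite F"
    then have "fdet (1 + A * (coord_proj F * B)) = fdet (1 + (coord_proj F * B) * A)"
      by (intro fdet_swap_summable A summable_coord_proj_mult)
    then show "fdet (1 + coord_proj F * (B * A) * coord_proj F) = fdet (1 + A * coord_proj F * B)"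
      using fdet_coord_proj_left[of F "B * A"] by (simp add: mult.assoc)
  qed
  ultimately have "((\<lambda>F. fdet (1 + A * coord_proj F * B)) \<longlongrightarrow> fdet (1 + B * A)) finite_sets"
    by (rule Lim_transform_eventually)
  with 1 show ?thesis by (rule tendsto_unique[rotated]) simp
qed

lemma fdet_conj:
  assumes "summable_bmat Z" "U * V = 1"
  shows "fdet (1 + V * Z * U) = fdet (1 + Z)"
  using fdet_swap[OF summable_bmat_mult_right[OF assms(1)], of V U] assms(2)
  by (simp flip: mult.assoc)

lemma coord_proj_mult_coord_proj_mult [simp]: "coord_proj S * (coord_proj T * A) = coord_proj (S \<inter> T) * A"
  by (simp flip: mult.assoc)

lemma coord_proj_add_coord_proj_Compl: "coord_proj S + coord_proj (- S) = 1"
  using coord_proj_Un[of S "- S"] by simp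

text \<open>
  A block triangular matrix is the product of its two diagonal blocks and a unipotent one.
\<close>

lemma fdet_block_triangular:
  assumes A: "summable_bmat (A - 1)" and z: "coord_proj (- S) * A * coord_proj S = 0"
  shows "fdet A = fdet (coord_proj S * A * coord_proj S + coord_proj (- S)) * fdet (coord_proj (- S) * A * coord_proj (- S) + coord_proj S)"
proof -
  let ?p = "coord_proj S" and ?q = "coord_proj (- S)"
  note pq = coord_proj_add_coord_proj_Compl[of S]
  have A_eq: "A = ?p * A * ?p + ?p * A * ?q + ?q * A * ?q"
  proof -
    have "A = (?p + ?q) * A * (?p + ?q)" by (simp add: pq)
    then show ?thesis using z by (simp add: distrib_left distrib_right add_ac)
  qed
  have s: "summable_bmat (coord_proj T * A * coord_proj T + coord_proj (- T) - 1)" for T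
  proof -
    have "coord_proj T * A * coord_proj T + coord_proj (- T) - 1 = coord_proj T * (A - 1) * coord_proj T"
      using coord_proj_add_coord_proj_Compl[of T] by (simp add: algebra_simps)
    then show ?thesis using A by (simp add: summable_bmat_mult_left summable_bmat_mult_right)
  qed
  have u: "fdet (1 + ?p * ((A - 1) * ?q)) = 1"
    by (subst fdet_coord_proj_left) (simp add: mult.assoc)
  have "A = (?q * A * ?q + ?p) * ((1 + ?p * ((A - 1) * ?q)) * (?p * A * ?p + ?q))"
    by (subst A_eq) (simp add: algebra_simps)
  then have "fdet A = fdet ((?q * A * ?q + ?p) * ((1 + ?p * ((A - 1) * ?q)) * (?p * A * ?p + ?q)))" by simp
  also have "\<dots> = fdet (?q * A * ?q + ?p) * (fdet (1 + ?p * ((A - 1) * ?q)) * fdet (?p * A * ?p + ?q))"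
  proof -
    have 1: "summable_bmat (1 + ?p * ((A - 1) * ?q) - 1)"
      using A by (simp add: summable_bmat_mult_left summable_bmat_mult_right)
    have "(1 + ?p * ((A - 1) * ?q)) * (?p * A * ?p + ?q) - 1 =
        ?p * ((A - 1) * ?q) * (?p * A * ?p + ?q) + (?p * A * ?p + ?q - 1)"
      by (simp add: algebra_simps)
    moreover have "summable_bmat (?p * ((A - 1) * ?q) * (?p * A * ?p + ?q) + (?p * A * ?p + ?q - 1))"
      by (intro summable_bmat_add s summable_bmat_mult_left summable_bmat_mult_right A)
    ultimately have "summable_bmat ((1 + ?p * ((A - 1) * ?q)) * (?p * A * ?p + ?q) - 1)" by (simp only:)
    then show ?thesis using s[of S] s[of "- S"] 1 by (simp add: fdet_mult)
  qed
  finally show ?thesis by (simp add: u mult.commute)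
qed

section \<open>Two determinant identities for triangular factors\<close>

lemma det_on_scalar:
  assumes "finite F"
  shows "det_on F (\<lambda>i j. if i = j then c else 0) = c ^ card F"
proof -
  have "det_on F (\<lambda>i j. if i = j then c else 0) =
      (\<Sum>\<pi>\<in>{id}. of_int (sign \<pi>) * (\<Prod>i\<in>F. if i = \<pi> i then c else 0))"
    unfolding det_on_def
  proof (rule sum.mono_neutral_right)
    show "finite {\<pi>. \<pi> permutes F}" using assms by (rule finite_permutations)
    show "\<forall>\<pi>\<in>{\<pi>. \<pi> permutes F} - {id}. of_int (sign \<pi>) * (\<Prod>i\<in>F. if i = \<pi> i then c else 0) = 0"
    proof
      fix \<pi> assume \<pi>: "\<pi> \<in> {\<pi>. \<pi> permutes F} - {id}"
      then obtain i where "i \<noteq> \<pi> i" by (force simp: fun_eq_iff)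
      moreover from this \<pi> have "i \<in> F" by (auto simp: permutes_def)
      ultimately show "of_int (sign \<pi>) * (\<Prod>i\<in>F. if i = \<pi> i then c else 0) = 0"
        using assms by (auto intro!: bexI[of _ i])
    qed
  qed (simp add: permutes_id)
  then show ?thesis by simp
qed

text \<open>
  Block triangularity with respect to the coordinates in \<open>S\<close> and those outside \<open>S\<close>. For \<open>S\<close> a half line
  \<open>{m..}\<close>, \<open>upper\<close> has no entries below, \<open>lower\<close> none above the block diagonal.
\<close>

definition upper :: "'k set \<Rightarrow> 'k bmat \<Rightarrow> bool" where
  "upper S T \<longleftrightarrow> coord_proj S * T * coord_proj (- S) = 0"

definition lower :: "'k set \<Rightarrow> 'k bmat \<Rightarrow> bool" where
  "lower S T \<longleftrightarrow> coord_proj (- S) * T * coord_proj S = 0"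

text \<open>
  The second equation is the first one in the form that rewriting needs inside right-nested products.
\<close>

lemma upper_absorb:
  assumes "upper S T"
  shows "coord_proj S * (T * coord_proj S) = coord_proj S * T" "coord_proj S * (T * (coord_proj S * Z)) = coord_proj S * (T * Z)"
proof -
  have "coord_proj S * T * coord_proj (- S) = 0" using assms by (simp add: upper_def)
  moreover have "coord_proj S * T * coord_proj S + coord_proj S * T * coord_proj (- S) = coord_proj S * T"
    by (simp only: coord_proj_add_coord_proj_Compl mult_1_right flip: distrib_left)
  ultimately show 1: "coord_proj S * (T * coord_proj S) = coord_proj S * T" by (simp only: mult.assoc add_0_right)
  show "coord_proj S * (T * (coord_proj S * Z)) = coord_proj S * (T * Z)"
    using arg_cong[OF 1, of "\<lambda>A. A * Z"] by (simp only: mult.assoc)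
qed

lemma lower_absorb:
  assumes "lower S T"
  shows "coord_proj S * (T * coord_proj S) = T * coord_proj S" "coord_proj S * (T * (coord_proj S * Z)) = T * (coord_proj S * Z)"
proof -
  have "coord_proj (- S) * T * coord_proj S = 0" using assms by (simp add: lower_def)
  moreover have "coord_proj S * (T * coord_proj S) + coord_proj (- S) * (T * coord_proj S) = T * coord_proj S"
    by (simp only: coord_proj_add_coord_proj_Compl mult_1_left flip: distrib_right)
  ultimately show 1: "coord_proj S * (T * coord_proj S) = T * coord_proj S" by (simp only: mult.assoc add_0_right)
  show "coord_proj S * (T * (coord_proj S * Z)) = T * (coord_proj S * Z)"
    using arg_cong[OF 1, of "\<lambda>A. A * Z"] by (simp only: mult.assoc)
qed

lemma mult_eq_1_cancel:
  fixes U V :: "'a::monoid_mult"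
  assumes "U * V = 1" shows "U * (V * Z) = Z"
  by (simp add: assms flip: mult.assoc)

lemma fdet_one_plus_coord_proj:
  assumes "finite F"
  shows "fdet (1 + coord_proj F) = 2 ^ card F"
proof -
  have "fdet (1 + coord_proj F) = det_on F (entries (1 + 1))"
    using fdet_finite[OF assms, of 1] by (simp del: one_add_one)
  also have "entries (1 + 1 :: 'a bmat) = (\<lambda>i j. if i = j then 2 else 0)"
    by (auto simp: fun_eq_iff one_bmat.rep_eq simp del: one_add_one)
  finally show ?thesis by (simp add: det_on_scalar[OF assms])
qed

text \<open>
  Conjugation by \<open>Up\<close> turns \<open>P - C * Q * B\<close> into \<open>X - Y\<close> with the idempotents \<open>X = Upi * P * Up\<close> and
  \<open>Y = Vmi * Q * Vm\<close>. By triangularity \<open>X\<close> has the range of \<open>P\<close> and \<open>Y\<close> has the kernel of \<open>Q\<close>, so with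
  respect to the coordinates outside \<open>P\<close>, in \<open>P - Q\<close> and in \<open>Q\<close> the matrix \<open>1 + X - Y\<close> has block rows
  \<open>(1, 0, *)\<close>, \<open>(*, 2, *)\<close>, \<open>(*, 0, 1)\<close>. The middle column yields the power of 2. Elimination in the remaining
  2 by 2 block matrix leaves the compression of \<open>B * P * C\<close> to \<open>Q\<close>, after conjugation by the
  compression of \<open>Vm\<close>. The elimination divides by nothing, so the case of determinant 0 is included.
\<close>

lemma fdet_projection_difference:
  fixes Up Upi Vm Vmi :: "'k bmat"
  assumes QP: "Q \<subseteq> P" and fin: "finite (P - Q)"
    and U: "Up * Upi = 1" "Upi * Up = 1" and V: "Vm * Vmi = 1" "Vmi * Vm = 1"
    and low: "lower P Up" "lower P Upi" and upp: "upper Q Vm" "upper Q Vmi"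
    and s1: "summable_bmat (coord_proj P * Up * coord_proj (- P))" and s2: "summable_bmat (coord_proj (- Q) * Vmi * coord_proj Q)"
  defines "B \<equiv> Vm * Upi" and "C \<equiv> Up * Vmi"
  shows "fdet (1 + coord_proj P - C * coord_proj Q * B) = 2 ^ card (P - Q) * fdet (1 - coord_proj Q + coord_proj Q * B * coord_proj P * C * coord_proj Q)"
    and "summable_bmat (coord_proj P - C * coord_proj Q * B)"
proof -
  define p n q q' e f where "p = coord_proj P" and "n = coord_proj (- P)" and "q = coord_proj Q" and "q' = coord_proj (- Q)"
    and "e = coord_proj (P - Q)" and "f = coord_proj (- (P - Q))"
  note d = p_def n_def q_def q'_def e_def f_def
  note Compl_Diff_eq [simp del]
  have sets: "P \<inter> Q = Q" "Q \<inter> P = Q" "- (P - Q) \<inter> P = Q" "P \<inter> - (P - Q) = Q" "- (P - Q) \<inter> - P = - P"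
    "- P \<inter> - (P - Q) = - P" "- P \<inter> Q = {}" "Q \<inter> - P = {}" "- (P - Q) \<inter> Q = Q" "Q \<inter> - (P - Q) = Q"
    "- (P - Q) \<inter> - Q = - P" "- P \<inter> - Q = - P"
    using QP by auto
  have pe: "p = q + e" using QP coord_proj_Un[of Q "P - Q"] by (simp add: d Un_absorb1)
  have pn: "p + n = 1" "q + q' = 1" "e + f = 1" unfolding d by (rule coord_proj_add_coord_proj_Compl)+
  note Vc = mult_eq_1_cancel[OF V(1)] mult_eq_1_cancel[OF V(2)]
  note Uc = mult_eq_1_cancel[OF U(1)] mult_eq_1_cancel[OF U(2)]
  have qV: "q * (Vm * q) = q * Vm" "q * (Vm * (q * Z)) = q * (Vm * Z)"
    "q * (Vmi * q) = q * Vmi" "q * (Vmi * (q * Z)) = q * (Vmi * Z)" for Z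
    unfolding d by (simp_all add: upper_absorb[OF upp(1)] upper_absorb[OF upp(2)])
  have Up: "p * (Up * p) = Up * p" "p * (Up * (p * Z)) = Up * (p * Z)"
    "p * (Upi * p) = Upi * p" "p * (Upi * (p * Z)) = Upi * (p * Z)" for Z
    unfolding d by (simp_all add: lower_absorb[OF low(1)] lower_absorb[OF low(2)])
  \<comment> \<open>\<open>X\<close> has the range of \<open>P\<close> and \<open>Y\<close> the kernel of \<open>Q\<close>; this is where triangularity enters.\<close>
  define X Y where "X = Upi * p * Up" and "Y = Vmi * q * Vm"
  have Xp: "X * p = p" using Up by (simp add: X_def mult.assoc Uc U)
  have pX: "p * X = X" using Up by (simp add: X_def mult.assoc)
  have qY: "q * Y = q" by (simp add: Y_def mult.assoc qV V)
  have qY2: "q * (Y * Z) = q * Z" for Z using qY by (simp flip: mult.assoc)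
  have Yq: "Y * q = Y" by (simp add: Y_def mult.assoc qV)
  have Xn: "X * n = X - p"
  proof -
    have "X * (p + n) = X" by (simp add: pn)
    then show ?thesis by (simp add: distrib_left Xp algebra_simps)
  qed
  \<comment> \<open>The parts of \<open>X\<close> and \<open>Y\<close> off the diagonal inherit summability from the two corners in the assumptions.\<close>
  define D K where "D = X * n" and "K = q' * Y"
  have X_eq: "X = p + D" by (simp add: D_def Xn)
  have Y_eq: "Y = q + K"
  proof -
    have "(q + q') * Y = Y" by (simp add: pn)
    then show ?thesis by (simp add: distrib_right qY K_def)
  qed
  have sD: "summable_bmat D"
  proof -
    have "D = p * X * n" by (simp only: D_def pX)
    also have "\<dots> = p * Upi * (coord_proj P * Up * coord_proj (- P))" by (simp only: X_def d mult.assoc)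
    finally have "D = p * Upi * (coord_proj P * Up * coord_proj (- P))" .
    then show ?thesis using s1 by (simp add: summable_bmat_mult_right)
  qed
  have sK: "summable_bmat K"
  proof -
    have "K = coord_proj (- Q) * Vmi * coord_proj Q * Vm"
      by (simp add: K_def Y_def d mult.assoc)
    then show ?thesis using s2 by (simp add: summable_bmat_mult_left)
  qed
  have se: "summable_bmat e" using summable_coord_proj_mult[OF fin, of 1] by (simp add: d)
  have De: "D * e = 0" using QP by (simp add: D_def d mult.assoc Int_absorb1 Diff_eq Int_assoc[symmetric])
  have Ke: "K * e = 0"
  proof -
    have "K * e = q' * (Y * q) * e" by (simp add: Yq K_def)
    then show ?thesis by (simp add: d mult.assoc)
  qed
  have XY: "X - Y = e + D - K" by (simp add: X_eq Y_eq pe)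
  have sXY: "summable_bmat (X - Y)" unfolding XY by (intro summable_bmat_diff summable_bmat_add se sD sK)
  have R: "p - C * q * B = Up * (X - Y) * Upi"
    by (simp add: X_def Y_def B_def C_def right_diff_distrib left_diff_distrib mult.assoc U Uc)
  show "summable_bmat (coord_proj P - C * coord_proj Q * B)"
    using R sXY by (simp add: d summable_bmat_mult_left summable_bmat_mult_right)
  have "fdet (1 + (p - C * q * B)) = fdet (1 + (X - Y))"
    unfolding R by (rule fdet_conj[OF sXY U(2)])
  also have "1 + (X - Y) = 1 + e + D - K" by (simp add: XY)
  \<comment> \<open>The columns in \<open>P - Q\<close> of \<open>1 + X - Y\<close> are twice those of the identity.\<close>
  also have "fdet \<dots> = fdet (e * (1 + e + D - K) * e + f) * fdet (f * (1 + e + D - K) * f + e)"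
    unfolding d
  proof (rule fdet_block_triangular[of _ "P - Q", simplified double_complement])
    show "summable_bmat (1 + coord_proj (P - Q) + D - K - 1)"
      using summable_bmat_diff[OF summable_bmat_add[OF se sD] sK] by (simp add: d)
    show "coord_proj (- (P - Q)) * (1 + coord_proj (P - Q) + D - K) * coord_proj (P - Q) = 0"
      using De Ke by (simp add: d algebra_simps)
  qed
  also have "e * (1 + e + D - K) * e + f = 1 + e"
  proof -
    note De Ke
    then have "e * (1 + e + D - K) * e = e + e"
      using De Ke by (simp add: d algebra_simps)
    then show ?thesis using pn(3) by (simp add: algebra_simps)
  qed
  also have "f * (1 + e + D - K) * f + e = 1 + q * X * n - n * Y * q"
  proof -
    have "f * D * f = f * (p * X) * n * f" by (simp add: pX D_def mult.assoc)
    also have "\<dots> = q * X * n" by (simp add: d sets mult.assoc)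
    finally have 1: "f * (D * f) = q * (X * n)" by (simp add: mult.assoc)
    have "f * K * f = f * q' * (Y * q) * f" by (simp add: Yq K_def mult.assoc)
    also have "\<dots> = n * Y * q" by (simp add: d sets mult.assoc)
    finally have 2: "f * (K * f) = n * (Y * q)" by (simp add: mult.assoc)
    have "f * (1 + e + D - K) * f + e = f * f + e + f * (e * f) + f * (D * f) - f * (K * f)"
      by (simp add: algebra_simps)
    also have "\<dots> = (e + f) + q * (X * n) - n * (Y * q)"
    proof -
      have "f * f = f" "f * (e * f) = 0" by (simp_all add: d)
      then show ?thesis unfolding 1 2 by (simp add: algebra_simps)
    qed
    finally show ?thesis by (simp only: pn(3) mult.assoc)
  qed
  also have "fdet (1 + q * X * n - n * Y * q) = fdet (1 + q * X * n * Y * q)"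
  proof -
    \<comment> \<open>Left multiplication by \<open>1 - D2\<close>, of determinant 1, eliminates \<open>D2\<close>.\<close>
    define D2 C1 where "D2 = q * X * n" and "C1 = n * Y * q"
    have sD2: "summable_bmat D2" using sD by (simp add: D2_def D_def mult.assoc summable_bmat_mult_right)
    have sC1: "summable_bmat C1"
    proof -
      have "C1 = n * K" using Yq by (simp add: C1_def K_def d mult.assoc sets)
      then show ?thesis using sK by (simp add: summable_bmat_mult_right)
    qed
    have z: "D2 * D2 = 0" "q * C1 = 0" "C1 * q = C1" "q * D2 = D2" "D2 * q = 0"
      by (simp_all add: D2_def C1_def d mult.assoc sets)
    have "fdet (1 - D2) = fdet (1 + coord_proj Q * (- D2))" using z(4) by (simp add: d)
    also have "\<dots> = 1" using z(5) by (subst fdet_coord_proj_left) (simp add: d mult.assoc)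
    finally have "fdet (1 + D2 - C1) = fdet (1 - D2) * fdet (1 + D2 - C1)" by simp
    also have "\<dots> = fdet ((1 - D2) * (1 + D2 - C1))"
      using summable_bmat_diff[OF sD2 sC1] summable_bmat_uminus[OF sD2] by (intro fdet_mult[symmetric]) simp_all
    also have "(1 - D2) * (1 + D2 - C1) = 1 + (D2 * C1 - C1) * coord_proj Q"
      using z by (simp add: algebra_simps d)
    also have "fdet \<dots> = fdet (1 + D2 * C1)"
    proof (subst fdet_coord_proj_right)
      have "coord_proj Q * (D2 * C1 - C1) * coord_proj Q = (q * D2) * (C1 * q) - q * C1 * q"
        by (simp add: d right_diff_distrib left_diff_distrib mult.assoc)
      then show "fdet (1 + coord_proj Q * (D2 * C1 - C1) * coord_proj Q) = fdet (1 + D2 * C1)" by (simp add: z)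
    qed
    also have "D2 * C1 = q * X * n * Y * q" by (simp add: D2_def C1_def d mult.assoc)
    finally show ?thesis by (simp add: D2_def C1_def)
  qed
  \<comment> \<open>Conjugation by \<open>q * Vm * q\<close>, whose inverse on the range of \<open>q\<close> is \<open>q * Vmi * q\<close>.\<close>
  also have "\<dots> = fdet (1 + (q * Vm * (q * X * n * Y * q)) * (Vmi * q))"
  proof -
    have "summable_bmat (q * Vm * (q * X * n * Y * q))"
    proof -
      have "q * Vm * (q * X * n * Y * q) = q * Vm * q * D * (Y * q)" by (simp only: D_def mult.assoc)
      then show ?thesis using sD by (simp only: summable_bmat_mult_left summable_bmat_mult_right)
    qed
    then have "fdet (1 + (q * Vm * (q * X * n * Y * q)) * (Vmi * q)) = fdet (1 + (Vmi * q) * (q * Vm * (q * X * n * Y * q)))"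
      by (rule fdet_swap)
    also have "(Vmi * q) * (q * Vm * (q * X * n * Y * q)) = Y * (q * X * n * Y) * coord_proj Q"
      by (simp add: Y_def d mult.assoc)
    also have "fdet (1 + \<dots>) = fdet (1 + coord_proj Q * (Y * (q * X * n * Y)) * coord_proj Q)" by (rule fdet_coord_proj_right)
    also have "coord_proj Q * (Y * (q * X * n * Y)) * coord_proj Q = q * X * n * Y * q"
      by (simp only: mult.assoc qY2 flip: d(3)) (simp add: d)
    finally show ?thesis by (simp only:)
  qed
  also have "(q * Vm * (q * X * n * Y * q)) * (Vmi * q) = q * B * p * C * q - q"
  proof -
    have "(q * Vm * (q * X * n * Y * q)) * (Vmi * q) = q * (Vm * (X * n * (Vmi * q)))"
      by (simp add: mult.assoc qV Y_def Vc) (simp add: d)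
    also have "\<dots> = q * (Vm * (X * (Vmi * q))) - q * (Vm * (p * (Vmi * q)))"
      by (simp add: Xn right_diff_distrib left_diff_distrib)
    also have "q * (Vm * (p * (Vmi * q))) = q"
    proof -
      have qp: "q * (p * Z) = q * Z" for Z by (simp add: d sets)
      have "q * (Vm * (p * (Vmi * q))) = q * (Vm * (q * (p * (Vmi * q))))" by (simp only: qV)
      also have "\<dots> = q" by (simp only: qp qV Vc V mult_1_right)
      finally show ?thesis .
    qed
    finally show ?thesis by (simp add: B_def C_def X_def mult.assoc)
  qed
  finally show "fdet (1 + coord_proj P - C * coord_proj Q * B) = 2 ^ card (P - Q) * fdet (1 - coord_proj Q + coord_proj Q * B * coord_proj P * C * coord_proj Q)"
    using fdet_one_plus_coord_proj[OF fin] by (simp add: d algebra_simps)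
qed

lemma det_on_mult_coord_proj_mult:
  assumes "finite F"
  shows "det_on F (entries (A * coord_proj F * B)) = det_on F (entries A) * det_on F (entries B)"
proof -
  have "det_on F (entries (A * coord_proj F * B)) = det_on F (\<lambda>i j. \<Sum>k\<in>F. entries A i k * entries B k j)"
    using assms by (intro det_on_cong) (simp add: entries_mult_coord_proj_mult)
  then show ?thesis by (simp add: det_on_mult[OF assms])
qed

lemma det_on_compression: "det_on F (entries (coord_proj F * A * coord_proj F)) = det_on F (entries A)"
  by (rule det_on_cong) simp

text \<open>
  Jacobi's identity for complementary minors of \<open>J\<close> and \<open>M = J\<^sup>-\<^sup>1\<close>: replacing the columns of \<open>M\<close> outside \<open>F\<close>
  by those of the identity gives \<open>M * (1 + (J - 1) * coord_proj (- F))\<close>.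
\<close>

lemma jacobi_complementary_minor:
  assumes fin: "finite F" and J: "summable_bmat (J - 1)" and inv: "J * M = 1" "M * J = 1"
  shows "det_on F (entries M) * fdet J = fdet (1 + coord_proj (- F) * (J - 1) * coord_proj (- F))"
proof -
  define e f where "e = coord_proj F" and "f = coord_proj (- F)"
  have ef: "e + f = 1" unfolding e_def f_def by (rule coord_proj_add_coord_proj_Compl)
  have "M - 1 = M * - (J - 1)" by (simp add: algebra_simps inv)
  then have M: "summable_bmat (M - 1)" using J by (simp only: summable_bmat_mult_right summable_bmat_uminus)
  have "det_on F (entries M) = fdet (1 + coord_proj F * (M - 1) * coord_proj F)"
    using fdet_finite[OF fin, of "M - 1"] by simp
  also have "\<dots> = fdet (1 + (M - 1) * e)" unfolding e_def by (rule fdet_coord_proj_right[symmetric])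
  also have "1 + (M - 1) * e = M * (1 + (J - 1) * f)"
  proof -
    have "M * (1 + (J - 1) * f) = M * (1 - f) + (M * J) * f" by (simp add: algebra_simps)
    also have "1 - f = e" using ef by (simp add: algebra_simps)
    also have "M * e + (M * J) * f = (e + f) + (M - 1) * e" by (simp add: inv algebra_simps)
    finally show ?thesis by (simp add: ef)
  qed
  also have "fdet \<dots> = fdet M * fdet (1 + (J - 1) * f)"
    using M J by (intro fdet_mult) (simp_all add: summable_bmat_mult_left)
  also have "fdet (1 + (J - 1) * f) = fdet (1 + coord_proj (- F) * (J - 1) * coord_proj (- F))"
    unfolding f_def by (rule fdet_coord_proj_right)
  finally have "det_on F (entries M) * fdet J = (fdet M * fdet J) * fdet (1 + coord_proj (- F) * (J - 1) * coord_proj (- F))"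
    by simp
  moreover have "fdet M * fdet J = 1" using fdet_mult[OF M J] by (simp add: inv)
  ultimately show ?thesis by simp
qed

text \<open>
  The Borodin-Okounkov identity in algebraic form. The compression \<open>J\<close> of \<open>B * P * C\<close> to \<open>P\<close>, completed by the
  identity, is a product of compressions of triangular matrices and is therefore invertible; its inverse \<open>M\<close>
  satisfies \<open>P * Um * Up * P = (P * Vp * P) * M * (P * Vm * P)\<close>. As the sections of \<open>Vp\<close> and \<open>Vm\<close> to \<open>P - Q\<close>
  split off by triangularity, the section of \<open>Um * Up\<close> is that of \<open>M\<close> up to two determinants, and Jacobi's
  identity converts the minor of \<open>M\<close> into one of \<open>J\<close>.
\<close>

lemma toeplitz_minor_identity:
  fixes Um Umi Up Upi Vm Vmi Vp Vpi :: "'k bmat"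
  assumes QP: "Q \<subseteq> P" and fin: "finite (P - Q)"
    and Um: "Um * Umi = 1" "Umi * Um = 1" "upper P Um" "upper P Umi"
    and Up: "Up * Upi = 1" "Upi * Up = 1" "lower P Up" "lower P Upi"
    and Vm: "Vm * Vmi = 1" "Vmi * Vm = 1" "upper P Vm" "upper P Vmi" "upper Q Vm"
    and Vp: "Vp * Vpi = 1" "Vpi * Vp = 1" "lower P Vp" "lower P Vpi" "lower Q Vp"
    and fac: "Um * Up = Vp * Vm"
    and s: "summable_bmat (coord_proj P * Upi * coord_proj (- P))"
  defines "B \<equiv> Vm * Upi" and "C \<equiv> Up * Vmi"
  shows "det_on (P - Q) (entries (Um * Up)) * fdet (1 - coord_proj P * B * coord_proj (- P) * C * coord_proj P) =
    det_on (P - Q) (entries Vp) * det_on (P - Q) (entries Vm) *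
    fdet (1 - coord_proj Q + coord_proj Q * B * coord_proj P * C * coord_proj Q)"
    and "fdet (1 - coord_proj P * B * coord_proj (- P) * C * coord_proj P) \<noteq> 0"
    and "summable_bmat (coord_proj P * B * coord_proj (- P) * C * coord_proj P)"
proof -
  define p n q e f where "p = coord_proj P" and "n = coord_proj (- P)" and "q = coord_proj Q"
    and "e = coord_proj (P - Q)" and "f = coord_proj (- (P - Q))"
  note d = p_def n_def q_def e_def f_def
  note Compl_Diff_eq [simp del]
  have sets: "P \<inter> Q = Q" "Q \<inter> P = Q" "- (P - Q) \<inter> P = Q" "P \<inter> - (P - Q) = Q"
    "P \<inter> (P - Q) = P - Q" "(P - Q) \<inter> P = P - Q"
    "(P - Q) \<inter> Q = {}" "Q \<inter> (P - Q) = {}" "(P - Q) \<inter> - P = {}"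
    using QP by auto
  have pe: "p = q + e" using QP coord_proj_Un[of Q "P - Q"] by (simp add: d Un_absorb1)
  have pn: "p + n = 1" unfolding d by (rule coord_proj_add_coord_proj_Compl)
  have np: "n + p = 1" using pn by (simp add: add.commute)
  have pp: "p * p = p" "p * (p * Z) = p * Z" "p * e = e" "e * p = e" "e * (p * Z) = e * Z"
    "p * (e * Z) = e * Z" "p * n = 0" "n * p = 0" "n * n = n" "p * (n * Z) = 0" "n * (p * Z) = 0"
    "p * q = q" "q * p = q" "q * (p * Z) = q * Z" "p * (q * Z) = q * Z" "q * e = 0" "e * q = 0"
    "e * e = e" "e * (e * Z) = e * Z" "e * (q * Z) = 0" for Z
    by (simp_all add: d sets)
  note inv = Um(1,2) Up(1,2) Vm(1,2) Vp(1,2) Um(1,2)[THEN mult_eq_1_cancel] Up(1,2)[THEN mult_eq_1_cancel]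
    Vm(1,2)[THEN mult_eq_1_cancel] Vp(1,2)[THEN mult_eq_1_cancel]
  note upp = Um(3,4)[THEN upper_absorb(1), folded p_def] Um(3,4)[THEN upper_absorb(2), folded p_def]
    Vm(3,4)[THEN upper_absorb(1), folded p_def] Vm(3,4)[THEN upper_absorb(2), folded p_def]
  note low = Up(3,4)[THEN lower_absorb(1), folded p_def] Up(3,4)[THEN lower_absorb(2), folded p_def]
    Vp(3,4)[THEN lower_absorb(1), folded p_def] Vp(3,4)[THEN lower_absorb(2), folded p_def]
  have C_eq: "C = Umi * Vp"
  proof -
    have "Umi * (Um * Up) * Vmi = Umi * (Vp * Vm) * Vmi" by (simp only: fac)
    then show ?thesis by (simp add: C_def mult.assoc inv)
  qed
  have BC: "B * C = 1" by (simp add: B_def C_def mult.assoc inv)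
  \<comment> \<open>On \<open>P\<close> the inverse is obtained by inverting the four triangular factors of \<open>J\<close> in reverse order.\<close>
  define J where "J = n + p * B * p * C * p"
  define M where "M = n + p * Vpi * p * Um * p * Up * p * Vmi * p"
  have J_eq: "J - 1 = - (p * B * n * C * p)"
  proof -
    have "p = p * B * (p + n) * C * p"
      by (simp add: pn mult.assoc) (simp add: BC pp flip: mult.assoc[of B C])
    also have "\<dots> = p * B * p * C * p + p * B * n * C * p" by (simp add: distrib_left distrib_right)
    finally have "J + p * B * n * C * p = n + p" by (simp add: J_def)
    then show ?thesis using pn by (simp add: algebra_simps)
  qed
  have "p * B * n = p * Vm * (coord_proj P * Upi * coord_proj (- P))"
  proof -
    have "p * B * n = p * (Vm * p) * Upi * n" by (simp add: B_def upp mult.assoc)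
    then show ?thesis by (simp add: d mult.assoc)
  qed
  then have spBn: "summable_bmat (p * B * n)" using s by (simp add: summable_bmat_mult_right)
  then show "summable_bmat (coord_proj P * B * coord_proj (- P) * C * coord_proj P)"
    by (simp add: summable_bmat_mult_left d)
  then have sJ: "summable_bmat (J - 1)" unfolding J_eq by (simp add: summable_bmat_uminus d)
  have J1: "J = n + p * Vm * p * Upi * p * Umi * p * Vp * p"
    unfolding J_def by (subst C_eq) (simp add: B_def mult.assoc upp low pp)
  have JM: "J * M = 1" and MJ: "M * J = 1"
    unfolding J1 M_def
    by (simp_all add: distrib_left distrib_right mult.assoc pp) (simp_all add: upp low inv pp np)
  have J2: "1 - coord_proj P * B * coord_proj (- P) * C * coord_proj P = J"
    using J_eq by (simp add: d algebra_simps)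
  have "fdet M * fdet J = 1"
  proof -
    have "M - 1 = M * - (J - 1)" by (simp add: algebra_simps MJ)
    then have "summable_bmat (M - 1)" using sJ by (simp only: summable_bmat_mult_right summable_bmat_uminus)
    from fdet_mult[OF this sJ] show ?thesis by (simp add: MJ)
  qed
  then show "fdet (1 - coord_proj P * B * coord_proj (- P) * C * coord_proj P) \<noteq> 0" unfolding J2 by auto
  have 1: "det_on (P - Q) (entries M) * fdet J = fdet (1 - coord_proj Q + coord_proj Q * B * coord_proj P * C * coord_proj Q)"
  proof -
    have "f * (J - 1) * f = (f * p) * (- (B * n * C)) * (p * f)" by (simp add: J_eq mult.assoc)
    also have "\<dots> = - (q * B * n * C * q)" by (simp add: d sets mult.assoc)
    also have "\<dots> = - q + q * B * p * C * q"
    proof -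
      have "q = q * B * (p + n) * C * q"
        by (simp add: pn mult.assoc) (simp add: BC d flip: mult.assoc[of B C])
      also have "\<dots> = q * B * p * C * q + q * B * n * C * q" by (simp add: distrib_left distrib_right)
      finally show ?thesis by (simp add: algebra_simps)
    qed
    finally have "coord_proj (- (P - Q)) * (J - 1) * coord_proj (- (P - Q)) = - q + q * B * p * C * q"
      by (simp only: f_def)
    then show ?thesis
      unfolding jacobi_complementary_minor[OF fin sJ JM MJ] by (simp add: d add_diff_eq diff_add_eq)
  qed
  have 2: "e * (Um * Up) * e = (e * Vp * e) * coord_proj (P - Q) * ((e * M * e) * coord_proj (P - Q) * (e * Vm * e))"
  proof -
    have en: "e * n = 0" "e * (n * Z) = 0" for Z by (simp_all add: d sets)
    have eM: "e * M * e = e * (Vpi * (p * (Um * (Up * (p * (Vmi * e))))))"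
      by (simp add: M_def distrib_left distrib_right mult.assoc pp en upp)
    have e: "e = p - q" by (simp add: pe)
    \<comment> \<open>The section of \<open>Vp\<close> cancels \<open>Vpi\<close>, because rows of \<open>Vp\<close> in \<open>P - Q\<close> have no entries in \<open>Q\<close>.\<close>
    have L: "e * (Vp * (e * (Vpi * (p * Z)))) = e * Z" for Z
    proof -
      have "e * (Vp * (q * W)) = e * (q * (Vp * (q * W)))" for W
        using lower_absorb(2)[OF Vp(5), of W] by (simp add: q_def)
      then have "e * (Vp * (q * W)) = 0" for W by (simp only: pp)
      then have "e * (Vp * (e * W)) = e * (Vp * (p * W))" for W
        unfolding pe by (simp add: distrib_left distrib_right)
      then show ?thesis by (simp only: low inv pp)
    qed
    \<comment> \<open>Dually, columns of \<open>Vm\<close> in \<open>P - Q\<close> have no entries in \<open>Q\<close>.\<close>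
    have R: "p * (Vmi * (e * (Vm * e))) = e"
    proof -
      have "q * (Vm * e) = q * (Vm * (q * e))"
        using upper_absorb(2)[OF Vm(5), of e] by (simp add: q_def)
      then have "q * (Vm * e) = 0" by (simp add: pp)
      then have "p * (Vm * e) = e * (Vm * e)" unfolding pe by (simp add: distrib_right)
      then have "p * (Vmi * (e * (Vm * e))) = p * (Vmi * (p * (Vm * e)))" by simp
      then show ?thesis by (simp only: upp inv pp)
    qed
    show ?thesis
      by (simp only: e_def[symmetric] eM) (simp add: mult.assoc pp L R)
  qed
  have "det_on (P - Q) (entries (Um * Up)) = det_on (P - Q) (entries (e * (Um * Up) * e))"
    by (simp add: d det_on_compression)
  also have "\<dots> = det_on (P - Q) (entries Vp) * (det_on (P - Q) (entries M) * det_on (P - Q) (entries Vm))"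
    unfolding 2 by (simp only: det_on_mult_coord_proj_mult[OF fin] e_def det_on_compression)
  finally show "det_on (P - Q) (entries (Um * Up)) * fdet (1 - coord_proj P * B * coord_proj (- P) * C * coord_proj P) =
    det_on (P - Q) (entries Vp) * det_on (P - Q) (entries Vm) *
    fdet (1 - coord_proj Q + coord_proj Q * B * coord_proj P * C * coord_proj Q)"
    unfolding J2 1[symmetric] by simp
qed

section \<open>Uniqueness of Fourier coefficients and the convolution theorem\<close>

definition ess_bounded :: "(real \<Rightarrow> complex) \<Rightarrow> bool" where
  "ess_bounded w \<longleftrightarrow> w \<in> borel_measurable angles \<and> (\<exists>C. AE \<theta> in angles. norm (w \<theta>) \<le> C)"

lemma finite_measure_angles: "finite_measure angles"
  by (rule finite_measure_lebesgue_on) simp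

lemma ess_bounded_integrable: "ess_bounded w \<Longrightarrow> integrable angles w"
  unfolding ess_bounded_def using finite_measure.integrable_const_bound[OF finite_measure_angles] by blast

lemma ess_bounded_measurable: "ess_bounded w \<Longrightarrow> w \<in> borel_measurable angles"
  by (simp add: ess_bounded_def)

lemma ess_bounded_add: "ess_bounded u \<Longrightarrow> ess_bounded v \<Longrightarrow> ess_bounded (\<lambda>\<theta>. u \<theta> + v \<theta>)"
proof -
  assume u: "ess_bounded u" and v: "ess_bounded v"
  obtain C D where "AE \<theta> in angles. norm (u \<theta>) \<le> C" "AE \<theta> in angles. norm (v \<theta>) \<le> D"
    using u v unfolding ess_bounded_def by blast
  then have "AE \<theta> in angles. norm (u \<theta> + v \<theta>) \<le> C + D"
    by eventually_elim (rule norm_triangle_mono)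
  then show ?thesis using u v unfolding ess_bounded_def by (blast intro: borel_measurable_add)
qed

lemma ess_bounded_mult: "ess_bounded u \<Longrightarrow> ess_bounded v \<Longrightarrow> ess_bounded (\<lambda>\<theta>. u \<theta> * v \<theta>)"
proof -
  assume u: "ess_bounded u" and v: "ess_bounded v"
  obtain C D where "AE \<theta> in angles. norm (u \<theta>) \<le> C" "AE \<theta> in angles. norm (v \<theta>) \<le> D"
    using u v unfolding ess_bounded_def by blast
  then have "AE \<theta> in angles. norm (u \<theta> * v \<theta>) \<le> C * D"
  proof eventually_elim
    case (elim \<theta>)
    moreover from elim have "0 \<le> C" using norm_ge_zero order_trans by blast
    ultimately show ?case by (simp add: norm_mult mult_mono)
  qed
  then show ?thesis using u v unfolding ess_bounded_def by (blast intro: borel_measurable_times)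
qed

lemma ess_bounded_continuous:
  assumes "continuous_on {0..2 * pi} w"
  shows "ess_bounded w"
proof -
  have "w \<in> borel_measurable angles"
    using assms by (intro continuous_imp_measurable_on_sets_lebesgue) auto
  moreover have "compact (w ` {0..2 * pi})" using assms by (intro compact_continuous_image) auto
  then obtain C where "\<And>\<theta>. \<theta> \<in> {0..2 * pi} \<Longrightarrow> norm (w \<theta>) \<le> C"
    by (meson compact_imp_bounded bounded_iff imageI)
  then have "AE \<theta> in angles. norm (w \<theta>) \<le> C"
    by (intro AE_I2) simp
  ultimately show ?thesis unfolding ess_bounded_def by blast
qed

lemma ess_bounded_const: "ess_bounded (\<lambda>_. c)"
  by (intro ess_bounded_continuous continuous_intros)

lemma continuous_cis_mult: "continuous_on S (\<lambda>\<theta>. cis (x * \<theta>))"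
  unfolding cis_conv_exp by (intro continuous_intros)

lemma ess_bounded_cis: "ess_bounded (\<lambda>\<theta>. cis (x * \<theta>))"
  by (intro ess_bounded_continuous continuous_cis_mult)

lemma integral_uniform_approx:
  assumes u: "ess_bounded u" and v: "ess_bounded v" and w: "ess_bounded w"
    and e: "\<And>\<theta>. \<theta> \<in> {0..2 * pi} \<Longrightarrow> norm (u \<theta> - v \<theta>) \<le> e"
  shows "norm ((LINT \<theta>|angles. u \<theta> * w \<theta>) - (LINT \<theta>|angles. v \<theta> * w \<theta>)) \<le> e * (LINT \<theta>|angles. norm (w \<theta>))"
proof -
  note i = ess_bounded_integrable[OF ess_bounded_mult[OF u w]] ess_bounded_integrable[OF ess_bounded_mult[OF v w]]
  have "(LINT \<theta>|angles. u \<theta> * w \<theta>) - (LINT \<theta>|angles. v \<theta> * w \<theta>) = (LINT \<theta>|angles. (u \<theta> - v \<theta>) * w \<theta>)"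
    using i by (simp add: left_diff_distrib)
  also have "norm \<dots> \<le> (LINT \<theta>|angles. e * norm (w \<theta>))"
  proof (rule Bochner_Integration.integral_norm_bound_integral)
    show "integrable angles (\<lambda>\<theta>. (u \<theta> - v \<theta>) * w \<theta>)" using i by (simp add: left_diff_distrib)
    show "integrable angles (\<lambda>\<theta>. e * norm (w \<theta>))"
      using ess_bounded_integrable[OF w] by (intro integrable_mult_right integrable_norm)
    show "norm ((u \<theta> - v \<theta>) * w \<theta>) \<le> e * norm (w \<theta>)" if "\<theta> \<in> space angles" for \<theta>
      using e[of \<theta>] that by (simp add: norm_mult mult_right_mono)
  qed
  finally show ?thesis by simp
qed

definition no_fourier :: "(real \<Rightarrow> complex) \<Rightarrow> bool" where
  "no_fourier w \<longleftrightarrow> ess_bounded w \<and> (\<forall>k::int. (LINT \<theta>|angles. w \<theta> * cis (of_int k * \<theta>)) = 0)"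

lemma no_fourier_add:
  assumes "no_fourier u" "no_fourier v"
  shows "no_fourier (\<lambda>\<theta>. u \<theta> + v \<theta>)"
  using assms ess_bounded_integrable[OF ess_bounded_mult[OF _ ess_bounded_cis]]
  by (auto simp: no_fourier_def ess_bounded_add distrib_right)

lemma no_fourier_cmult:
  assumes "no_fourier u"
  shows "no_fourier (\<lambda>\<theta>. c * u \<theta>)"
  using assms by (auto simp: no_fourier_def ess_bounded_mult ess_bounded_const mult.assoc)

lemma no_fourier_cis:
  assumes "no_fourier u"
  shows "no_fourier (\<lambda>\<theta>. cis (of_int m * \<theta>) * u \<theta>)"
proof -
  have *: "(LINT \<theta>|angles. (cis (of_int m * \<theta>) * u \<theta>) * cis (of_int k * \<theta>)) =
      (LINT \<theta>|angles. u \<theta> * cis (of_int (m + k) * \<theta>))" for k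
    by (rule arg_cong2[where f = lebesgue_integral]) (auto simp: fun_eq_iff cis_mult ring_distribs add.commute)
  show ?thesis
    using assms unfolding no_fourier_def * by (simp add: ess_bounded_mult ess_bounded_cis del: of_int_add)
qed

text \<open>
  On the circle a real linear function is a combination of \<open>cis \<theta>\<close> and \<open>cis (- \<theta>)\<close>, and multiplication by these
  only shifts the Fourier coefficients.
\<close>

lemma no_fourier_polynomial:
  assumes "real_polynomial_function p" "no_fourier w"
  shows "no_fourier (\<lambda>\<theta>. of_real (p (cis \<theta>)) * w \<theta>)"
  using assms
proof (induction arbitrary: w)
  case (linear f)
  interpret bounded_linear f by (rule linear)
  have *: "of_real (f (cis \<theta>)) * w \<theta> =
      (of_real (f 1) / 2 + of_real (f \<i>) / (2 * \<i>)) * (cis (of_int 1 * \<theta>) * w \<theta>) +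
      (of_real (f 1) / 2 - of_real (f \<i>) / (2 * \<i>)) * (cis (of_int (-1) * \<theta>) * w \<theta>)" for \<theta>
  proof -
    have "cis \<theta> = cos \<theta> *\<^sub>R 1 + sin \<theta> *\<^sub>R \<i>" by (simp add: complex_eq_iff)
    then have "f (cis \<theta>) = cos \<theta> * f 1 + sin \<theta> * f \<i>" by (simp add: add scaleR)
    then show ?thesis by (simp add: complex_eq_iff field_simps)
  qed
  show ?case unfolding * by (intro no_fourier_add no_fourier_cmult no_fourier_cis linear.prems)
next
  case (const c)
  then show ?case by (rule no_fourier_cmult)
next
  case (add f g)
  then show ?case using no_fourier_add by (simp add: distrib_right)
next
  case (mult f g)
  from mult.IH(1)[OF mult.IH(2)[OF mult.prems]] show ?case by (simp add: mult.assoc)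
qed

text \<open>
  By Stone-Weierstrass, polynomials are uniformly dense in the continuous functions on the circle.
\<close>

lemma no_fourier_integral_continuous:
  fixes \<phi> :: "complex \<Rightarrow> real"
  assumes w: "no_fourier w" and \<phi>: "continuous_on (sphere 0 1) \<phi>"
  shows "(LINT \<theta>|angles. of_real (\<phi> (cis \<theta>)) * w \<theta>) = 0"
proof -
  have bw: "ess_bounded w" using w by (simp add: no_fourier_def)
  define I where "I = (LINT \<theta>|angles. norm (w \<theta>))"
  have I: "0 \<le> I" unfolding I_def by simp
  have cis_sphere: "cis ` S \<subseteq> sphere 0 1" for S by auto
  have c: "continuous_on {0..2 * pi} (\<lambda>\<theta>. complex_of_real (\<psi> (cis \<theta>)))"
    if "continuous_on (sphere 0 1) \<psi>" for \<psi> :: "complex \<Rightarrow> real"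
    using continuous_cis_mult[of _ 1] that
    by (intro continuous_intros continuous_on_compose2[OF that]) (auto simp: cis_sphere)
  have "norm (LINT \<theta>|angles. of_real (\<phi> (cis \<theta>)) * w \<theta>) \<le> e * I" if e: "e > 0" for e
  proof -
    obtain p where p: "real_polynomial_function p" "\<And>x. x \<in> sphere 0 1 \<Longrightarrow> \<bar>\<phi> x - p x\<bar> < e"
      using Stone_Weierstrass_real_polynomial_function[OF compact_sphere \<phi> e] by blast
    have "no_fourier (\<lambda>\<theta>. of_real (p (cis \<theta>)) * w \<theta>)" by (rule no_fourier_polynomial[OF p(1) w])
    then have "(LINT \<theta>|angles. of_real (p (cis \<theta>)) * w \<theta> * cis (of_int 0 * \<theta>)) = 0"
      unfolding no_fourier_def by blast
    then have 0: "(LINT \<theta>|angles. of_real (p (cis \<theta>)) * w \<theta>) = 0" by simp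
    have "norm ((LINT \<theta>|angles. of_real (\<phi> (cis \<theta>)) * w \<theta>) - (LINT \<theta>|angles. of_real (p (cis \<theta>)) * w \<theta>)) \<le> e * I"
      unfolding I_def
    proof (rule integral_uniform_approx[OF _ _ bw])
      show "ess_bounded (\<lambda>\<theta>. complex_of_real (\<phi> (cis \<theta>)))" "ess_bounded (\<lambda>\<theta>. complex_of_real (p (cis \<theta>)))"
        by (intro ess_bounded_continuous c \<phi> continuous_on_polymonial_function[OF p(1)[unfolded real_polynomial_function_eq]])+
      show "norm (complex_of_real (\<phi> (cis \<theta>)) - of_real (p (cis \<theta>))) \<le> e" for \<theta>
        using p(2)[of "cis \<theta>"] by (simp flip: of_real_diff)
    qed
    then show ?thesis by (simp add: 0)
  qed
  note le = this
  have "norm (LINT \<theta>|angles. of_real (\<phi> (cis \<theta>)) * w \<theta>) \<le> 0"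
  proof (rule field_le_epsilon)
    fix e :: real assume "e > 0"
    then have "e / (I + 1) > 0" using I by simp
    from le[OF this] have "norm (LINT \<theta>|angles. of_real (\<phi> (cis \<theta>)) * w \<theta>) \<le> e / (I + 1) * I" .
    also have "\<dots> \<le> e" using I \<open>e > 0\<close> by (simp add: field_simps)
    finally show "norm (LINT \<theta>|angles. of_real (\<phi> (cis \<theta>)) * w \<theta>) \<le> 0 + e" by simp
  qed
  then show ?thesis by simp
qed

lemma cis_eq_imp_eq:
  assumes "cis x = cis y" "0 < y" "y < 2 * pi" "0 \<le> x" "x \<le> 2 * pi"
  shows "x = y"
proof -
  have "sin x = sin y" "cos x = cos y" using assms(1) by (simp_all add: complex_eq_iff)
  then obtain n :: int where n: "x = y + 2 * pi * of_int n"
    using sin_cos_eq_iff[of x y] by auto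
  have "\<bar>2 * pi * of_int n\<bar> < 2 * pi" using n assms by auto
  then have "\<bar>of_int n :: real\<bar> < 1" using pi_gt_zero by (simp add: abs_mult)
  then show ?thesis using n by simp
qed

text \<open>
  The indicator of the compact arc set \<open>cis ` K\<close> is a bounded limit of continuous functions of the distance to
  it. The end points are excluded from \<open>K\<close> because the angles \<open>0\<close> and \<open>2 * pi\<close> are the same point of the circle.
\<close>

lemma no_fourier_integral_compact:
  assumes w: "no_fourier w" and K: "compact K" "K \<subseteq> {0<..<2 * pi}"
  shows "(LINT \<theta>|angles. indicator K \<theta> * w \<theta>) = 0"
proof (cases "K = {}")
  case False
  have bw: "ess_bounded w" using w by (simp add: no_fourier_def)
  define A where "A = cis ` K"
  have A: "closed A" "A \<noteq> {}" using False continuous_cis_mult[of K 1] K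
    by (auto simp: A_def intro!: compact_imp_closed compact_continuous_image)
  define \<phi> :: "nat \<Rightarrow> complex \<Rightarrow> real" where "\<phi> m z = max 0 (1 - real m * infdist z A)" for m z
  have cont: "continuous_on S (\<phi> m)" for m S
    unfolding \<phi>_def by (intro continuous_intros)
  have lim: "(\<lambda>m. complex_of_real (\<phi> m (cis \<theta>)) * w \<theta>) \<longlonglongrightarrow> indicator K \<theta> * w \<theta>" if "\<theta> \<in> {0..2 * pi}" for \<theta>
  proof (cases "\<theta> \<in> K")
    case True
    then have "infdist (cis \<theta>) A = 0" by (auto simp: A_def)
    then show ?thesis using True by (simp add: \<phi>_def)
  next
    case nK: False
    have "cis \<theta> \<notin> A"
    proof
      assume "cis \<theta> \<in> A"
      then obtain t where "t \<in> K" "cis \<theta> = cis t" by (auto simp: A_def)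
      then show False using cis_eq_imp_eq[of \<theta> t] K(2) that nK by auto
    qed
    then have d: "infdist (cis \<theta>) A > 0"
      using in_closed_iff_infdist_zero[OF A] infdist_nonneg[of "cis \<theta>" A] by (simp add: less_le)
    obtain M :: nat where M: "1 / infdist (cis \<theta>) A < M" using reals_Archimedean2 by blast
    have "\<phi> m (cis \<theta>) = 0" if "m \<ge> M" for m
    proof -
      have "1 / infdist (cis \<theta>) A < m" using M that by simp
      then show ?thesis using d by (simp add: \<phi>_def field_simps)
    qed
    then have "\<forall>\<^sub>F m in sequentially. complex_of_real (\<phi> m (cis \<theta>)) * w \<theta> = indicator K \<theta> * w \<theta>"
      using nK by (auto simp: eventually_sequentially)
    then show ?thesis by (rule tendsto_eventually)
  qed
  have "(\<lambda>m. LINT \<theta>|angles. complex_of_real (\<phi> m (cis \<theta>)) * w \<theta>) \<longlonglongrightarrow> (LINT \<theta>|angles. indicator K \<theta> * w \<theta>)"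
  proof (rule integral_dominated_convergence[where w = "\<lambda>\<theta>. norm (w \<theta>)"])
    have "K \<in> sets lebesgue" using K(1) by (simp add: compact_imp_closed borel_closed)
    then have "(\<lambda>\<theta>. indicator K \<theta> :: complex) \<in> borel_measurable angles"
      by (intro measurable_restrict_space1 borel_measurable_indicator) 
    then show "(\<lambda>\<theta>. indicator K \<theta> * w \<theta>) \<in> borel_measurable angles"
      using ess_bounded_measurable[OF bw] by (rule borel_measurable_times)
    show "(\<lambda>\<theta>. complex_of_real (\<phi> m (cis \<theta>)) * w \<theta>) \<in> borel_measurable angles" for m
    proof (intro borel_measurable_times ess_bounded_measurable[OF bw] ess_bounded_measurable[OF ess_bounded_continuous])
      show "continuous_on {0..2 * pi} (\<lambda>\<theta>. complex_of_real (\<phi> m (cis \<theta>)))"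
        using continuous_cis_mult[of _ 1]
        by (intro continuous_intros continuous_on_compose2[OF cont[of UNIV]]) auto
    qed
    show "integrable angles (\<lambda>\<theta>. norm (w \<theta>))"
      using ess_bounded_integrable[OF bw] by (rule integrable_norm)
    show "AE \<theta> in angles. (\<lambda>m. complex_of_real (\<phi> m (cis \<theta>)) * w \<theta>) \<longlonglongrightarrow> indicator K \<theta> * w \<theta>"
      by (rule AE_I2) (simp add: lim)
    show "AE \<theta> in angles. norm (complex_of_real (\<phi> m (cis \<theta>)) * w \<theta>) \<le> norm (w \<theta>)" for m
    proof (rule AE_I2)
      fix \<theta>
      have "\<bar>\<phi> m (cis \<theta>)\<bar> \<le> 1" by (auto simp: \<phi>_def infdist_nonneg)
      then show "norm (complex_of_real (\<phi> m (cis \<theta>)) * w \<theta>) \<le> norm (w \<theta>)"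
        by (simp add: norm_mult mult_left_le_one_le)
    qed
  qed
  moreover have "(LINT \<theta>|angles. complex_of_real (\<phi> m (cis \<theta>)) * w \<theta>) = 0" for m
    by (rule no_fourier_integral_continuous[OF w cont])
  ultimately show ?thesis by (simp add: LIMSEQ_const_iff)
qed simp

text \<open>
  The integral over a compact subset of \<open>{Re w > 0}\<close> vanishes although the integrand is positive there, so
  the subset is null. By inner regularity \<open>{Re w > 0}\<close> is null as well.
\<close>

lemma no_fourier_Re_le_0:
  assumes w: "no_fourier w"
  shows "AE \<theta> in angles. Re (w \<theta>) \<le> 0"
proof -
  have mw: "w \<in> borel_measurable angles" and bw: "ess_bounded w"
    using w by (simp_all add: no_fourier_def ess_bounded_def)
  define E where "E = {\<theta> \<in> {0<..<2 * pi}. Re (w \<theta>) > 0}"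
  have "{\<theta> \<in> space angles. Re (w \<theta>) > 0} \<in> sets angles"
    using mw by measurable
  then have "{\<theta> \<in> space angles. Re (w \<theta>) > 0} \<in> sets lebesgue"
    by (simp add: sets_restrict_space_iff)
  then have "{\<theta> \<in> space angles. Re (w \<theta>) > 0} \<inter> {0<..<2 * pi} \<in> sets lebesgue"
    by (intro sets.Int) auto
  also have "{\<theta> \<in> space angles. Re (w \<theta>) > 0} \<inter> {0<..<2 * pi} = E" by (auto simp: E_def)
  finally have E: "E \<in> sets lebesgue" .
  have null: "K \<in> null_sets lebesgue" if K: "compact K" "K \<subseteq> E" for K
  proof -
    have K2: "K \<subseteq> {0<..<2 * pi}" using K by (auto simp: E_def)
    have Kl: "K \<in> sets lebesgue" using K(1) by (simp add: compact_imp_closed borel_closed)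
    then have mK: "(\<lambda>\<theta>. indicator K \<theta> :: complex) \<in> borel_measurable angles"
      by (intro measurable_restrict_space1 borel_measurable_indicator) 
    have "AE \<theta> in angles. norm (indicator K \<theta> :: complex) \<le> 1" by (simp add: indicator_def)
    then have bK: "ess_bounded (indicator K)" using mK unfolding ess_bounded_def by blast
    have int: "integrable angles (\<lambda>\<theta>. indicator K \<theta> * w \<theta>)"
      by (intro ess_bounded_integrable ess_bounded_mult bK bw)
    have "(LINT \<theta>|angles. Re (indicator K \<theta> * w \<theta>)) = Re (LINT \<theta>|angles. indicator K \<theta> * w \<theta>)"
      by (rule integral_Re[OF int])
    also have "\<dots> = 0" by (simp add: no_fourier_integral_compact[OF w K(1) K2])
    finally have "(LINT \<theta>|angles. Re (indicator K \<theta> * w \<theta>)) = 0" .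
    moreover have "AE \<theta> in angles. 0 \<le> Re (indicator K \<theta> * w \<theta>)"
      using K(2) by (intro AE_I2) (auto simp: indicator_def E_def)
    ultimately have "AE \<theta> in angles. Re (indicator K \<theta> * w \<theta>) = 0"
      using integral_nonneg_eq_0_iff_AE[OF integrable_Re[OF int]] by blast
    then have "AE \<theta> in angles. \<theta> \<notin> K"
      by eventually_elim (use K(2) in \<open>auto simp: indicator_def E_def\<close>)
    then have "AE \<theta> in lebesgue. \<theta> \<notin> K"
      by (subst (asm) AE_restrict_space_iff) (use K2 in \<open>auto elim!: eventually_mono\<close>)
    then show ?thesis using Kl by (simp add: AE_iff_null_sets)
  qed
  have "emeasure lebesgue E = 0"
  proof (rule ccontr)
    assume ne: "emeasure lebesgue E \<noteq> 0"
    have "emeasure lebesgue E \<le> emeasure lebesgue {0<..<2 * pi}"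
      by (rule emeasure_mono) (auto simp: E_def)
    then have fin: "emeasure lebesgue E < \<infinity>"
      using order_le_less_trans[OF _ ennreal_less_top[of "2 * pi"]] by simp
    define r where "r = measure lebesgue E"
    have r: "emeasure lebesgue E = ennreal r" using fin by (simp add: r_def emeasure_eq_ennreal_measure)
    then have "r > 0" using ne by (cases "r \<le> 0") (auto simp: ennreal_neg)
    then obtain T where T: "closed T" "T \<subseteq> E" "E - T \<in> lmeasurable" "emeasure lebesgue (E - T) < ennreal r"
      using sets_lebesgue_inner_closed[OF E] by blast
    have "bounded T"
      by (rule bounded_subset[of "{0..2 * pi}"]) (use T(2) in \<open>auto simp: E_def\<close>)
    then have "T \<in> null_sets lebesgue" using T by (intro null) (auto simp: compact_eq_bounded_closed)
    then have "emeasure lebesgue (E - T) = emeasure lebesgue E"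
      by (rule emeasure_Diff_null_set[OF _ E])
    then show False using T(4) r by simp
  qed
  then have "AE \<theta> in lebesgue. \<theta> \<notin> E" using E by (intro AE_not_in null_setsI)
  moreover have "AE \<theta> in lebesgue. \<theta> \<noteq> (0 :: real)" "AE \<theta> in lebesgue. \<theta> \<noteq> 2 * pi"
    using AE_iff_null_sets[of "{0::real}" lebesgue] AE_iff_null_sets[of "{2 * pi}" lebesgue] by auto
  ultimately have "AE \<theta> in lebesgue. \<theta> \<in> {0..2 * pi} \<longrightarrow> Re (w \<theta>) \<le> 0"
    by eventually_elim (auto simp: E_def not_less)
  then show ?thesis by (subst AE_restrict_space_iff) auto
qed

text \<open>
  Uniqueness of Fourier coefficients: apply the one-sided estimate to \<open>w\<close>, \<open>- w\<close>, \<open>\<i> w\<close> and \<open>- \<i> w\<close>.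
\<close>

lemma no_fourier_AE_0:
  assumes w: "no_fourier w"
  shows "AE \<theta> in angles. w \<theta> = 0"
proof -
  have "AE \<theta> in angles. Re (c * w \<theta>) \<le> 0" for c
    by (rule no_fourier_Re_le_0[OF no_fourier_cmult[OF w]])
  from this[of 1] this[of "-1"] this[of \<i>] this[of "- \<i>"]
  show ?thesis by eventually_elim (auto simp: complex_eq_iff)
qed

lemma integral_cis:
  "(LINT \<theta>|angles. cis (of_int k * \<theta>)) = (if k = 0 then 2 * pi else 0)"
proof (cases "k = 0")
  case True
  then show ?thesis by (simp add: measure_restrict_space scaleR_conv_of_real)
next
  case False
  let ?F = "\<lambda>\<theta>. cis (of_int k * \<theta>) / (of_int k * \<i>)"
  have "((\<lambda>\<theta>. cis (of_int k * \<theta>)) has_integral (?F (2 * pi) - ?F 0)) {0..2 * pi}"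
  proof (rule fundamental_theorem_of_calculus)
    fix x :: real
    have "((\<lambda>z. exp (\<i> * (of_int k * z)) / (of_int k * \<i>)) has_field_derivative exp (\<i> * (of_int k * x))) (at (of_real x))"
      using False by (auto intro!: derivative_eq_intros)
    from has_vector_derivative_real_field[OF this]
    show "(?F has_vector_derivative cis (of_int k * x)) (at x within {0..2 * pi})"
      by (simp add: cis_conv_exp)
  qed simp
  moreover have "?F (2 * pi) = ?F 0"
    using cis_multiple_2pi[of "of_int k"] by (simp add: mult_ac)
  ultimately have "integral {0..2 * pi} (\<lambda>\<theta>. cis (of_int k * \<theta>)) = 0"
    by (simp add: integral_unique)
  then show ?thesis
    using False by (subst lebesgue_integral_eq_integral[OF ess_bounded_integrable[OF ess_bounded_cis]]) auto
qed

definition fourier_sum :: "(int \<Rightarrow> complex) \<Rightarrow> real \<Rightarrow> complex" where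
  "fourier_sum a \<theta> = (\<Sum>\<^sub>\<infinity>j. a j * cis (of_int j * \<theta>))"

context
  fixes a :: "int \<Rightarrow> complex"
  assumes a: "(\<lambda>j. norm (a j)) summable_on UNIV"
begin

lemma fourier_sum_uniform:
  "uniform_limit UNIV (\<lambda>J \<theta>. \<Sum>j\<in>J. a j * cis (of_int j * \<theta>)) (fourier_sum a) (finite_subsets_at_top UNIV)"
  unfolding fourier_sum_def[abs_def]
  by (rule Weierstrass_m_test_general[OF _ a]) (simp add: norm_mult)

lemma continuous_partial_sum: "continuous_on S (\<lambda>\<theta>. \<Sum>j\<in>J. a j * cis (of_int j * \<theta>))"
  by (intro continuous_intros continuous_cis_mult)

lemma ess_bounded_fourier_sum: "ess_bounded (fourier_sum a)"
  by (rule ess_bounded_continuous, rule continuous_on_subset[OF uniform_limit_theorem[OF _ fourier_sum_uniform]])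
     (auto intro!: always_eventually continuous_partial_sum)

lemma fourier_sum_integral:
  assumes w: "ess_bounded w"
  shows "((\<lambda>j. a j * (LINT \<theta>|angles. cis (of_int j * \<theta>) * w \<theta>)) has_sum
           (LINT \<theta>|angles. fourier_sum a \<theta> * w \<theta>)) UNIV"
proof -
  define I where "I = (LINT \<theta>|angles. norm (w \<theta>))"
  have I: "0 \<le> I" unfolding I_def by simp
  let ?S = "\<lambda>J \<theta>. \<Sum>j\<in>J. a j * cis (of_int j * \<theta>)"
  have bS: "ess_bounded (?S J)" for J by (rule ess_bounded_continuous[OF continuous_partial_sum])
  have sum: "(LINT \<theta>|angles. ?S J \<theta> * w \<theta>) = (\<Sum>j\<in>J. a j * (LINT \<theta>|angles. cis (of_int j * \<theta>) * w \<theta>))" for J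
    using ess_bounded_integrable[OF ess_bounded_mult[OF ess_bounded_cis w]]
    by (simp add: sum_distrib_right mult.assoc)
  show ?thesis
    unfolding has_sum_def
  proof (rule tendstoI)
    fix e :: real assume "e > 0"
    then have d: "e / (I + 1) > 0" using I by simp
    from uniform_limitD[OF fourier_sum_uniform this]
    show "\<forall>\<^sub>F J in finite_subsets_at_top UNIV. dist (\<Sum>j\<in>J. a j * (LINT \<theta>|angles. cis (of_int j * \<theta>) * w \<theta>))
        (LINT \<theta>|angles. fourier_sum a \<theta> * w \<theta>) < e"
    proof eventually_elim
      case (elim J)
      have "dist (\<Sum>j\<in>J. a j * (LINT \<theta>|angles. cis (of_int j * \<theta>) * w \<theta>)) (LINT \<theta>|angles. fourier_sum a \<theta> * w \<theta>)
          \<le> e / (I + 1) * I"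
        unfolding dist_norm sum[symmetric] I_def[symmetric]
        using integral_uniform_approx[OF bS ess_bounded_fourier_sum w, of J "e / (I + 1)"] elim
        by (auto simp: dist_norm I_def less_imp_le)
      also have "\<dots> < e" using I \<open>e > 0\<close> by (simp add: field_simps)
      finally show ?case .
    qed
  qed
qed

lemma fourier_sum_coefficient:
  "(LINT \<theta>|angles. fourier_sum a \<theta> * cis (of_int k * \<theta>)) = 2 * pi * a (- k)"
proof -
  have "(LINT \<theta>|angles. cis (of_int j * \<theta>) * cis (of_int k * \<theta>)) = (if j = - k then 2 * pi else 0)" for j
    using integral_cis[of "j + k"] by (simp add: cis_mult distrib_right eq_neg_iff_add_eq_0)
  then have "((\<lambda>j. a j * (if j = - k then 2 * pi else 0)) has_sum
      (LINT \<theta>|angles. fourier_sum a \<theta> * cis (of_int k * \<theta>))) UNIV"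
    using fourier_sum_integral[OF ess_bounded_cis, of "of_int k"] by simp
  moreover have "((\<lambda>j. a j * (if j = - k then 2 * pi else 0)) has_sum (2 * pi * a (- k))) UNIV"
    by (rule has_sum_finite_neutralI[of "{- k}"]) auto
  ultimately show ?thesis by (rule has_sum_unique)
qed

end

text \<open>
  The difference of the two sides is essentially bounded and all its Fourier coefficients vanish.
\<close>

lemma fourier_inversion:
  fixes f :: "complex \<Rightarrow> complex"
  assumes f: "ess_bounded (\<lambda>\<theta>. f (cis \<theta>))" and s: "(\<lambda>j. norm (fourier f j)) summable_on UNIV"
  shows "AE \<theta> in angles. f (cis \<theta>) = fourier_sum (fourier f) \<theta>"
proof -
  let ?h = "\<lambda>\<theta>. f (cis \<theta>) + - 1 * fourier_sum (fourier f) \<theta>"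
  have "no_fourier ?h"
    unfolding no_fourier_def
  proof (intro conjI allI)
    have bF: "ess_bounded (\<lambda>\<theta>. - 1 * fourier_sum (fourier f) \<theta>)"
      by (intro ess_bounded_mult ess_bounded_const ess_bounded_fourier_sum s)
    show "ess_bounded ?h" by (intro ess_bounded_add f bF)
    fix k :: int
    have "(LINT \<theta>|angles. ?h \<theta> * cis (of_int k * \<theta>)) =
        (LINT \<theta>|angles. f (cis \<theta>) * cis (of_int k * \<theta>)) - (LINT \<theta>|angles. fourier_sum (fourier f) \<theta> * cis (of_int k * \<theta>))"
      using ess_bounded_integrable[OF ess_bounded_mult[OF f ess_bounded_cis]]
        ess_bounded_integrable[OF ess_bounded_mult[OF ess_bounded_fourier_sum[OF s] ess_bounded_cis]]
      by (simp add: left_diff_distrib)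
    also have "\<dots> = 0"
      unfolding fourier_sum_coefficient[OF s] by (simp add: fourier_def)
    finally show "(LINT \<theta>|angles. ?h \<theta> * cis (of_int k * \<theta>)) = 0" .
  qed
  from no_fourier_AE_0[OF this] show ?thesis by eventually_elim simp
qed

text \<open>
  The convolution theorem. Summability of the coefficients of one factor is enough: that factor is replaced by
  its uniformly convergent Fourier series, which is integrated term by term against the other.
\<close>

lemma fourier_mult:
  fixes f g :: "complex \<Rightarrow> complex"
  assumes f: "ess_bounded (\<lambda>\<theta>. f (cis \<theta>))" and g: "ess_bounded (\<lambda>\<theta>. g (cis \<theta>))"
    and s: "(\<lambda>j. norm (fourier f j)) summable_on UNIV"
  shows "((\<lambda>j. fourier f j * fourier g (k - j)) has_sum fourier (\<lambda>z. f z * g z) k) UNIV"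
proof -
  have b: "ess_bounded (\<lambda>\<theta>. g (cis \<theta>) * cis (- of_int k * \<theta>))"
    by (intro ess_bounded_mult g ess_bounded_cis)
  have 1: "(LINT \<theta>|angles. cis (of_int j * \<theta>) * (g (cis \<theta>) * cis (- of_int k * \<theta>))) = 2 * pi * fourier g (k - j)" for j
  proof -
    have "(\<lambda>\<theta>. cis (of_int j * \<theta>) * (g (cis \<theta>) * cis (- of_int k * \<theta>))) = (\<lambda>\<theta>. g (cis \<theta>) * cis (- (of_int (k - j) * \<theta>)))"
      by (simp add: fun_eq_iff mult.left_commute cis_mult algebra_simps)
    then show ?thesis by (simp add: fourier_def)
  qed
  have 2: "(LINT \<theta>|angles. fourier_sum (fourier f) \<theta> * (g (cis \<theta>) * cis (- of_int k * \<theta>))) =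
      2 * pi * fourier (\<lambda>z. f z * g z) k"
  proof -
    have "(LINT \<theta>|angles. fourier_sum (fourier f) \<theta> * (g (cis \<theta>) * cis (- of_int k * \<theta>))) =
        (LINT \<theta>|angles. f (cis \<theta>) * g (cis \<theta>) * cis (- (of_int k * \<theta>)))"
    proof (rule integral_cong_AE)
      show "(\<lambda>\<theta>. fourier_sum (fourier f) \<theta> * (g (cis \<theta>) * cis (- of_int k * \<theta>))) \<in> borel_measurable angles"
        by (intro ess_bounded_measurable ess_bounded_mult b ess_bounded_fourier_sum s)
      have "ess_bounded (\<lambda>\<theta>. f (cis \<theta>) * (g (cis \<theta>) * cis (- of_int k * \<theta>)))"
        by (intro ess_bounded_mult b f)
      then show "(\<lambda>\<theta>. f (cis \<theta>) * g (cis \<theta>) * cis (- (of_int k * \<theta>))) \<in> borel_measurable angles"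
        using ess_bounded_measurable by (simp add: mult.assoc)
      show "AE \<theta> in angles. fourier_sum (fourier f) \<theta> * (g (cis \<theta>) * cis (- of_int k * \<theta>)) =
          f (cis \<theta>) * g (cis \<theta>) * cis (- (of_int k * \<theta>))"
        using fourier_inversion[OF f s] by eventually_elim (simp add: mult.assoc)
    qed
    then show ?thesis by (simp add: fourier_def)
  qed
  have "((\<lambda>j. fourier f j * (2 * pi * fourier g (k - j))) has_sum 2 * pi * fourier (\<lambda>z. f z * g z) k) UNIV"
    using fourier_sum_integral[OF s b] by (simp only: 1 2)
  from has_sum_cmult_right[OF this, of "1 / (2 * pi)"] show ?thesis by (simp add: mult_ac)
qed

section \<open>Operators on square summable sequences as matrices\<close>

lemma has_sum_prod_finite:
  fixes f :: "'a \<times> 'n::finite \<Rightarrow> 'b::topological_comm_monoid_add"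
  assumes "\<And>r. ((\<lambda>k. f (k, r)) has_sum s r) UNIV"
  shows "(f has_sum (\<Sum>r\<in>UNIV. s r)) UNIV"
proof -
  have "(f has_sum s r) (range (\<lambda>k. (k, r)))" for r
    using assms[of r] by (subst has_sum_reindex) (auto simp: inj_on_def o_def)
  then have "(f has_sum (\<Sum>r\<in>UNIV. s r)) (\<Union>r\<in>UNIV. range (\<lambda>k. (k, r)))"
    by (intro sum_has_sum) auto
  also have "(\<Union>r\<in>UNIV. range (\<lambda>k. (k, r))) = (UNIV :: ('a \<times> 'n) set)" by auto
  finally show ?thesis .
qed

lemma has_sum_vec:
  fixes f :: "'a \<Rightarrow> 'b::topological_comm_monoid_add ^ 'n"
  assumes "\<And>p. ((\<lambda>k. f k $ p) has_sum a $ p) S"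
  shows "(f has_sum a) S"
  using assms unfolding has_sum_def by (intro vec_tendstoI) simp

definition coords :: "('i \<Rightarrow> complex^'n) \<Rightarrow> 'i \<times> 'n \<Rightarrow> complex" where
  "coords x = (\<lambda>(k, q). x k $ q)"

lemma coords_apply [simp]: "coords x (k, q) = x k $ q"
  by (simp add: coords_def)

lemma norm_coords_le: "norm (coords x t) \<le> norm (x (fst t))"
  by (cases t) (simp add: Finite_Cartesian_Product.norm_nth_le)

lemma ell2_bounded:
  fixes x :: "'i \<Rightarrow> complex^'n"
  assumes "x \<in> ell2"
  shows "\<exists>X. \<forall>t. norm (coords x t) \<le> X"
proof (intro exI allI)
  fix t :: "'i \<times> 'n"
  have "(norm (x (fst t)))\<^sup>2 \<le> (\<Sum>\<^sub>\<infinity>k. (norm (x k))\<^sup>2)"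
    using assms finite_sum_le_infsum[of "\<lambda>k. (norm (x k))\<^sup>2" UNIV "{fst t}"] by (simp add: ell2_def)
  then have "norm (x (fst t)) \<le> sqrt (\<Sum>\<^sub>\<infinity>k. (norm (x k))\<^sup>2)" by (rule real_le_rsqrt)
  then show "norm (coords x t) \<le> sqrt (\<Sum>\<^sub>\<infinity>k. (norm (x k))\<^sup>2)"
    using norm_coords_le order_trans by blast
qed

lemma unit_vec_norm: "norm (c *s (unit_vec (j, q) k :: complex^'a)) = (if k = j then norm c else 0)"
proof -
  have "c *s axis q 1 = axis q c" by (simp add: vec_eq_iff axis_def)
  moreover have "norm (axis q c :: complex^'a) = norm c"
  proof -
    have "(\<Sum>i\<in>UNIV. (norm (axis q c $ i :: complex))\<^sup>2) = (\<Sum>i\<in>UNIV. if i = q then (norm c)\<^sup>2 else 0)"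
      by (rule sum.cong) (auto simp: axis_def)
    then show ?thesis by (simp add: norm_vec_def L2_set_def)
  qed
  ultimately show ?thesis by (simp add: unit_vec_def)
qed

lemma scaled_unit_vec_ell2:
  "(\<lambda>k. c *s unit_vec s k) \<in> ell2" "ell2_norm (\<lambda>k. c *s unit_vec s k) = norm c"
proof -
  obtain j q where s: "s = (j, q)" by force
  have "((\<lambda>k. (norm (c *s unit_vec s k))\<^sup>2) has_sum (norm c)\<^sup>2) UNIV"
    by (rule has_sum_finite_neutralI[of "{j}"]) (auto simp: s unit_vec_norm)
  then show "(\<lambda>k. c *s unit_vec s k) \<in> ell2" "ell2_norm (\<lambda>k. c *s unit_vec s k) = norm c"
    by (auto simp: ell2_def ell2_norm_def has_sum_imp_summable infsumI)
qed

lemma unit_vec_ell2: "unit_vec s \<in> ell2" "ell2_norm (unit_vec s) = 1"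
  using scaled_unit_vec_ell2[of 1 s] by (simp_all add: ell2_norm_def)

lemma coords_unit_vec: "coords (unit_vec s) t = (if t = s then 1 else 0)"
  by (cases s; cases t) (auto simp: unit_vec_def axis_def)

lemma ell2_inner_unit_vec: "ell2_inner x (unit_vec s) = coords x s"
proof -
  obtain j q where s: "s = (j, q)" by force
  have "ell2_inner x (unit_vec s) = (\<Sum>p\<in>UNIV. x j $ p * cnj (unit_vec s j $ p))"
    unfolding ell2_inner_def by (rule infsum_single) (simp add: s unit_vec_def)
  also have "\<dots> = (\<Sum>p\<in>UNIV. if p = q then x j $ p else 0)"
    by (rule sum.cong) (auto simp: s unit_vec_def axis_def)
  finally show ?thesis by (simp add: s)
qed

text \<open>
  Such an operator is the absolutely convergent sum of the rank one operators given by its single entries, which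
  are enumerated by the natural numbers.
\<close>

lemma
  fixes K :: "('i::countable \<Rightarrow> complex^'n) \<Rightarrow> 'i \<Rightarrow> complex^'n"
  assumes inf: "infinite (UNIV :: 'i set)"
    and m: "(\<lambda>(s, t). norm (m s t)) summable_on UNIV"
    and K: "\<And>x i p. x \<in> ell2 \<Longrightarrow> ((\<lambda>t. m (i, p) t * coords x t) has_sum K x i $ p) UNIV"
  shows trace_class_matrix: "trace_class K"
    and entry_matrix: "entry K = m"
proof -
  show "entry K = m"
  proof (intro ext)
    fix s t :: "'i \<times> 'n"
    obtain i p where s: "s = (i, p)" by force
    have "((\<lambda>u. m s u * coords (unit_vec t) u) has_sum m s t) UNIV"
      by (rule has_sum_finite_neutralI[of "{t}"]) (auto simp: coords_unit_vec)
    with K[OF unit_vec_ell2(1), of i p t] show "entry K s t = m s t"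
      by (simp add: s entry_def has_sum_unique)
  qed
  have "infinite (UNIV :: (('i \<times> 'n) \<times> ('i \<times> 'n)) set)"
    using inf by (simp add: finite_prod)
  then obtain \<phi> :: "nat \<Rightarrow> ('i \<times> 'n) \<times> ('i \<times> 'n)" where \<phi>: "bij \<phi>"
    using bij_betw_from_nat_into[of "UNIV :: (('i \<times> 'n) \<times> ('i \<times> 'n)) set"] by auto
  define f where "f r k = m (fst (\<phi> r)) (snd (\<phi> r)) *s unit_vec (fst (\<phi> r)) k" for r k
  define g where "g r = (unit_vec (snd (\<phi> r)) :: 'i \<Rightarrow> complex^'n)" for r
  show "trace_class K"
    unfolding trace_class_def
  proof (rule exI[of _ f], rule exI[of _ g], intro conjI allI ballI)
    show "f r \<in> ell2" for r unfolding f_def[abs_def] by (rule scaled_unit_vec_ell2)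
    show "g r \<in> ell2" for r unfolding g_def by (rule unit_vec_ell2)
    have "(\<lambda>r. case \<phi> r of (s, t) \<Rightarrow> norm (m s t)) summable_on UNIV"
      using m summable_on_reindex_bij_betw[OF \<phi>] by blast
    then show "summable (\<lambda>r. ell2_norm (f r) * ell2_norm (g r))"
      unfolding f_def[abs_def] g_def
      by (simp add: scaled_unit_vec_ell2 unit_vec_ell2 summable_on_imp_summable case_prod_unfold)
    fix x :: "'i \<Rightarrow> complex^'n" and j assume x: "x \<in> ell2"
    let ?F = "\<lambda>(s, t). coords x t *s (m s t *s unit_vec s j)"
    have "(?F has_sum K x j) UNIV"
    proof (rule has_sum_vec)
      fix p
      have "((\<lambda>(s, t). m s t * coords x t) has_sum K x j $ p) (range (Pair (j, p)))"
        using K[OF x, of j p] by (subst has_sum_reindex) (auto simp: o_def inj_on_def)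
      also have "?this \<longleftrightarrow> ((\<lambda>st. ?F st $ p) has_sum K x j $ p) UNIV"
        by (rule has_sum_cong_neutral) (auto simp: unit_vec_def axis_def image_iff split: if_splits)
      finally show "((\<lambda>st. ?F st $ p) has_sum K x j $ p) UNIV" .
    qed
    then have "((\<lambda>r. ?F (\<phi> r)) has_sum K x j) UNIV"
      using has_sum_reindex_bij_betw[OF \<phi>] by blast
    then show "(\<lambda>r. ell2_inner x (g r) *s f r j) sums K x j"
      by (intro has_sum_imp_sums) (simp add: f_def g_def ell2_inner_unit_vec case_prod_unfold)
  qed
qed

definition bmat_apply :: "'k bmat \<Rightarrow> ('k \<Rightarrow> complex) \<Rightarrow> 'k \<Rightarrow> complex" where
  "bmat_apply A v i = (\<Sum>\<^sub>\<infinity>t. entries A i t * v t)"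

lemma bmat_apply_has_sum:
  assumes "\<And>t. norm (v t) \<le> X"
  shows "((\<lambda>t. entries A i t * v t) has_sum bmat_apply A v i) UNIV"
  unfolding bmat_apply_def
  by (intro has_sum_infsum abs_summable_summable[OF abs_summable_mult_bounded[OF bmat_row_summable assms]])

lemma bmat_apply_bounded:
  assumes "\<And>t. norm (v t) \<le> X"
  shows "norm (bmat_apply A v i) \<le> abs_sum_bound A * X"
proof -
  have s: "(\<lambda>t. norm (entries A i t * v t)) summable_on UNIV"
    by (rule abs_summable_mult_bounded[OF bmat_row_summable assms])
  have X: "0 \<le> X" using assms[of undefined] norm_ge_zero order_trans by blast
  have "norm (bmat_apply A v i) \<le> (\<Sum>\<^sub>\<infinity>t. norm (entries A i t * v t))"
    unfolding bmat_apply_def by (rule norm_infsum_bound[OF s])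
  also have "\<dots> \<le> abs_sum_bound A * X"
  proof (rule infsum_le_finite_sums[OF s])
    fix F :: "'a set" assume F: "finite F"
    have "(\<Sum>t\<in>F. norm (entries A i t * v t)) \<le> (\<Sum>t\<in>F. norm (entries A i t) * X)"
      by (intro sum_mono) (simp add: norm_mult mult_left_mono assms)
    also have "\<dots> \<le> abs_sum_bound A * X"
      unfolding sum_distrib_right[symmetric] by (intro mult_right_mono row_sum_le_bound F X)
    finally show "(\<Sum>t\<in>F. norm (entries A i t * v t)) \<le> abs_sum_bound A * X" .
  qed
  finally show ?thesis .
qed

lemma bmat_apply_mult:
  assumes "\<And>t. norm (v t) \<le> X"
  shows "bmat_apply (A * B) v = bmat_apply A (bmat_apply B v)"
proof
  fix i
  from bmat_fubini[of "entries A i" v X B, OF bmat_row_summable assms]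
  show "bmat_apply (A * B) v i = bmat_apply A (bmat_apply B v) i" by (simp add: bmat_apply_def times_bmat.rep_eq)
qed

lemma bmat_apply_diff:
  assumes "\<And>t. norm (v t) \<le> X"
  shows "bmat_apply (A - B) v i = bmat_apply A v i - bmat_apply B v i"
proof -
  have "((\<lambda>t. entries (A - B) i t * v t) has_sum bmat_apply A v i - bmat_apply B v i) UNIV"
    using has_sum_add[OF bmat_apply_has_sum[of v X A i, OF assms] has_sum_uminusI[OF bmat_apply_has_sum[of v X B i, OF assms]]]
    by (simp add: left_diff_distrib)
  then show ?thesis using bmat_apply_has_sum[of v X "A - B" i, OF assms] has_sum_unique by blast
qed

lemma bmat_apply_coord_proj: "bmat_apply (coord_proj S) v i = (if i \<in> S then v i else 0)"
  unfolding bmat_apply_def by (subst infsum_single[of i]) (auto simp: coord_proj.rep_eq)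

text \<open>
  A relation and not a function of the symbol: a product of Laurent matrices represents the product symbol
  without any estimate for the coefficients of the latter.
\<close>

definition represents :: "(int \<times> 'n) bmat \<Rightarrow> (complex \<Rightarrow> complex^'n^'n) \<Rightarrow> bool" where
  "represents L a \<longleftrightarrow> (\<forall>i p j q. entries L (i, p) (j, q) = mfourier a (i - j) $ p $ q)"

lemma laurent_coords:
  assumes L: "represents L b" and x: "\<And>t. norm (coords x t) \<le> X"
  shows "coords (laurent b x) = bmat_apply L (coords x)"
proof
  fix s :: "int \<times> 'a"
  obtain j p where s: "s = (j, p)" by force
  have "((\<lambda>k. mfourier b (j - k) *v x k) has_sum (\<chi> p. bmat_apply L (coords x) (j, p))) UNIV"
  proof (rule has_sum_vec)
    fix p
    have "((\<lambda>(k, q). entries L (j, p) (k, q) * coords x (k, q)) has_sum bmat_apply L (coords x) (j, p)) (Sigma UNIV (\<lambda>_. UNIV))"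
      using bmat_apply_has_sum[of "coords x" X L "(j, p)", OF x] by (simp add: case_prod_unfold coords_def)
    then have "((\<lambda>k. \<Sum>q\<in>UNIV. entries L (j, p) (k, q) * coords x (k, q)) has_sum bmat_apply L (coords x) (j, p)) UNIV"
      by (rule has_sum_SigmaD) (auto intro: has_sum_finiteI)
    then show "((\<lambda>k. (mfourier b (j - k) *v x k) $ p) has_sum (\<chi> p. bmat_apply L (coords x) (j, p)) $ p) UNIV"
      using L by (simp add: represents_def matrix_vector_mult_def)
  qed
  then show "coords (laurent b x) s = bmat_apply L (coords x) s"
    by (simp add: laurent_def infsumI s)
qed

definition rows_from :: "int \<Rightarrow> (int \<times> 'n) set" where
  "rows_from m = {m..} \<times> UNIV"

lemma proj_coords:
  "coords (proj_P x) = bmat_apply (coord_proj (rows_from 0)) (coords x)"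
  "coords (proj_Q n x) = bmat_apply (coord_proj (rows_from (int n))) (coords x)"
  by (auto simp: fun_eq_iff bmat_apply_coord_proj rows_from_def proj_P_def proj_Q_def)

lemma fredholm_det_laurent:
  fixes b c :: "complex \<Rightarrow> complex^'n^'n"
  assumes B: "represents B b" and C: "represents C c"
    and s: "summable_bmat (coord_proj (rows_from 0) - C * coord_proj (rows_from (int n)) * B)"
  shows "fredholm_det (id + proj_P - (laurent c \<circ> proj_Q n \<circ> laurent b)) =
    fdet (1 + coord_proj (rows_from 0) - C * coord_proj (rows_from (int n)) * B)"
proof -
  let ?Z = "coord_proj (rows_from 0) - C * coord_proj (rows_from (int n)) * B"
  define K where "K = id + proj_P - (laurent c \<circ> proj_Q n \<circ> laurent b) - (id :: (int \<Rightarrow> complex^'n) \<Rightarrow> _)"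
  have K: "((\<lambda>t. entries ?Z (i, p) t * coords x t) has_sum K x i $ p) UNIV" if x: "x \<in> ell2" for x i p
  proof -
    obtain X where X: "\<And>t. norm (coords x t) \<le> X" using ell2_bounded[OF x] by blast
    have e1: "coords (laurent b x) = bmat_apply B (coords x)" by (rule laurent_coords[OF B X])
    then have b1: "norm (coords (laurent b x) t) \<le> abs_sum_bound B * X" for t using bmat_apply_bounded[OF X] by simp
    have e2: "coords (proj_Q n (laurent b x)) = bmat_apply (coord_proj (rows_from (int n)) * B) (coords x)"
      by (simp add: proj_coords e1 bmat_apply_mult[OF X])
    then have b2: "norm (coords (proj_Q n (laurent b x)) t) \<le> abs_sum_bound (coord_proj (rows_from (int n)) * B) * X" for t
      using bmat_apply_bounded[OF X] by simp
    have "coords (laurent c (proj_Q n (laurent b x))) = bmat_apply (C * (coord_proj (rows_from (int n)) * B)) (coords x)"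
      by (simp add: laurent_coords[OF C b2] e2 bmat_apply_mult[OF X])
    from fun_cong[OF this, of "(i, p)"] have "coords (K x) (i, p) = bmat_apply ?Z (coords x) (i, p)"
      unfolding bmat_apply_diff[OF X] by (simp add: K_def proj_coords(1)[symmetric] mult.assoc)
    then show ?thesis using bmat_apply_has_sum[OF X, of ?Z "(i, p)"] by simp
  qed
  have t: "trace_class K" "entry K = entries ?Z"
    by (rule trace_class_matrix[OF infinite_UNIV_int s[unfolded summable_bmat_def] K], assumption)
       (rule entry_matrix[OF infinite_UNIV_int s[unfolded summable_bmat_def] K], assumption)
  have "fredholm_det (id + proj_P - (laurent c \<circ> proj_Q n \<circ> laurent b)) = fdet (1 + ?Z)"
    unfolding fredholm_det_def fdet_one_plus fredholm_series_def K_def[symmetric] using t by simp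
  then show ?thesis by (simp add: add_diff_eq)
qed

definition extend_0 :: "(nat \<Rightarrow> complex^'n) \<Rightarrow> int \<Rightarrow> complex^'n" where
  "extend_0 x k = (if k \<ge> 0 then x (nat k) else 0)"

lemma hankel_tilde_laurent: "hankel_tilde c x j = laurent c (extend_0 x) (- int j - 1)"
proof -
  have "laurent c (extend_0 x) (- int j - 1) = (\<Sum>\<^sub>\<infinity>k\<in>range int. mfourier c (- int j - 1 - k) *v extend_0 x k)"
    unfolding laurent_def
    by (rule infsum_cong_neutral) (auto simp: extend_0_def image_iff, metis nat_0_le)
  also have "\<dots> = hankel_tilde c x j"
    unfolding hankel_tilde_def by (subst infsum_reindex) (auto simp: o_def extend_0_def algebra_simps)
  finally show ?thesis ..
qed

text \<open>
  The summation index \<open>k\<close> of a Hankel matrix is the position \<open>- k - 1\<close> on the negative half line.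
\<close>

lemma hankel_laurent:
  "hankel b y j = laurent b (\<lambda>k. if k < 0 then y (nat (- k - 1)) else 0) (int j)"
proof -
  let ?f = "\<lambda>k. - int k - 1"
  have r: "k \<in> range ?f" if "k < 0" for k
    using that by (intro image_eqI[of _ _ "nat (- k - 1)"]) auto
  have "laurent b (\<lambda>k. if k < 0 then y (nat (- k - 1)) else 0) (int j) =
      (\<Sum>\<^sub>\<infinity>k\<in>range ?f. mfourier b (int j - k) *v (if k < 0 then y (nat (- k - 1)) else 0))"
    unfolding laurent_def by (rule infsum_cong_neutral) (auto intro: r)
  also have "\<dots> = hankel b y j"
    unfolding hankel_def by (subst infsum_reindex) (auto simp: o_def inj_on_def algebra_simps)
  finally show ?thesis ..
qed

text \<open>
  The product of the two Hankel operators is the matrix \<open>P * B * (1 - P) * C * P\<close>, whose indices in \<open>P\<close> are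
  read as natural numbers.
\<close>

lemma fredholm_det_hankel:
  fixes b c :: "complex \<Rightarrow> complex^'n^'n"
  assumes B: "represents B b" and C: "represents C c"
  defines "P \<equiv> rows_from 0"
  assumes s: "summable_bmat (coord_proj P * B * coord_proj (- P) * C * coord_proj P)"
  shows "fredholm_det (id - (hankel b \<circ> hankel_tilde c)) = fdet (1 - coord_proj P * B * coord_proj (- P) * C * coord_proj P)"
proof -
  let ?Z = "- (coord_proj P * B * coord_proj (- P) * C * coord_proj P)"
  define \<iota> :: "nat \<times> 'n \<Rightarrow> int \<times> 'n" where "\<iota> = (\<lambda>(j, p). (int j, p))"
  have \<iota> [simp]: "\<iota> (j, p) = (int j, p)" for j p by (simp add: \<iota>_def)
  define m where "m s t = entries ?Z (\<iota> s) (\<iota> t)" for s t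
  define K where "K = id - (hankel b \<circ> hankel_tilde c) - (id :: (nat \<Rightarrow> complex^'n) \<Rightarrow> _)"
  have inj: "inj \<iota>" by (auto simp: inj_on_def \<iota>_def)
  have range: "range \<iota> = P"
  proof (intro equalityI subsetI)
    fix t :: "int \<times> 'n" assume "t \<in> P"
    then have "t = \<iota> (nat (fst t), snd t)" by (cases t) (simp add: P_def rows_from_def)
    then show "t \<in> range \<iota>" by (rule range_eqI)
  qed (auto simp: P_def rows_from_def \<iota>_def)
  have m_eq: "m s t = - entries (B * (coord_proj (- P) * C)) (\<iota> s) (\<iota> t)" for s t
  proof -
    have "?Z = - (coord_proj P * (B * (coord_proj (- P) * C)) * coord_proj P)" by (simp only: mult.assoc)
    moreover have "\<iota> s \<in> P" "\<iota> t \<in> P" using range by auto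
    ultimately show ?thesis by (simp add: m_def)
  qed
  have m: "(\<lambda>(s, t). norm (m s t)) summable_on UNIV"
  proof -
    have "(\<lambda>(s, t). norm (entries ?Z s t)) summable_on UNIV"
      using summable_bmat_uminus[OF s] by (simp add: summable_bmat_def)
    then have "(\<lambda>(s, t). norm (entries ?Z s t)) summable_on range (map_prod \<iota> \<iota>)"
      by (rule summable_on_subset_banach) auto
    then show ?thesis
      by (subst (asm) summable_on_reindex)
         (simp_all only: prod.inj_map inj o_def m_def case_prod_unfold fst_map_prod snd_map_prod)
  qed
  have K: "((\<lambda>t. m (i, p) t * coords x t) has_sum K x i $ p) UNIV" if x: "x \<in> ell2" for x i p
  proof -
    obtain X where X0: "\<And>t. norm (coords x t) \<le> X" using ell2_bounded[OF x] by blast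
    have "0 \<le> X" using X0[of undefined] norm_ge_zero order_trans by blast
    then have X: "norm (coords (extend_0 x) t) \<le> X" for t
      using X0[of "(nat (fst t), snd t)"] by (cases t) (auto simp: extend_0_def)
    define z where "z k = (if k < 0 then hankel_tilde c x (nat (- k - 1)) else 0)" for k
    have z: "coords z = bmat_apply (coord_proj (- P) * C) (coords (extend_0 x))"
      unfolding bmat_apply_mult[OF X] laurent_coords[OF C X, symmetric]
      by (auto simp: fun_eq_iff bmat_apply_coord_proj z_def P_def rows_from_def hankel_tilde_laurent)
    then have bz: "norm (coords z t) \<le> abs_sum_bound (coord_proj (- P) * C) * X" for t using bmat_apply_bounded[OF X] by simp
    have "hankel b (hankel_tilde c x) i = laurent b z (int i)"
      unfolding hankel_laurent z_def ..
    then have "hankel b (hankel_tilde c x) i $ p = bmat_apply (B * (coord_proj (- P) * C)) (coords (extend_0 x)) (int i, p)"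
      using fun_cong[OF laurent_coords[OF B bz], of "(int i, p)"] by (simp add: z bmat_apply_mult[OF X])
    moreover have "((\<lambda>t. entries (B * (coord_proj (- P) * C)) (int i, p) t * coords (extend_0 x) t) has_sum
        bmat_apply (B * (coord_proj (- P) * C)) (coords (extend_0 x)) (int i, p)) UNIV"
      by (rule bmat_apply_has_sum[OF X])
    ultimately have "((\<lambda>t. entries (B * (coord_proj (- P) * C)) (int i, p) t * coords (extend_0 x) t) has_sum
        hankel b (hankel_tilde c x) i $ p) UNIV" by simp
    also have "?this \<longleftrightarrow> ((\<lambda>t. entries (B * (coord_proj (- P) * C)) (int i, p) t * coords (extend_0 x) t) has_sum
        hankel b (hankel_tilde c x) i $ p) (range \<iota>)"
      unfolding range by (rule has_sum_cong_neutral) (auto simp: P_def rows_from_def extend_0_def split: if_splits)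
    also have "\<dots> \<longleftrightarrow> ((\<lambda>t. - m (i, p) t * coords x t) has_sum hankel b (hankel_tilde c x) i $ p) UNIV"
      by (subst has_sum_reindex[OF inj])
         (auto simp: o_def m_eq case_prod_unfold extend_0_def intro!: has_sum_cong)
    finally have "((\<lambda>t. - (- m (i, p) t * coords x t)) has_sum - (hankel b (hankel_tilde c x) i $ p)) UNIV"
      by (rule has_sum_uminusI)
    then show ?thesis by (simp add: K_def)
  qed
  have t: "trace_class K" "entry K = m"
    using trace_class_matrix[OF _ m K] entry_matrix[OF _ m K] by simp_all
  have "fredholm_det (id - (hankel b \<circ> hankel_tilde c)) = fredholm_series m"
    unfolding fredholm_det_def fredholm_series_def K_def[symmetric] using t by simp
  also have "\<dots> = fredholm_series (entries ?Z)"
    by (rule fredholm_series_reindex[OF inj, symmetric]) (auto simp: m_def range mult.assoc)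
  also have "\<dots> = fdet (1 + ?Z)" by (simp only: fdet_one_plus)
  finally show ?thesis by simp
qed

section \<open>Laurent matrices of functions with weighted summable coefficients\<close>

text \<open>
  Lebesgue measure is complete, so the measurability of \<open>f\<close> follows from that of \<open>g\<close>. A function with a
  factorization is therefore determined, as far as its coefficients are concerned, by the factors.
\<close>

lemma fourier_cong_AE:
  assumes g: "(\<lambda>\<theta>. g (cis \<theta>)) \<in> borel_measurable angles"
    and ae: "AE \<theta> in angles. f (cis \<theta>) = g (cis \<theta>)"
  shows "fourier f k = fourier g k"
proof -
  let ?I = "{0..2 * pi}"
  \<comment> \<open>Extension by 0 to the whole line, where almost everywhere equality preserves measurability.\<close>
  have "AE \<theta> in lebesgue. (if \<theta> \<in> ?I then g (cis \<theta>) else 0) = (if \<theta> \<in> ?I then f (cis \<theta>) else 0)"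
    using ae by (subst (asm) AE_restrict_space_iff) (auto elim!: eventually_mono)
  moreover have "(\<lambda>\<theta>. if \<theta> \<in> ?I then g (cis \<theta>) else 0) \<in> borel_measurable lebesgue"
    using g by (intro borel_measurable_if_I) auto
  ultimately have "(\<lambda>\<theta>. if \<theta> \<in> ?I then f (cis \<theta>) else 0) \<in> borel_measurable lebesgue"
    by (rule borel_measurable_AE[rotated])
  then have f: "(\<lambda>\<theta>. f (cis \<theta>)) \<in> borel_measurable angles"
    by (intro borel_measurable_if_D) auto
  have c: "(\<lambda>\<theta>. cis (- (of_int k * \<theta>))) \<in> borel_measurable angles"
    using ess_bounded_measurable[OF ess_bounded_cis, of "- of_int k"] by simp
  have "(LINT \<theta>|angles. f (cis \<theta>) * cis (- (of_int k * \<theta>))) = (LINT \<theta>|angles. g (cis \<theta>) * cis (- (of_int k * \<theta>)))"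
  proof (rule integral_cong_AE)
    show "AE \<theta> in angles. f (cis \<theta>) * cis (- (of_int k * \<theta>)) = g (cis \<theta>) * cis (- (of_int k * \<theta>))"
      using ae by eventually_elim simp
  qed (intro borel_measurable_times f g c)+
  then show ?thesis by (simp add: fourier_def)
qed

lemma fourier_const: "fourier (\<lambda>_. c) k = (if k = 0 then c else 0)"
proof -
  have "(LINT \<theta>|angles. cis (- (of_int k * \<theta>))) = (if k = 0 then 2 * pi else 0)"
    using integral_cis[of "- k"] by simp
  then show ?thesis by (simp add: fourier_def)
qed

lemma fourier_finite_sum:
  assumes "\<And>r. r \<in> R \<Longrightarrow> ess_bounded (\<lambda>\<theta>. f r (cis \<theta>))"
  shows "fourier (\<lambda>z. \<Sum>r\<in>R. f r z) k = (\<Sum>r\<in>R. fourier (f r) k)"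
proof -
  have "integrable angles (\<lambda>\<theta>. f r (cis \<theta>) * cis (- (of_int k * \<theta>)))" if "r \<in> R" for r
    using ess_bounded_integrable[OF ess_bounded_mult[OF assms[OF that] ess_bounded_cis], of "- of_int k"] by simp
  then show ?thesis by (simp add: fourier_def sum_distrib_right sum_divide_distrib)
qed

lemma ess_bounded_sum:
  "(\<And>r. r \<in> R \<Longrightarrow> ess_bounded (f r)) \<Longrightarrow> ess_bounded (\<lambda>\<theta>. \<Sum>r\<in>R. f r \<theta>)"
  by (induction R rule: infinite_finite_induct) (auto intro: ess_bounded_const ess_bounded_add)

lemma ess_bounded_entry:
  assumes "a \<in> Linf"
  shows "ess_bounded (\<lambda>\<theta>. a (cis \<theta>) $ p $ q)"
proof -
  obtain C where m: "(\<lambda>\<theta>. a (cis \<theta>)) \<in> borel_measurable angles" and C: "AE \<theta> in angles. norm (a (cis \<theta>)) \<le> C"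
    using assms by (auto simp: Linf_def)
  have le: "norm (A $ p $ q) \<le> norm A" for A :: "complex^'a^'b" and p q
    by (rule order_trans[OF Finite_Cartesian_Product.norm_nth_le Finite_Cartesian_Product.norm_nth_le])
  have "(\<lambda>A :: complex^'a^'a. A $ p $ q) \<in> borel_measurable borel"
    by (intro borel_measurable_continuous_onI continuous_intros)
  from measurable_compose[OF m this] have "(\<lambda>\<theta>. a (cis \<theta>) $ p $ q) \<in> borel_measurable angles" .
  moreover have "AE \<theta> in angles. norm (a (cis \<theta>) $ p $ q) \<le> C"
    using C by eventually_elim (rule order_trans[OF le])
  ultimately show ?thesis unfolding ess_bounded_def by blast
qed

lemma norm_mfourier_entry_le: "norm (mfourier a k $ p $ q) \<le> norm (mfourier a k)"
  by (rule order_trans[OF Finite_Cartesian_Product.norm_nth_le Finite_Cartesian_Product.norm_nth_le])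

lemma K11_summable:
  assumes "a \<in> K11"
  shows "(\<lambda>k. norm (mfourier a k)) summable_on UNIV"
proof (rule summable_on_comparison_test)
  show "(\<lambda>n. (of_int \<bar>n\<bar> + 1) * norm (mfourier a n)) summable_on UNIV"
    using assms by (simp add: K11_def)
qed (auto simp: distrib_right)

lemma K11_entry_summable:
  assumes "a \<in> K11"
  shows "(\<lambda>k. norm (fourier (\<lambda>z. a z $ p $ q) k)) summable_on UNIV"
  by (rule summable_on_comparison_test[OF K11_summable[OF assms]])
     (use norm_mfourier_entry_le[of a _ p q] in \<open>auto simp: mfourier_def\<close>)

definition laurent_bmat :: "(complex \<Rightarrow> complex^'n^'n) \<Rightarrow> (int \<times> 'n) bmat" where
  "laurent_bmat a = Bmat (\<lambda>(i, p) (j, q). mfourier a (i - j) $ p $ q)"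

lemma represents_laurent_bmat:
  fixes a :: "complex \<Rightarrow> complex^'n^'n"
  assumes "a \<in> K11"
  shows "represents (laurent_bmat a) a"
proof -
  let ?N = "\<lambda>k. norm (mfourier a k)"
  define C where "C = CARD('n) * (\<Sum>\<^sub>\<infinity>k. ?N k)"
  have le: "(\<Sum>(j, q)\<in>F. f j q) \<le> C"
    if F: "finite F" and f: "\<And>j q. f j q \<le> ?N (h j)" and h: "inj h"
    for F :: "(int \<times> 'n) set" and f :: "int \<Rightarrow> 'n \<Rightarrow> real" and h :: "int \<Rightarrow> int"
  proof -
    have "(\<Sum>(j, q)\<in>F. f j q) \<le> (\<Sum>(j, q)\<in>F. ?N (h j))" using f by (intro sum_mono) auto
    also have "\<dots> \<le> (\<Sum>(j, q)\<in>fst ` F \<times> (UNIV :: 'n set). ?N (h j))"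
      using F by (intro sum_mono2) force+
    also have "\<dots> = CARD('n) * (\<Sum>j\<in>fst ` F. ?N (h j))"
      by (simp add: sum.cartesian_product[symmetric] sum_distrib_left)
    also have "(\<Sum>j\<in>fst ` F. ?N (h j)) = (\<Sum>k\<in>h ` fst ` F. ?N k)"
      using h by (subst sum.reindex) (auto simp: inj_on_def)
    also have "\<dots> \<le> (\<Sum>\<^sub>\<infinity>k. ?N k)"
      using F by (intro finite_sum_le_infsum K11_summable assms) auto
    finally show ?thesis by (simp add: C_def mult_left_mono)
  qed
  have "(\<lambda>(i, p) (j, q). mfourier a (i - j) $ p $ q) \<in> {M :: int \<times> 'n \<Rightarrow> int \<times> 'n \<Rightarrow> complex.
      \<exists>C. \<forall>i F. finite F \<longrightarrow> (\<Sum>j\<in>F. norm (M i j)) \<le> C \<and> (\<Sum>j\<in>F. norm (M j i)) \<le> C}"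
  proof (intro CollectI exI[of _ C] allI impI conjI)
    fix s :: "int \<times> 'n" and F :: "(int \<times> 'n) set" assume F: "finite F"
    obtain i p where s: "s = (i, p)" by force
    have "inj (\<lambda>j. i - j)" "inj (\<lambda>j. j - i)" by (auto simp: inj_on_def)
    from le[OF F norm_mfourier_entry_le[of a _ p] this(1)] le[OF F _ this(2), of "\<lambda>j q. norm (mfourier a (j - i) $ q $ p)"]
    show "(\<Sum>t\<in>F. norm ((\<lambda>(i, p) (j, q). mfourier a (i - j) $ p $ q) s t)) \<le> C"
      "(\<Sum>t\<in>F. norm ((\<lambda>(i, p) (j, q). mfourier a (i - j) $ p $ q) t s)) \<le> C"
      by (simp_all add: s case_prod_unfold norm_mfourier_entry_le)
  qed
  then show ?thesis by (simp add: represents_def laurent_bmat_def Bmat_inverse)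
qed

text \<open>
  Entrywise this is the convolution theorem, summed over the inner matrix index.
\<close>

lemma represents_mult:
  assumes A: "represents A a" and B: "represents B b" and a: "a \<in> K11" and b: "b \<in> Linf"
  shows "represents (A * B) (a \<odot> b)"
  unfolding represents_def
proof (intro allI)
  fix i p j q
  have al: "a \<in> Linf" using a by (simp add: K11_def)
  have eb: "ess_bounded (\<lambda>\<theta>. a (cis \<theta>) $ p $ r * b (cis \<theta>) $ r $ q)" for r
    by (intro ess_bounded_mult ess_bounded_entry al b)
  have "((\<lambda>t. entries A (i, p) t * entries B t (j, q)) has_sum
      (\<Sum>r\<in>UNIV. fourier (\<lambda>z. a z $ p $ r * b z $ r $ q) (i - j))) UNIV"
  proof (rule has_sum_prod_finite)
    fix r
    have "((\<lambda>k. fourier (\<lambda>z. a z $ p $ r) k * fourier (\<lambda>z. b z $ r $ q) (i - j - k)) has_sum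
        fourier (\<lambda>z. a z $ p $ r * b z $ r $ q) (i - j)) UNIV"
      by (intro fourier_mult ess_bounded_entry al b K11_entry_summable a)
    also have "?this \<longleftrightarrow> ((\<lambda>k. entries A (i, p) (k, r) * entries B (k, r) (j, q)) has_sum
        fourier (\<lambda>z. a z $ p $ r * b z $ r $ q) (i - j)) UNIV"
      by (rule has_sum_reindex_bij_witness[of _ "\<lambda>k. i - k" "\<lambda>k. i - k"])
         (use A B in \<open>auto simp: represents_def mfourier_def algebra_simps\<close>)
    finally show "((\<lambda>k. entries A (i, p) (k, r) * entries B (k, r) (j, q)) has_sum
        fourier (\<lambda>z. a z $ p $ r * b z $ r $ q) (i - j)) UNIV" .
  qed
  also have "(\<Sum>r\<in>UNIV. fourier (\<lambda>z. a z $ p $ r * b z $ r $ q) (i - j)) = mfourier (a \<odot> b) (i - j) $ p $ q"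
    using fourier_finite_sum[of UNIV "\<lambda>r z. a z $ p $ r * b z $ r $ q" "i - j"] eb
    by (simp add: mfourier_def mmult_def matrix_matrix_mult_def)
  finally show "entries (A * B) (i, p) (j, q) = mfourier (a \<odot> b) (i - j) $ p $ q"
    by (simp add: times_bmat.rep_eq infsumI)
qed

lemma mfourier_cong_AE:
  assumes "a \<in> Linf" "b \<in> Linf" and ae: "AE \<theta> in angles. f (cis \<theta>) = (a \<odot> b) (cis \<theta>)"
  shows "mfourier f k = mfourier (a \<odot> b) k"
proof -
  have "fourier (\<lambda>z. f z $ p $ q) k = fourier (\<lambda>z. (a \<odot> b) z $ p $ q) k" for p q
  proof (rule fourier_cong_AE)
    have "ess_bounded (\<lambda>\<theta>. \<Sum>r\<in>UNIV. a (cis \<theta>) $ p $ r * b (cis \<theta>) $ r $ q)"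
      by (intro ess_bounded_sum ess_bounded_mult ess_bounded_entry assms)
    then show "(\<lambda>\<theta>. (a \<odot> b) (cis \<theta>) $ p $ q) \<in> borel_measurable angles"
      by (simp add: mmult_def matrix_matrix_mult_def ess_bounded_def)
    show "AE \<theta> in angles. f (cis \<theta>) $ p $ q = (a \<odot> b) (cis \<theta>) $ p $ q"
      using ae by eventually_elim simp
  qed
  then show ?thesis by (simp add: mfourier_def)
qed

lemma represents_eqI:
  assumes "represents A a" "represents B b" "\<And>k. mfourier a k = mfourier b k"
  shows "A = B"
proof (rule bmat_eqI)
  fix s t show "entries A s t = entries B s t"
    using assms by (cases s; cases t) (simp add: represents_def)
qed

lemma represents_one: "represents 1 (\<lambda>_. mat 1)"
  by (auto simp: represents_def one_bmat.rep_eq mfourier_def fourier_const mat_def)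

text \<open>
  Almost everywhere \<open>u\<close> times its pointwise inverse is constant, and the Laurent matrix of that constant is the identity.
\<close>

lemma laurent_bmat_inverse:
  assumes u: "unit_in (K11 \<inter> E) u"
  shows "laurent_bmat u * laurent_bmat (minv u) = 1" "laurent_bmat (minv u) * laurent_bmat u = 1"
proof -
  have K: "u \<in> K11" "minv u \<in> K11" and ae: "AE \<theta> in angles. invertible (u (cis \<theta>))"
    using u by (auto simp: unit_in_def)
  then have L: "u \<in> Linf" "minv u \<in> Linf" by (auto simp: K11_def)
  have inv: "A ** matrix_inv A = mat 1 \<and> matrix_inv A ** A = mat 1" if "invertible A" for A :: "complex^'a^'a"
    using that unfolding invertible_def matrix_inv_def by (rule someI_ex)
  have 1: "AE \<theta> in angles. mat 1 = (u \<odot> minv u) (cis \<theta>)"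
    using ae by eventually_elim (simp add: mmult_def minv_def inv)
  have 2: "AE \<theta> in angles. mat 1 = (minv u \<odot> u) (cis \<theta>)"
    using ae by eventually_elim (simp add: mmult_def minv_def inv)
  show "laurent_bmat u * laurent_bmat (minv u) = 1"
    using represents_mult[OF represents_laurent_bmat represents_laurent_bmat K(1) L(2)] K represents_one
      mfourier_cong_AE[OF L 1] by (metis represents_eqI)
  show "laurent_bmat (minv u) * laurent_bmat u = 1"
    using represents_mult[OF represents_laurent_bmat represents_laurent_bmat K(2) L(1)] K represents_one
      mfourier_cong_AE[OF L(2,1) 2] by (metis represents_eqI)
qed

lemma lower_laurent_bmat:
  assumes "a \<in> K11" "a \<in> Hinf_plus"
  shows "lower (rows_from m) (laurent_bmat a)"
proof -
  have "entries (laurent_bmat a) s t = 0" if "s \<notin> rows_from m" "t \<in> rows_from m" for s t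
  proof -
    obtain i p j q where st: "s = (i, p)" "t = (j, q)" by (cases s, cases t) auto
    then have "j - i > 0" using that by (auto simp: rows_from_def)
    then have "mfourier a (- (j - i)) = 0" using assms(2) unfolding Hinf_plus_def by blast
    then show ?thesis using represents_laurent_bmat[OF assms(1)] by (simp add: represents_def st)
  qed
  then show ?thesis unfolding lower_def by (intro bmat_eqI) simp
qed

lemma upper_laurent_bmat:
  assumes "a \<in> K11" "a \<in> Hinf_minus"
  shows "upper (rows_from m) (laurent_bmat a)"
proof -
  have "entries (laurent_bmat a) s t = 0" if "s \<in> rows_from m" "t \<notin> rows_from m" for s t
  proof -
    obtain i p j q where st: "s = (i, p)" "t = (j, q)" by (cases s, cases t) auto
    then have "i - j > 0" using that by (auto simp: rows_from_def)
    then have "mfourier a (i - j) = 0" using assms(2) unfolding Hinf_minus_def by blast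
    then show ?thesis using represents_laurent_bmat[OF assms(1)] by (simp add: represents_def st)
  qed
  then show ?thesis unfolding upper_def by (intro bmat_eqI) simp
qed

text \<open>
  The number of pairs \<open>(i, j)\<close> with \<open>j < m \<le> i\<close> and difference \<open>l > 0\<close> is \<open>l\<close>, which is where the weight of
  \<open>K11\<close> enters.
\<close>

lemma corner_summable:
  fixes c :: "int \<Rightarrow> real"
  assumes c: "\<And>l. 0 \<le> c l" and s: "(\<lambda>l. (of_int \<bar>l\<bar> + 1) * c l) summable_on UNIV"
  shows "(\<lambda>(i, j). c (i - j)) summable_on {m..} \<times> {..<m}"
proof -
  have "(\<lambda>p. norm (case p of (l, j) \<Rightarrow> c l)) summable_on Sigma UNIV (\<lambda>l. {m - l..<m})"
  proof (rule Infinite_Sum.abs_summable_on_Sigma_iff[THEN iffD2], intro conjI ballI)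
    show "(\<lambda>l. norm (\<Sum>\<^sub>\<infinity>j\<in>{m - l..<m}. norm (case (l, j) of (l, j) \<Rightarrow> c l))) summable_on UNIV"
    proof (rule summable_on_comparison_test[OF s])
      fix l :: int
      have "norm (\<Sum>\<^sub>\<infinity>j\<in>{m - l..<m}. norm (case (l, j) of (l, j) \<Rightarrow> c l)) = real (nat l) * c l"
        using c[of l] by (simp add: abs_mult)
      also have "\<dots> \<le> (of_int \<bar>l\<bar> + 1) * c l"
        using c[of l] by (intro mult_right_mono) auto
      finally show "norm (\<Sum>\<^sub>\<infinity>j\<in>{m - l..<m}. norm (case (l, j) of (l, j) \<Rightarrow> c l)) \<le> (of_int \<bar>l\<bar> + 1) * c l" .
    qed auto
  qed auto
  then have "(\<lambda>(l, j). c l) summable_on Sigma UNIV (\<lambda>l. {m - l..<m})"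
    using c by (simp add: case_prod_unfold)
  also have "?this \<longleftrightarrow> (\<lambda>(i, j). c (i - j)) summable_on {m..} \<times> {..<m}"
    by (rule summable_on_reindex_bij_witness[of _ "\<lambda>(i, j). (i - j, j)" "\<lambda>(l, j). (l + j, j)"]) auto
  finally show ?thesis .
qed

text \<open>
  Passing from blocks to scalar entries repeats each term a finite number of times, once for each pair of matrix indices.
\<close>

lemma summable_bmat_blockwise:
  fixes A :: "('i \<times> 'n::finite) bmat"
  assumes d: "(\<lambda>(i, j). d i j) summable_on UNIV" and le: "\<And>i p j q. norm (entries A (i, p) (j, q)) \<le> d i j"
  shows "summable_bmat A"
proof (rule summable_bmat_comparison)
  have "((\<lambda>((i, j), (p :: 'n, q :: 'n)). d i j) has_sum (\<Sum>r\<in>(UNIV :: ('n \<times> 'n) set). \<Sum>\<^sub>\<infinity>(i, j). d i j)) UNIV"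
    by (rule has_sum_prod_finite) (use has_sum_infsum[OF d] in \<open>simp add: case_prod_unfold\<close>)
  then have "(\<lambda>((i, j), (p :: 'n, q :: 'n)). d i j) summable_on UNIV" by (rule has_sum_imp_summable)
  also have "?this \<longleftrightarrow> (\<lambda>((i, p :: 'n), (j, q :: 'n)). d i j) summable_on UNIV"
    by (rule summable_on_reindex_bij_witness[of _ "\<lambda>((i, p), (j, q)). ((i, j), (p, q))" "\<lambda>((i, j), (p, q)). ((i, p), (j, q))"]) auto
  finally show "(\<lambda>(s, t :: 'i \<times> 'n). d (fst s) (fst t)) summable_on (UNIV :: (('i \<times> 'n) \<times> ('i \<times> 'n)) set)"
    by (simp add: case_prod_unfold)
  show "norm (entries A s t) \<le> d (fst s) (fst t)" for s t
    using le by (cases s; cases t) simp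
qed

lemma summable_laurent_corners:
  assumes a: "a \<in> K11"
  shows "summable_bmat (coord_proj (rows_from m) * laurent_bmat a * coord_proj (- rows_from m))"
    and "summable_bmat (coord_proj (- rows_from m) * laurent_bmat a * coord_proj (rows_from m))"
proof -
  let ?N = "\<lambda>k. norm (mfourier a k)"
  note r = represents_laurent_bmat[OF a, unfolded represents_def]
  have s: "(\<lambda>l. (of_int \<bar>l\<bar> + 1) * ?N l) summable_on UNIV" using a by (simp add: K11_def)
  have "(\<lambda>(i, j). ?N (i - j)) summable_on {m..} \<times> {..<m}"
    by (rule corner_summable[OF _ s]) simp
  also have "?this \<longleftrightarrow> (\<lambda>(i, j). if i \<ge> m \<and> j < m then ?N (i - j) else 0) summable_on UNIV"
    by (rule summable_on_cong_neutral) (auto split: if_splits)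
  finally show "summable_bmat (coord_proj (rows_from m) * laurent_bmat a * coord_proj (- rows_from m))"
    by (rule summable_bmat_blockwise) (auto simp: rows_from_def r norm_mfourier_entry_le)
  have "(\<lambda>l. (of_int \<bar>l\<bar> + 1) * ?N l) summable_on UNIV \<longleftrightarrow> (\<lambda>l. (of_int \<bar>l\<bar> + 1) * ?N (- l)) summable_on UNIV"
    by (rule summable_on_reindex_bij_witness[of _ uminus uminus]) auto
  with s have "(\<lambda>(i, j). ?N (- (i - j))) summable_on {m..} \<times> {..<m}"
    by (intro corner_summable) auto
  then have "(\<lambda>(i, j). ?N (i - j)) summable_on {..<m} \<times> {m..}"
    by (subst summable_on_swap) (simp add: case_prod_unfold)
  also have "?this \<longleftrightarrow> (\<lambda>(i, j). if i < m \<and> j \<ge> m then ?N (i - j) else 0) summable_on UNIV"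
    by (rule summable_on_cong_neutral) (auto split: if_splits)
  finally show "summable_bmat (coord_proj (- rows_from m) * laurent_bmat a * coord_proj (rows_from m))"
    by (rule summable_bmat_blockwise) (auto simp: rows_from_def r norm_mfourier_entry_le)
qed

text \<open>
  A finite determinant is that of a finite perturbation of the identity, so this is a case of
  \<open>fdet_block_triangular\<close>.
\<close>

lemma det_on_block_triangular:
  assumes S: "finite S" and T: "finite T" and ST: "S \<inter> T = {}"
    and z: "\<And>i j. i \<in> T \<Longrightarrow> j \<in> S \<Longrightarrow> entries V i j = 0"
  shows "det_on (S \<union> T) (entries V) = det_on S (entries V) * det_on T (entries V)"
proof -
  let ?F = "S \<union> T"
  define A where "A = 1 + coord_proj ?F * (V - 1) * coord_proj ?F"
  have F: "finite ?F" using S T by simp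
  have sets: "- S \<inter> ?F = T" "?F \<inter> S = S" "S \<inter> ?F = S" "?F \<inter> - S = T" using ST by auto
  have "det_on ?F (entries V) = fdet A" using fdet_finite[OF F, of "V - 1"] by (simp add: A_def)
  also have "fdet A = fdet (coord_proj S * A * coord_proj S + coord_proj (- S)) * fdet (coord_proj (- S) * A * coord_proj (- S) + coord_proj S)"
  proof (rule fdet_block_triangular)
    show "summable_bmat (A - 1)"
      using summable_coord_proj_mult[OF F, of "(V - 1) * coord_proj ?F"] by (simp add: A_def mult.assoc)
    show "coord_proj (- S) * A * coord_proj S = 0"
      using z ST by (intro bmat_eqI) (auto simp: A_def one_bmat.rep_eq)
  qed
  also have "coord_proj S * A * coord_proj S + coord_proj (- S) = 1 + coord_proj S * (V - 1) * coord_proj S"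
    using coord_proj_add_coord_proj_Compl[of S] by (simp add: A_def distrib_left distrib_right mult.assoc sets add_ac)
  also have "coord_proj (- S) * A * coord_proj (- S) + coord_proj S = 1 + coord_proj T * (V - 1) * coord_proj T"
    using coord_proj_add_coord_proj_Compl[of S] by (simp add: A_def distrib_left distrib_right mult.assoc sets add_ac)
  finally show ?thesis using fdet_finite[OF S, of "V - 1"] fdet_finite[OF T, of "V - 1"] by simp
qed

lemma rows_between: "rows_from 0 - rows_from (int n) = {0..<int n} \<times> UNIV"
  by (auto simp: rows_from_def)

lemma det_on_diagonal_block:
  fixes v :: "complex \<Rightarrow> complex^'n^'n"
  assumes "represents V v"
  shows "det_on ({k} \<times> UNIV) (entries V) = det (mfourier v 0)"
proof -
  have "{k} \<times> (UNIV :: 'n set) = range (Pair k)" by auto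
  then have "det_on ({k} \<times> UNIV) (entries V) = det_on UNIV (\<lambda>p q. entries V (k, p) (k, q))"
    using det_on_reindex[of "UNIV :: 'n set" "Pair k" "entries V"] by (simp add: inj_on_def)
  then show ?thesis using assms by (simp add: represents_def det_on_UNIV)
qed

text \<open>
  The section is block triangular with constant diagonal block; the rows and columns of the last block are
  split off in each step.
\<close>

lemma det_on_triangular_toeplitz:
  fixes v :: "complex \<Rightarrow> complex^'n^'n"
  assumes V: "represents V v"
    and tri: "(\<forall>k>0. mfourier v k = 0) \<or> (\<forall>k>0. mfourier v (- k) = 0)"
  shows "det_on ({0..<int n} \<times> UNIV) (entries V) = det (mfourier v 0) ^ n"
proof (induction n)
  case 0
  then show ?case by (simp add: det_on_def)
next
  case (Suc n)
  let ?F = "{0..<int n} \<times> (UNIV :: 'n set)" and ?T = "{int n} \<times> (UNIV :: 'n set)"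
  have e: "{0..<int (Suc n)} \<times> UNIV = ?F \<union> ?T" by auto
  have "det_on (?F \<union> ?T) (entries V) = det_on ?F (entries V) * det_on ?T (entries V)"
    using tri
  proof
    assume z: "\<forall>k>0. mfourier v k = 0"
    show ?thesis
      by (rule det_on_block_triangular) (use V z in \<open>auto simp: represents_def\<close>)
  next
    assume z: "\<forall>k>0. mfourier v (- k) = 0"
    have "det_on (?T \<union> ?F) (entries V) = det_on ?T (entries V) * det_on ?F (entries V)"
    proof (rule det_on_block_triangular)
      fix s t assume st: "s \<in> ?F" "t \<in> ?T"
      obtain i p j q where "s = (i, p)" "t = (j, q)" by (cases s, cases t) auto
      with st z[rule_format, of "j - i"] V show "entries V s t = 0" by (auto simp: represents_def)
    qed auto
    then show ?thesis by (simp add: Un_commute mult.commute)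
  qed
  then show ?case unfolding e using Suc det_on_diagonal_block[OF V] by simp
qed

text \<open>
  The zeroth coefficient of a convolution of sequences supported on the same half line is the product of the zeroth
  coefficients. The sign \<open>\<sigma>\<close> selects the half line.
\<close>

lemma fourier_prod_one_sided:
  fixes \<sigma> :: int
  assumes \<sigma>: "\<sigma> \<noteq> 0" and "finite I"
    and "\<And>i. i \<in> I \<Longrightarrow> ess_bounded (\<lambda>\<theta>. f i (cis \<theta>))"
    and "\<And>i. i \<in> I \<Longrightarrow> (\<lambda>k. norm (fourier (f i) k)) summable_on UNIV"
    and "\<And>i k. i \<in> I \<Longrightarrow> \<sigma> * k < 0 \<Longrightarrow> fourier (f i) k = 0"
  shows "ess_bounded (\<lambda>\<theta>. \<Prod>i\<in>I. f i (cis \<theta>)) \<and>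
    (\<forall>k. \<sigma> * k < 0 \<longrightarrow> fourier (\<lambda>z. \<Prod>i\<in>I. f i z) k = 0) \<and>
    fourier (\<lambda>z. \<Prod>i\<in>I. f i z) 0 = (\<Prod>i\<in>I. fourier (f i) 0)"
  using assms(2-)
proof (induction I)
  case empty
  then show ?case by (auto simp: ess_bounded_const fourier_const)
next
  case (insert i I)
  let ?g = "\<lambda>z. \<Prod>i\<in>I. f i z"
  have g: "ess_bounded (\<lambda>\<theta>. ?g (cis \<theta>))" "\<And>k. \<sigma> * k < 0 \<Longrightarrow> fourier ?g k = 0"
    "fourier ?g 0 = (\<Prod>i\<in>I. fourier (f i) 0)"
    using insert by auto
  have conv: "((\<lambda>j. fourier (f i) j * fourier ?g (k - j)) has_sum fourier (\<lambda>z. f i z * ?g z) k) UNIV" for k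
    using insert.prems by (intro fourier_mult g) auto
  have z: "fourier (f i) j * fourier ?g (k - j) = 0" if "\<sigma> * j < 0 \<or> \<sigma> * (k - j) < 0" for j k
    using that insert.prems g(2) by auto
  have "fourier (\<lambda>z. f i z * ?g z) k = 0" if k: "\<sigma> * k < 0" for k
  proof -
    have "fourier (f i) j * fourier ?g (k - j) = 0" for j
      by (rule z) (use k in \<open>auto simp: right_diff_distrib\<close>)
    with conv[of k] show ?thesis by (simp add: has_sum_unique[OF _ has_sum_0])
  qed
  moreover have "fourier (\<lambda>z. f i z * ?g z) 0 = fourier (f i) 0 * fourier ?g 0"
  proof -
    have "fourier (f i) j * fourier ?g (0 - j) = 0" if "j \<noteq> 0" for j
      by (rule z) (use that \<sigma> in \<open>auto simp: mult_less_0_iff zero_less_mult_iff\<close>)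
    then have "((\<lambda>j. fourier (f i) j * fourier ?g (0 - j)) has_sum fourier (f i) 0 * fourier ?g (0 - 0)) UNIV"
      by (intro has_sum_finite_neutralI[of "{0}"]) auto
    with conv[of 0] show ?thesis using has_sum_unique by fastforce
  qed
  ultimately show ?case using insert.hyps insert.prems g by (auto intro!: ess_bounded_mult)
qed

text \<open>
  Identifies \<open>G_const\<close> with the determinants of the diagonal blocks of the triangular Toeplitz sections.
\<close>

lemma fourier_det_one_sided:
  fixes v :: "complex \<Rightarrow> complex^'n^'n"
  assumes v: "v \<in> K11" and \<sigma>: "\<sigma> \<noteq> 0" and z: "\<And>k. \<sigma> * k < 0 \<Longrightarrow> mfourier v k = 0"
  shows "fourier (\<lambda>z. det (v z)) 0 = det (mfourier v 0)"
proof -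
  have L: "v \<in> Linf" using v by (simp add: K11_def)
  have *: "ess_bounded (\<lambda>\<theta>. \<Prod>i\<in>UNIV. v (cis \<theta>) $ i $ \<pi> i) \<and>
     fourier (\<lambda>z. \<Prod>i\<in>UNIV. v z $ i $ \<pi> i) 0 = (\<Prod>i\<in>UNIV. mfourier v 0 $ i $ \<pi> i)" for \<pi> :: "'n \<Rightarrow> 'n"
  proof -
    have "fourier (\<lambda>z. v z $ i $ \<pi> i) k = 0" if "\<sigma> * k < 0" for i k
    proof -
      have "mfourier v k $ i $ \<pi> i = 0" using z[OF that] by simp
      then show ?thesis by (simp add: mfourier_def)
    qed
    with fourier_prod_one_sided[OF \<sigma>, of UNIV "\<lambda>i z. v z $ i $ \<pi> i"]
    show ?thesis using ess_bounded_entry[OF L] K11_entry_summable[OF v] by (simp add: mfourier_def)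
  qed
  have c: "fourier (\<lambda>z. c * f z) 0 = c * fourier f 0" for c f
    by (simp add: fourier_def mult.assoc)
  show ?thesis
    unfolding det_def
    by (subst fourier_finite_sum) (use * in \<open>auto simp: c intro!: ess_bounded_mult ess_bounded_const\<close>)
qed

section \<open>The determinant formula\<close>

theorem theorem1p2:
  fixes a um up vp vm b c :: "complex \<Rightarrow> complex^'n^'n"
    and n :: nat
  assumes "a \<in> Phi_r K11 \<inter> Phi_l K11"
    and "right_factorization K11 a um up"
    and "left_factorization K11 a vp vm"
    and "b = vm \<odot> minv up"
    and "c = minv um \<odot> vp"
    and "n \<ge> 1"
  shows "det_toeplitz n a =
    G_const vp vm ^ n * E_const b c * 2 powi (- int (n * CARD('n))) *
    fredholm_det (id + proj_P - (laurent c \<circ> proj_Q n \<circ> laurent b))"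
proof -
  have um: "unit_in (K11 \<inter> Hinf_minus) um" and up: "unit_in (K11 \<inter> Hinf_plus) up"
    and vm: "unit_in (K11 \<inter> Hinf_minus) vm" and vp: "unit_in (K11 \<inter> Hinf_plus) vp"
    and aer: "AE \<theta> in angles. a (cis \<theta>) = (um \<odot> up) (cis \<theta>)"
    and ael: "AE \<theta> in angles. a (cis \<theta>) = (vp \<odot> vm) (cis \<theta>)"
    using assms(2,3) by (auto simp: right_factorization_def left_factorization_def)
  have K: "um \<in> K11" "minv um \<in> K11" "up \<in> K11" "minv up \<in> K11"
    "vm \<in> K11" "minv vm \<in> K11" "vp \<in> K11" "minv vp \<in> K11"
    and Hm: "um \<in> Hinf_minus" "minv um \<in> Hinf_minus" "vm \<in> Hinf_minus" "minv vm \<in> Hinf_minus"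
    and Hp: "up \<in> Hinf_plus" "minv up \<in> Hinf_plus" "vp \<in> Hinf_plus" "minv vp \<in> Hinf_plus"
    using um up vm vp by (auto simp: unit_in_def)
  have L: "x \<in> Linf" if "x \<in> K11" for x :: "complex \<Rightarrow> complex^'n^'n" using that by (simp add: K11_def)
  note rep = represents_laurent_bmat and rmult = represents_mult
  define Um Umi Up Upi Vm Vmi Vp Vpi where "Um = laurent_bmat um" and "Umi = laurent_bmat (minv um)"
    and "Up = laurent_bmat up" and "Upi = laurent_bmat (minv up)"
    and "Vm = laurent_bmat vm" and "Vmi = laurent_bmat (minv vm)"
    and "Vp = laurent_bmat vp" and "Vpi = laurent_bmat (minv vp)"
  note d = Um_def Umi_def Up_def Upi_def Vm_def Vmi_def Vp_def Vpi_def
  define P Q :: "(int \<times> 'n) set" where "P = rows_from 0" and "Q = rows_from (int n)"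
  have QP: "Q \<subseteq> P" by (auto simp: P_def Q_def rows_from_def)
  have PQ: "P - Q = {0..<int n} \<times> UNIV" by (simp add: P_def Q_def rows_between)
  have fin: "finite (P - Q)" and card: "card (P - Q) = n * CARD('n)"
    by (simp_all add: PQ card_cartesian_product)
  have inv: "Um * Umi = 1" "Umi * Um = 1" "Up * Upi = 1" "Upi * Up = 1"
    "Vm * Vmi = 1" "Vmi * Vm = 1" "Vp * Vpi = 1" "Vpi * Vp = 1"
    unfolding d by (rule laurent_bmat_inverse[OF um] laurent_bmat_inverse[OF up]
      laurent_bmat_inverse[OF vm] laurent_bmat_inverse[OF vp])+
  have ra: "represents (Um * Up) (um \<odot> up)" "represents (Vp * Vm) (vp \<odot> vm)"
    unfolding d by (intro rmult rep K L)+
  have mf: "mfourier a k = mfourier (um \<odot> up) k" "mfourier a k = mfourier (vp \<odot> vm) k" for k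
    by (intro mfourier_cong_AE aer ael L K)+
  have fac: "Um * Up = Vp * Vm"
    using ra by (rule represents_eqI) (simp add: mf[symmetric])
  have tri: "upper P Um" "upper P Umi" "lower P Up" "lower P Upi" "upper P Vm" "upper P Vmi"
    "upper Q Vm" "upper Q Vmi" "lower P Vp" "lower P Vpi" "lower Q Vp"
    unfolding d P_def Q_def by (intro upper_laurent_bmat lower_laurent_bmat K Hm Hp)+
  define B C where "B = Vm * Upi" and "C = Up * Vmi"
  have C_eq: "C = Umi * Vp"
  proof -
    have "Umi * (Um * Up) * Vmi = Umi * (Vp * Vm) * Vmi" by (simp only: fac)
    then show ?thesis using inv by (simp add: C_def mult.assoc mult_eq_1_cancel[OF inv(2)])
  qed
  have rB: "represents B b" unfolding B_def d assms(4) by (intro rmult rep K L)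
  have rC: "represents C c" unfolding C_eq d assms(5) by (intro rmult rep K L)
  have s1: "summable_bmat (coord_proj P * Up * coord_proj (- P))" "summable_bmat (coord_proj P * Upi * coord_proj (- P))"
    and s2: "summable_bmat (coord_proj (- Q) * Vmi * coord_proj Q)"
    unfolding d P_def Q_def by (intro summable_laurent_corners K)+
  \<comment> \<open>Both identities reduce to the determinant of the compression of \<open>B * P * C\<close> to \<open>Q\<close>.\<close>
  note pd = fdet_projection_difference[OF QP fin inv(3,4,5,6) tri(3,4,7,8) s1(1) s2, folded B_def C_def]
  note tm = toeplitz_minor_identity[OF QP fin inv(1,2) tri(1,2) inv(3,4) tri(3,4) inv(5,6) tri(5,6,7)
    inv(7,8) tri(9,10,11) fac s1(2), folded B_def C_def]
  have R: "fredholm_det (id + proj_P - (laurent c \<circ> proj_Q n \<circ> laurent b)) = fdet (1 + coord_proj P - C * coord_proj Q * B)"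
    unfolding P_def Q_def by (rule fredholm_det_laurent[OF rB rC pd(2)[unfolded P_def Q_def]])
  have J: "fredholm_det (id - (hankel b \<circ> hankel_tilde c)) = fdet (1 - coord_proj P * B * coord_proj (- P) * C * coord_proj P)"
    unfolding P_def by (rule fredholm_det_hankel[OF rB rC tm(3)[unfolded P_def]])
  have T: "det_toeplitz n a = det_on (P - Q) (entries (Um * Up))"
  proof -
    let ?\<iota> = "\<lambda>(j, p). (int j, p) :: int \<times> 'n"
    have im: "P - Q = ?\<iota> ` ({..<n} \<times> UNIV)"
    proof (intro equalityI subsetI)
      fix t assume "t \<in> P - Q"
      then have "t = ?\<iota> (nat (fst t), snd t)" "(nat (fst t), snd t) \<in> {..<n} \<times> UNIV"
        by (auto simp: PQ)
      then show "t \<in> ?\<iota> ` ({..<n} \<times> UNIV)" by (rule image_eqI)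
    qed (auto simp: PQ)
    show ?thesis
      unfolding im det_toeplitz_def using ra(1)
      by (subst det_on_reindex)
         (auto simp: inj_on_def represents_def mf(1) intro!: det_on_cong)
  qed
  have "det_on (P - Q) (entries Vp) = det (mfourier vp 0) ^ n"
    unfolding PQ d using Hp(3) by (intro det_on_triangular_toeplitz rep K) (simp add: Hinf_plus_def)
  moreover have "det_on (P - Q) (entries Vm) = det (mfourier vm 0) ^ n"
    unfolding PQ d using Hm(3) by (intro det_on_triangular_toeplitz rep K) (simp add: Hinf_minus_def)
  moreover have "fourier (\<lambda>z. det (vp z)) 0 = det (mfourier vp 0)"
  proof (rule fourier_det_one_sided[where \<sigma> = 1, OF K(7)])
    fix k :: int assume "1 * k < 0"
    then have "- k > 0" by simp
    then have "mfourier vp (- (- k)) = 0" using Hp(3) unfolding Hinf_plus_def by blast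
    then show "mfourier vp k = 0" by simp
  qed simp
  moreover have "fourier (\<lambda>z. det (vm z)) 0 = det (mfourier vm 0)"
    by (rule fourier_det_one_sided[where \<sigma> = "-1", OF K(5)]) (use Hm(3) in \<open>auto simp: Hinf_minus_def\<close>)
  ultimately have G: "det_on (P - Q) (entries Vp) * det_on (P - Q) (entries Vm) = G_const vp vm ^ n"
    by (simp add: G_const_def power_mult_distrib)
  let ?X = "fdet (1 - coord_proj Q + coord_proj Q * B * coord_proj P * C * coord_proj Q)"
  have "det_toeplitz n a * fdet (1 - coord_proj P * B * coord_proj (- P) * C * coord_proj P) = G_const vp vm ^ n * ?X"
    using tm(1) by (simp add: T G)
  then have "det_toeplitz n a = G_const vp vm ^ n * E_const b c * ?X"
    using tm(2) by (simp add: E_const_def J field_simps)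
  moreover have "?X = 2 powi (- int (n * CARD('n))) * fdet (1 + coord_proj P - C * coord_proj Q * B)"
    unfolding pd(1) card power_int_minus power_int_of_nat by simp
  ultimately show ?thesis by (simp add: R)
qed

end
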